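(* Let $(C, k)$ be an instance of WSAT$^+[t]$ ($t \geq 2$) such that $C$ has genus $g(n) = n^{o(1)}$, where $n$ is the number of variables in $C$. There is an fpt-time algorithm that either decides the instance $(C, k)$ correctly, or reduces it to $h(k)n^{O(1)}$ many instances $(C', k')$ of WSAT$^+[t]$, where $h$ is a computable function of $k$ and $k' \leq k$, such that $(C, k)$ is a yes-instance if and only if at least one of the instances $(C', k')$ is, and such that each instance $(C', k')$ satisfies: (1) the number of critical gates in $C'$ is at most $2k'$, (2) every variable in $C'$ is incoming to gates in at most two subtrees $T_p, T_q$ of $T_{C'}$ rooted at critical gates $p, q$ of $C'$, and (3) the genus of $C'$ is at most $g(n)$.
   Context: A $\Pi_t$ circuit is a Boolean circuit in normalized form of depth at most $t$: the output gate is an AND-gate, every non-variable gate has outdegree at most 1, and starting from the output gate the gates alternate between AND-gates and OR-gates (no NOT-gates; input vertices are literals). Monotone means all input literals are positive. WSAT$^+[t]$ is the problem: given a monotone $\Pi_t$ circuit $C$ and a parameter $k$, decide whether $C$ has a satisfying assignment of weight (number of variables set to 1) exactly $k$. The genus of a circuit is the genus of its underlying undirected graph after the output gate is removed. A critical gate is an OR-gate that is incoming to the output gate. Removing the literals from $C$ yields a graph whose underlying undirected graph is a tree $T_C$, rooted at the output gate; $T_p$ denotes the subtree rooted at gate $p$. Fpt-time means $f(k)N^{O(1)}$ for a computable $f$ and input length $N$. The $o(\cdot)$ notation is the effective one. *)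

theory Defs
  imports Complex_Main "HOL-Combinatorics.Orbits"
begin

section \<open>Model of computation\<close>

text \<open>
  A variable-free form of the WHILE language over binary trees. Every elementary step is charged
  the size of the tree it is applied to, so the size of the output never exceeds the running time
  (copying by \<open>PPair\<close> is not free) and time is polynomially related to Turing machine time.
  The tree \<open>Leaf\<close> is the truth value "false", all other trees count as "true".
\<close>

datatype tree = Leaf | Node tree tree

fun tsize :: "tree \<Rightarrow> nat" where
  "tsize Leaf = 1"
| "tsize (Node l r) = tsize l + tsize r + 1"

fun left :: "tree \<Rightarrow> tree" where
  "left Leaf = Leaf"
| "left (Node l r) = l"

fun right :: "tree \<Rightarrow> tree" where
  "right Leaf = Leaf"
| "right (Node l r) = r"

fun enc_bool :: "bool \<Rightarrow> tree" where
  "enc_bool False = Leaf"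
| "enc_bool True = Node Leaf Leaf"

datatype prog =
    PId
  | PNil
  | PLeft
  | PRight
  | PEq
  | PPair prog prog
  | PSeq prog prog
  | PIf prog prog prog
  | PWhile prog prog

text \<open>\<open>runs p x y \<tau>\<close>: program \<open>p\<close> on input \<open>x\<close> halts with output \<open>y\<close> after time \<open>\<tau>\<close>.\<close>

inductive runs :: "prog \<Rightarrow> tree \<Rightarrow> tree \<Rightarrow> nat \<Rightarrow> bool" where
  runs_Id: "runs PId x x (tsize x)"
| runs_Nil: "runs PNil x Leaf (tsize x)"
| runs_Left: "runs PLeft x (left x) (tsize x)"
| runs_Right: "runs PRight x (right x) (tsize x)"
| runs_Eq: "runs PEq x (enc_bool (left x = right x)) (tsize x + 2)"
| runs_Pair: "runs p x y a \<Longrightarrow> runs q x z b \<Longrightarrow> runs (PPair p q) x (Node y z) (a + b + tsize x)"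
| runs_Seq: "runs p x y a \<Longrightarrow> runs q y z b \<Longrightarrow> runs (PSeq p q) x z (a + b + tsize x)"
| runs_If_True:
    "runs c x y a \<Longrightarrow> y \<noteq> Leaf \<Longrightarrow> runs p x z b \<Longrightarrow> runs (PIf c p q) x z (a + b + tsize x)"
| runs_If_False:
    "runs c x Leaf a \<Longrightarrow> runs q x z b \<Longrightarrow> runs (PIf c p q) x z (a + b + tsize x)"
| runs_While_stop:
    "runs c x Leaf a \<Longrightarrow> runs (PWhile c p) x x (a + tsize x)"
| runs_While_step:
    "runs c x y a \<Longrightarrow> y \<noteq> Leaf \<Longrightarrow> runs p x z b \<Longrightarrow> runs (PWhile c p) z w d \<Longrightarrow>
     runs (PWhile c p) x w (a + b + d + tsize x)"

fun enc_list :: "('a \<Rightarrow> tree) \<Rightarrow> 'a list \<Rightarrow> tree" where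
  "enc_list e [] = Leaf"
| "enc_list e (x # xs) = Node (e x) (enc_list e xs)"

fun enc_unary :: "nat \<Rightarrow> tree" where
  "enc_unary 0 = Leaf"
| "enc_unary (Suc n) = Node Leaf (enc_unary n)"

fun enc_binary :: "nat \<Rightarrow> tree" where
  "enc_binary n = (if n = 0 then Leaf else Node (enc_bool (odd n)) (enc_binary (n div 2)))"

declare enc_binary.simps [simp del]

definition computable :: "(nat \<Rightarrow> nat) \<Rightarrow> bool" where
  "computable f \<longleftrightarrow> (\<exists>p. \<forall>n. \<exists>\<tau>. runs p (enc_unary n) (enc_unary (f n)) \<tau>)"


section \<open>Effective asymptotics\<close>

definition effective_smallo :: "(nat \<Rightarrow> real) \<Rightarrow> (nat \<Rightarrow> real) \<Rightarrow> bool" where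
  "effective_smallo e b \<longleftrightarrow>
     (\<exists>s :: nat \<Rightarrow> nat. computable s \<and> mono s \<and> filterlim s at_top at_top \<and>
        (\<forall>\<^sub>F n in sequentially. e n \<le> b n / real (s n)))"

text \<open>\<open>g(n) = n\<^bsup>o(1)\<^esup>\<close>\<close>

definition subpolynomial :: "(nat \<Rightarrow> nat) \<Rightarrow> bool" where
  "subpolynomial g \<longleftrightarrow>
     (\<exists>e :: nat \<Rightarrow> real. effective_smallo e (\<lambda>_. 1) \<and>
        (\<forall>\<^sub>F n in sequentially. real (g n) \<le> real n powr e n))"


section \<open>Genus of a graph\<close>

text \<open>
  An undirected graph is given by its finite vertex set \<open>V\<close> and the symmetric irreflexive set \<open>D\<close>
  of its darts (each edge contributes both of its orientations). Up to homeomorphism, the cellular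
  embeddings of a connected graph in closed orientable surfaces are its rotation systems: a cyclic
  order \<open>\<sigma>\<close> of the darts leaving each vertex. The faces are the orbits of \<open>\<sigma> \<circ> prod.swap\<close>; an
  isolated vertex has one face and no dart.
\<close>

definition rotation_system :: "('a \<times> 'a) set \<Rightarrow> ('a \<times> 'a \<Rightarrow> 'a \<times> 'a) \<Rightarrow> bool" where
  "rotation_system D \<sigma> \<longleftrightarrow>
     \<sigma> permutes D \<and> (\<forall>d\<in>D. orbit \<sigma> d = {d'\<in>D. fst d' = fst d})"

definition num_faces :: "'a set \<Rightarrow> ('a \<times> 'a) set \<Rightarrow> ('a \<times> 'a \<Rightarrow> 'a \<times> 'a) \<Rightarrow> nat" where
  "num_faces V D \<sigma> = card (orbit (\<sigma> \<circ> prod.swap) ` D) + card {v\<in>V. v \<notin> fst ` D}"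

definition num_components :: "'a set \<Rightarrow> ('a \<times> 'a) set \<Rightarrow> nat" where
  "num_components V D = card ((\<lambda>v. D\<^sup>* `` {v}) ` V)"

text \<open>
  The sum over the components of Euler's formula \<open>|V| - |E| + |F| = 2 - 2\<gamma>\<close>: the genus of a graph
  is the sum of the genera of its components.
\<close>

definition graph_genus :: "'a set \<Rightarrow> ('a \<times> 'a) set \<Rightarrow> nat" where
  "graph_genus V D = (LEAST \<gamma>. \<exists>\<sigma>. rotation_system D \<sigma> \<and>
     int (card V) - int (card D div 2) + int (num_faces V D \<sigma>)
       = 2 * int (num_components V D) - 2 * int \<gamma>)"


section \<open>Circuits\<close>

text \<open>\<open>Lit True x\<close> is the literal \<open>x\<close>, \<open>Lit False x\<close> its negation. Arcs point towards the output.\<close>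

datatype label = And | Or | Lit bool nat

record circuit =
  nodes :: "(nat \<times> label) list"
  arcs :: "(nat \<times> nat) list"
  out :: nat

definition verts :: "circuit \<Rightarrow> nat set" where
  "verts C = fst ` set (nodes C)"

definition arc_rel :: "circuit \<Rightarrow> (nat \<times> nat) set" where
  "arc_rel C = set (arcs C)"

definition and_gates :: "circuit \<Rightarrow> nat set" where
  "and_gates C = {v. (v, And) \<in> set (nodes C)}"

definition or_gates :: "circuit \<Rightarrow> nat set" where
  "or_gates C = {v. (v, Or) \<in> set (nodes C)}"

definition gates :: "circuit \<Rightarrow> nat set" where
  "gates C = and_gates C \<union> or_gates C"

definition lit_verts :: "circuit \<Rightarrow> nat set" where
  "lit_verts C = {v. \<exists>b x. (v, Lit b x) \<in> set (nodes C)}"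

definition variables :: "circuit \<Rightarrow> nat set" where
  "variables C = {x. \<exists>b v. (v, Lit b x) \<in> set (nodes C)}"

text \<open>
  The sources of the underlying acyclic digraph are exactly the literals, and no literal labels two
  vertices. A literal may have outdegree 0; its variable still counts as a variable of the circuit.
\<close>

definition is_circuit :: "circuit \<Rightarrow> bool" where
  "is_circuit C \<longleftrightarrow>
     distinct (map fst (nodes C)) \<and> distinct (arcs C) \<and>
     arc_rel C \<subseteq> verts C \<times> verts C \<and> acyclic (arc_rel C) \<and>
     lit_verts C = {v \<in> verts C. \<nexists>u. (u, v) \<in> arc_rel C} \<and>
     (\<forall>u v b x. (u, Lit b x) \<in> set (nodes C) \<and> (v, Lit b x) \<in> set (nodes C) \<longrightarrow> u = v) \<and>
     out C \<in> gates C \<and> (\<forall>v\<in>gates C. (v, out C) \<in> (arc_rel C)\<^sup>*)"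

definition depth :: "circuit \<Rightarrow> nat" where
  "depth C = Max {l. \<exists>v\<in>lit_verts C. (v, out C) \<in> arc_rel C ^^ l}"

definition pi_circuit :: "nat \<Rightarrow> circuit \<Rightarrow> bool" where
  "pi_circuit t C \<longleftrightarrow>
     is_circuit C \<and> depth C \<le> t \<and> out C \<in> and_gates C \<and>
     (\<forall>v\<in>gates C. card {w. (v, w) \<in> arc_rel C} \<le> 1) \<and>
     (\<forall>v\<in>gates C. \<forall>w\<in>gates C. (v, w) \<in> arc_rel C \<longrightarrow> (v \<in> and_gates C \<longleftrightarrow> w \<in> or_gates C))"

definition monotone_circuit :: "circuit \<Rightarrow> bool" where
  "monotone_circuit C \<longleftrightarrow> (\<forall>v b x. (v, Lit b x) \<in> set (nodes C) \<longrightarrow> b)"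

text \<open>
  \<open>evaluates C A v\<close>: vertex \<open>v\<close> has value 1 under the assignment that sets exactly the variables
  in \<open>A\<close> to 1. There are no negation gates, hence an inductive definition suffices.
\<close>

inductive evaluates :: "circuit \<Rightarrow> nat set \<Rightarrow> nat \<Rightarrow> bool" for C A where
  "(v, Lit b x) \<in> set (nodes C) \<Longrightarrow> (x \<in> A \<longleftrightarrow> b) \<Longrightarrow> evaluates C A v"
| "v \<in> and_gates C \<Longrightarrow> (\<And>u. (u, v) \<in> arc_rel C \<Longrightarrow> evaluates C A u) \<Longrightarrow> evaluates C A v"
| "v \<in> or_gates C \<Longrightarrow> (u, v) \<in> arc_rel C \<Longrightarrow> evaluates C A u \<Longrightarrow> evaluates C A v"

text \<open>\<open>C\<close> is an admissible circuit for the problem WSAT\<open>\<^sup>+[t]\<close>; the parameter \<open>k\<close> is unrestricted.\<close>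

definition wsat_mono_instance :: "nat \<Rightarrow> circuit \<Rightarrow> bool" where
  "wsat_mono_instance t C \<longleftrightarrow> pi_circuit t C \<and> monotone_circuit C"

definition yes_instance :: "circuit \<Rightarrow> nat \<Rightarrow> bool" where
  "yes_instance C k \<longleftrightarrow> (\<exists>A \<subseteq> variables C. card A = k \<and> evaluates C A (out C))"

definition circuit_genus :: "circuit \<Rightarrow> nat" where
  "circuit_genus C =
     (let V = verts C - {out C} in
      graph_genus V ((arc_rel C \<union> (arc_rel C)\<inverse>) \<inter> V \<times> V))"

definition critical_gates :: "circuit \<Rightarrow> nat set" where
  "critical_gates C = {p \<in> or_gates C. (p, out C) \<in> arc_rel C}"

text \<open>The vertices of the subtree \<open>T\<^sub>p\<close> of \<open>T\<^sub>C\<close>\<close>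

definition subtree :: "circuit \<Rightarrow> nat \<Rightarrow> nat set" where
  "subtree C p = {q \<in> gates C. (q, p) \<in> (arc_rel C \<inter> gates C \<times> gates C)\<^sup>*}"

text \<open>The critical gates \<open>p\<close> such that \<open>x\<close> is incoming to a gate in \<open>T\<^sub>p\<close>\<close>

definition critical_gates_of_var :: "circuit \<Rightarrow> nat \<Rightarrow> nat set" where
  "critical_gates_of_var C x =
     {p \<in> critical_gates C.
        \<exists>b v. (v, Lit b x) \<in> set (nodes C) \<and> (\<exists>q\<in>subtree C p. (v, q) \<in> arc_rel C)}"


section \<open>Encoding of instances\<close>

fun enc_label :: "label \<Rightarrow> tree" where
  "enc_label And = Node Leaf (enc_bool False)"
| "enc_label Or = Node Leaf (enc_bool True)"
| "enc_label (Lit b x) = Node (Node Leaf (enc_bool b)) (enc_binary x)"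

definition enc_circuit :: "circuit \<Rightarrow> tree" where
  "enc_circuit C =
     Node (enc_list (\<lambda>(v, l). Node (enc_binary v) (enc_label l)) (nodes C))
       (Node (enc_list (\<lambda>(u, v). Node (enc_binary u) (enc_binary v)) (arcs C))
         (enc_binary (out C)))"

definition enc_instance :: "circuit \<times> nat \<Rightarrow> tree" where
  "enc_instance = (\<lambda>(C, k). Node (enc_circuit C) (enc_unary k))"

datatype result = Decided bool | Reduced "(circuit \<times> nat) list"

fun enc_result :: "result \<Rightarrow> tree" where
  "enc_result (Decided b) = Node Leaf (enc_bool b)"
| "enc_result (Reduced Is) = Node (Node Leaf Leaf) (enc_list enc_instance Is)"

end

theory Submission
  imports Defs
begin

text \<open>
  Branch on the variables that are incoming to at least three of the subtrees \<open>T\<^sub>p\<close>, where \<open>p\<close> ranges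
  over the first \<open>2k + 1\<close> critical gates not yet satisfied (\<open>k\<close> being the remaining weight). A solution
  avoiding all these variables hits at most \<open>2k\<close> of the gates, so if more than \<open>2k\<close> critical gates are
  unsatisfied, one of the variables must be set to 1; otherwise they may also all be set to 0, which
  gives an instance of the required form. By Euler's formula, applied to the graph formed by the
  subtrees and three arcs from each branching variable, there are at most \<open>8k + 4 + 4g\<close> branching
  variables. Hence the search tree has at most \<open>(8k + 5 + 4g)\<^sup>k\<close> nodes, and this is at most \<open>h(k) n\<close>
  for a computable \<open>h\<close> since \<open>g = n\<^bsup>o(1)\<^esup>\<close> effectively.
\<close>

section \<open>Orbits of permutations\<close>

text \<open>The genus is a minimum over rotation systems, so the counting argument needs Euler's
  formula as an inequality for every rotation system, and monotonicity of the genus under subgraphs.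
  Both come from one computation: glueing an edge composes the face permutation with a
  transposition, which merges two cycles or splits one.

  Choosing only \<open>2k + 1\<close> gates bounds the number of branching variables independently
  of the number of critical gates, and one gate beyond \<open>2k\<close> already suffices to exclude
  solutions that avoid all branching variables.

  Normalized circuits contain no constants. After a substitution a gate therefore survives only if
  neither it nor any gate above it has become constant. If the output itself becomes constant, the
  search node yields a fixed yes-instance or no instance at all; an empty list of instances thus
  means "no".

  The program computes neither the genus nor \<open>g\<close>, which is not assumed to be
  computable; both enter only the analysis of the running time and of the number of
  instances.\<close>

lemma orbit_self:
  assumes "\<phi> permutes D" "finite D"
  shows "x \<in> orbit \<phi> x"
  using assms by (auto intro!: permutation_self_in_orbit simp: permutation_permutes)

lemma orbit_eq_orbit:
  assumes "\<phi> permutes D" "finite D" "y \<in> orbit \<phi> x"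
  shows "orbit \<phi> y = orbit \<phi> x"
  using cyclic_on_orbit[OF assms(1,2)] assms(3) by (rule orbit_cyclic_eq3)

lemma orbit_least:
  assumes "f x \<in> A" "\<And>y. y \<in> A \<Longrightarrow> f y \<in> A"
  shows "orbit f x \<subseteq> A"
proof
  fix y assume "y \<in> orbit f x" then show "y \<in> A"
    by induct (use assms in auto)
qed

text \<open>The new map exchanges the images of \<open>a\<close> and \<open>b\<close>: starting at
  \<open>a\<close> it runs through the whole cycle of \<open>b\<close>, and from \<open>b\<close> it
  continues with the cycle of \<open>a\<close>. All other cycles are untouched.\<close>

lemma orbit_transpose_merge:
  assumes \<phi>: "\<phi> permutes D" "finite D" and ab: "a \<in> D" "b \<in> D" "b \<notin> orbit \<phi> a"
  defines "\<psi> \<equiv> \<phi> \<circ> transpose a b"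
  shows "orbit \<psi> a = orbit \<phi> a \<union> orbit \<phi> b"
    and "d \<notin> orbit \<phi> a \<union> orbit \<phi> b \<Longrightarrow> orbit \<psi> d = orbit \<phi> d"
proof -
  note self = orbit_self[OF \<phi>] and eq = orbit_eq_orbit[OF \<phi>]
  have ne: "a \<noteq> b" using ab self by auto
  have pa: "\<psi> a = \<phi> b" and pb: "\<psi> b = \<phi> a"
    and po: "\<And>y. y \<noteq> a \<Longrightarrow> y \<noteq> b \<Longrightarrow> \<psi> y = \<phi> y"
    by (auto simp: \<psi>_def transpose_def)
  have "a \<notin> orbit \<phi> b" using ab(3) eq self by metis
  have sub: "orbit \<phi> b \<subseteq> orbit \<psi> a"
  proof
    fix y assume "y \<in> orbit \<phi> b" then show "y \<in> orbit \<psi> a"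
    proof induct
      case base then show ?case by (metis orbit.base pa)
    next
      case (step y)
      then have "y \<noteq> a" using \<open>a \<notin> orbit \<phi> b\<close> by auto
      then show ?case using step by (cases "y = b") (metis orbit.base pa, metis orbit.step po)
    qed
  qed
  have sub2: "orbit \<phi> a \<subseteq> orbit \<psi> a"
  proof
    fix y assume "y \<in> orbit \<phi> a" then show "y \<in> orbit \<psi> a"
    proof induct
      case base
      have "b \<in> orbit \<psi> a" using sub self by auto
      then show ?case by (metis orbit.step pb)
    next
      case (step y)
      then have "y \<noteq> b" using ab(3) by auto
      have "b \<in> orbit \<psi> a" using sub self by auto
      then show ?case using step \<open>y \<noteq> b\<close> by (cases "y = a") (metis orbit.step pb, metis orbit.step po)
    qed
  qed
  have "orbit \<psi> a \<subseteq> orbit \<phi> a \<union> orbit \<phi> b"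
  proof (rule orbit_least)
    show "\<psi> a \<in> orbit \<phi> a \<union> orbit \<phi> b" by (simp add: pa orbit.base)
    fix y assume "y \<in> orbit \<phi> a \<union> orbit \<phi> b"
    then show "\<psi> y \<in> orbit \<phi> a \<union> orbit \<phi> b"
      by (cases "y = a"; cases "y = b") (auto simp: pa pb po intro: orbit.intros)
  qed
  then show "orbit \<psi> a = orbit \<phi> a \<union> orbit \<phi> b" using sub sub2 by auto
  show "orbit \<psi> d = orbit \<phi> d" if "d \<notin> orbit \<phi> a \<union> orbit \<phi> b"
  proof (rule orbit_cong[OF self])
    fix s assume "s \<in> orbit \<phi> d"
    then have "s \<noteq> a" "s \<noteq> b" using that eq[of s d] self by auto
    then show "\<psi> s = \<phi> s" by (rule po)
  qed
qed

lemma card_orbits_transpose_merge: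
  assumes \<phi>: "\<phi> permutes D" "finite D" and ab: "a \<in> D" "b \<in> D" "b \<notin> orbit \<phi> a"
  shows "card (orbit (\<phi> \<circ> transpose a b) ` D) + 1 = card (orbit \<phi> ` D)"
proof -
  define \<psi> where "\<psi> = \<phi> \<circ> transpose a b"
  note self = orbit_self[OF \<phi>] and eq = orbit_eq_orbit[OF \<phi>]
  note m = orbit_transpose_merge[OF \<phi> ab, folded \<psi>_def]
  have \<psi>: "\<psi> permutes D" unfolding \<psi>_def
    using \<phi> ab by (intro permutes_compose permutes_swap_id) auto
  let ?R = "orbit \<phi> ` {d\<in>D. d \<notin> orbit \<phi> a \<union> orbit \<phi> b}"
  have fin: "finite ?R" using \<phi> by auto
  have 1: "orbit \<phi> ` D = insert (orbit \<phi> a) (insert (orbit \<phi> b) ?R)"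
    using ab eq by auto
  have 2: "orbit \<psi> ` D = insert (orbit \<phi> a \<union> orbit \<phi> b) ?R"
  proof -
    have "orbit \<psi> d = orbit \<phi> a \<union> orbit \<phi> b" if "d \<in> orbit \<phi> a \<union> orbit \<phi> b" for d
      using that m(1) orbit_eq_orbit[OF \<psi> \<phi>(2), of d a] by auto
    then have "orbit \<psi> d = (if d \<in> orbit \<phi> a \<union> orbit \<phi> b then orbit \<phi> a \<union> orbit \<phi> b else orbit \<phi> d)" for d
      using m(2) by auto
    then have "orbit \<psi> ` D = (\<lambda>d. if d \<in> orbit \<phi> a \<union> orbit \<phi> b then orbit \<phi> a \<union> orbit \<phi> b else orbit \<phi> d) ` D"
      by auto
    also have "\<dots> = insert (orbit \<phi> a \<union> orbit \<phi> b) ?R"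
      using ab(1) self by (auto simp: image_iff)
    finally show ?thesis .
  qed
  have "orbit \<phi> a \<noteq> orbit \<phi> b" using ab self by auto
  moreover have "orbit \<phi> a \<notin> ?R" "orbit \<phi> b \<notin> ?R" using self by auto
  moreover have "orbit \<phi> a \<union> orbit \<phi> b \<notin> ?R"
  proof
    assume "orbit \<phi> a \<union> orbit \<phi> b \<in> ?R"
    then obtain d where "orbit \<phi> a \<union> orbit \<phi> b = orbit \<phi> d" "d \<notin> orbit \<phi> a \<union> orbit \<phi> b" by auto
    then show False using self by auto
  qed
  ultimately show ?thesis unfolding \<psi>_def[symmetric] 1 2 using fin by simp
qed

text \<open>With \<open>b\<close> in position \<open>n\<close> on a cycle of length \<open>m\<close>
  through \<open>a\<close>, the new map jumps from \<open>a\<close> to position \<open>n + 1\<close>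
  and then returns to \<open>a\<close> without passing \<open>b\<close>.\<close>

lemma orbit_transpose_split:
  assumes \<phi>: "\<phi> permutes D" "finite D" and ab: "a \<noteq> b" "b \<in> orbit \<phi> a"
  shows "b \<notin> orbit (\<phi> \<circ> transpose a b) a"
proof -
  define \<psi> where "\<psi> = \<phi> \<circ> transpose a b"
  have inj: "inj (\<phi> ^^ n)" for n
    using \<phi>(1) by (simp add: permutes_inj inj_fn)
  have pa: "\<psi> a = \<phi> b" and po: "\<And>y. y \<noteq> a \<Longrightarrow> y \<noteq> b \<Longrightarrow> \<psi> y = \<phi> y"
    by (auto simp: \<psi>_def transpose_def)
  have ex: "\<exists>m>0. (\<phi> ^^ m) a = a" using orbit_self[OF \<phi>, of a] by (auto simp: orbit_altdef)
  define m where "m = (LEAST m. m > 0 \<and> (\<phi> ^^ m) a = a)"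
  have m: "m > 0" "(\<phi> ^^ m) a = a" using LeastI_ex[OF ex] by (auto simp: m_def)
  have ml: "0 < i \<Longrightarrow> i < m \<Longrightarrow> (\<phi> ^^ i) a \<noteq> a" for i
    using not_less_Least[of i "\<lambda>m. m > 0 \<and> (\<phi> ^^ m) a = a"] by (auto simp: m_def)
  obtain n where n: "n < m" "b = (\<phi> ^^ n) a"
    using ab(2) orbit_altdef_bounded[OF m(2,1)] by auto
  define O' where "O' = {(\<phi> ^^ i) a | i. n < i \<and> i \<le> m}"
  have b: "b \<notin> O'"
  proof
    assume "b \<in> O'"
    then obtain i where i: "n < i" "i \<le> m" "(\<phi> ^^ i) a = (\<phi> ^^ n) a" using n by (auto simp: O'_def)
    have "(\<phi> ^^ n) ((\<phi> ^^ (i - n)) a) = (\<phi> ^^ n) a"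
      using i by (simp flip: funpow_add[THEN fun_cong, unfolded comp_def])
    then have "(\<phi> ^^ (i - n)) a = a" using inj by (auto dest: injD)
    moreover have "n \<noteq> 0" using n ab by (metis funpow_0)
    ultimately show False using ml[of "i - n"] i by auto
  qed
  have "orbit \<psi> a \<subseteq> O'"
  proof (rule orbit_least)
    show 1: "\<psi> a \<in> O'" unfolding pa O'_def using n by (intro CollectI exI[of _ "Suc n"]) auto
    fix y assume y: "y \<in> O'"
    then obtain i where i: "n < i" "i \<le> m" "y = (\<phi> ^^ i) a" by (auto simp: O'_def)
    show "\<psi> y \<in> O'"
    proof (cases "y = a")
      case False
      then have "i < m" using i m(2) by (metis le_neq_implies_less)
      have "\<psi> y = \<phi> y" using False b y by (intro po) auto
      then show ?thesis unfolding O'_def using i \<open>i < m\<close> by (intro CollectI exI[of _ "Suc i"]) auto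
    qed (use 1 in auto)
  qed
  then show ?thesis using b unfolding \<psi>_def by auto
qed

text \<open>Transpositions are involutions, so splitting a cycle is merging two cycles read
  backwards.\<close>

lemma card_orbits_transpose_split:
  assumes \<phi>: "\<phi> permutes D" "finite D" and ab: "a \<in> D" "b \<in> D" "a \<noteq> b" "b \<in> orbit \<phi> a"
  shows "card (orbit (\<phi> \<circ> transpose a b) ` D) = card (orbit \<phi> ` D) + 1"
proof -
  have "\<phi> \<circ> transpose a b permutes D"
    using \<phi> ab by (intro permutes_compose permutes_swap_id) auto
  from card_orbits_transpose_merge[OF this \<phi>(2) ab(1,2) orbit_transpose_split[OF \<phi> ab(3,4)]]
  show ?thesis by (simp add: comp_assoc)
qed

subsection \<open>First return maps\<close>

text \<open>The map induced on \<open>A\<close>, as in dynamics. Deleting edges from an embedded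
  graph replaces the rotation by the map it induces on the remaining darts.\<close>

definition first_return :: "('a \<Rightarrow> 'a) \<Rightarrow> 'a set \<Rightarrow> 'a \<Rightarrow> 'a" where
  "first_return f A x = (f ^^ (LEAST n. n > 0 \<and> (f ^^ n) x \<in> A)) x"

lemma first_return_props:
  assumes "y \<in> orbit f x" "y \<in> A"
  obtains n where "n > 0" "(f ^^ n) x \<in> A" "first_return f A x = (f ^^ n) x"
    "\<And>i. 0 < i \<Longrightarrow> i < n \<Longrightarrow> (f ^^ i) x \<notin> A"
proof -
  let ?P = "\<lambda>n. n > 0 \<and> (f ^^ n) x \<in> A"
  have "\<exists>n. ?P n" using assms by (auto simp: orbit_altdef)
  from LeastI_ex[OF this] show thesis
    using not_less_Least[of _ ?P] by (intro that[of "Least ?P"]) (auto simp: first_return_def)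
qed

lemma first_return_eqI:
  assumes "n > 0" "(f ^^ n) x \<in> A" "\<And>i. 0 < i \<Longrightarrow> i < n \<Longrightarrow> (f ^^ i) x \<notin> A"
  shows "first_return f A x = (f ^^ n) x"
proof -
  have "(LEAST n. n > 0 \<and> (f ^^ n) x \<in> A) = n"
    using assms by (intro Least_equality) (auto simp: not_less[symmetric])
  then show ?thesis by (simp add: first_return_def)
qed

text \<open>A point of \<open>A\<close> that is \<open>n\<close> steps of \<phi> away is fewer than
  \<open>n\<close> steps away from the first return, so strong induction on \<open>n\<close> reaches
  it by returns only.\<close>

lemma orbit_first_return:
  assumes \<phi>: "\<phi> permutes D" "finite D" and d: "d \<in> A"
  shows "orbit (first_return \<phi> A) d = orbit \<phi> d \<inter> A"
proof
  show "orbit (first_return \<phi> A) d \<subseteq> orbit \<phi> d \<inter> A"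
  proof -
    have *: "first_return \<phi> A y \<in> orbit \<phi> d \<inter> A" if y: "y \<in> orbit \<phi> d \<inter> A" for y
    proof -
      from y orbit_self[OF \<phi>] obtain n where "(\<phi> ^^ n) y \<in> A" "first_return \<phi> A y = (\<phi> ^^ n) y"
        by (metis Int_iff first_return_props)
      then show ?thesis using y funpow_in_orbit by fastforce
    qed
    then show ?thesis using orbit_self[OF \<phi>, of d] d by (intro orbit_least) auto
  qed
  have "y \<in> orbit (first_return \<phi> A) d" if "y = (\<phi> ^^ n) d" "n > 0" "y \<in> A" "d \<in> A" for n y d
    using that
  proof (induction n arbitrary: d rule: less_induct)
    case (less n)
    from less.prems have "y \<in> orbit \<phi> d" by (auto simp: orbit_altdef)
    then obtain m where m: "m > 0" "(\<phi> ^^ m) d \<in> A" "first_return \<phi> A d = (\<phi> ^^ m) d"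
      "\<And>i. 0 < i \<Longrightarrow> i < m \<Longrightarrow> (\<phi> ^^ i) d \<notin> A" using first_return_props[of y \<phi> d A] less.prems by metis
    have "m \<le> n" using m(4) less.prems by (metis not_less)
    show ?case
    proof (cases "m = n")
      case True then show ?thesis using m(3) less.prems by (metis orbit.base)
    next
      case False
      have "y = (\<phi> ^^ (n - m)) (first_return \<phi> A d)"
        unfolding m(3) using \<open>m \<le> n\<close> less.prems by (simp flip: funpow_add[THEN fun_cong, unfolded comp_def])
      then have "y \<in> orbit (first_return \<phi> A) (first_return \<phi> A d)"
        using less.IH[of "n - m" "first_return \<phi> A d"] False \<open>m \<le> n\<close> m less.prems by auto
      then show ?thesis by (rule orbit_subset)
    qed
  qed
  then show "orbit \<phi> d \<inter> A \<subseteq> orbit (first_return \<phi> A) d"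
    using d by (auto simp: orbit_altdef)
qed

lemma permutes_first_return:
  assumes \<phi>: "\<phi> permutes D" "finite D" and A: "finite A"
  shows "perm_restrict (first_return \<phi> A) A permutes A"
proof (rule bij_imp_permutes)
  let ?r = "perm_restrict (first_return \<phi> A) A"
  have o: "orbit (first_return \<phi> A) d = orbit \<phi> d \<inter> A" if "d \<in> A" for d
    using orbit_first_return[OF \<phi> that] .
  have into: "?r ` A \<subseteq> A" using o by (force simp: perm_restrict_simps intro: orbit.base)
  have "A \<subseteq> ?r ` A"
  proof
    fix d assume d: "d \<in> A"
    then have "d \<in> orbit (first_return \<phi> A) d" using o orbit_self[OF \<phi>] by auto
    then have "\<exists>y\<in>A. d = first_return \<phi> A y"
      using o[OF d] by cases (use d in auto)
    then show "d \<in> ?r ` A" by (auto simp: perm_restrict_simps)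
  qed
  then have "?r ` A = A" using into by auto
  then show "bij_betw ?r A A" using A by (simp add: bij_betw_def eq_card_imp_inj_on)
qed (auto simp: perm_restrict_simps)

lemma orbit_perm_restrict_first_return:
  assumes \<phi>: "\<phi> permutes D" "finite D" and d: "d \<in> A"
  shows "orbit (perm_restrict (first_return \<phi> A) A) d = orbit \<phi> d \<inter> A"
proof -
  have "orbit (perm_restrict (first_return \<phi> A) A) d = orbit (first_return \<phi> A) d"
    using orbit_first_return[OF \<phi> d] orbit_self[OF \<phi>, of d] d
    by (intro orbit_cong) (auto simp: perm_restrict_simps)
  then show ?thesis using orbit_first_return[OF \<phi> d] by simp
qed

text \<open>A new element starts as a fixed point and is spliced into the cycle of its fibre by one
  transposition. With \<open>f = fst\<close> this provides a rotation system for every graph, so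
  that minimising over rotation systems makes sense.\<close>

lemma ex_permutation_with_orbits:
  assumes "finite D"
  shows "\<exists>\<sigma>. \<sigma> permutes D \<and> (\<forall>d\<in>D. orbit \<sigma> d = {d'\<in>D. f d' = f d})"
  using assms
proof induct
  case empty then show ?case by (intro exI[of _ id]) (auto simp: permutes_id)
next
  case (insert a D)
  then obtain \<sigma> where \<sigma>: "\<sigma> permutes D" "\<And>d. d \<in> D \<Longrightarrow> orbit \<sigma> d = {d'\<in>D. f d' = f d}" by auto
  have \<sigma>': "\<sigma> permutes insert a D" using \<sigma>(1) by (rule permutes_subset) auto
  have fin: "finite (insert a D)" using insert by auto
  have oa: "orbit \<sigma> a = {a}" using \<sigma>(1) insert by (simp add: orbit_eq_singleton_iff permutes_not_in)
  show ?case
  proof (cases "\<exists>b\<in>D. f b = f a")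
    case False
    then show ?thesis using \<sigma>' \<sigma>(2) oa by (intro exI[of _ \<sigma>]) auto
  next
    case True
    then obtain b where b: "b \<in> D" "f b = f a" by auto
    let ?\<psi> = "\<sigma> \<circ> transpose a b"
    have nb: "b \<notin> orbit \<sigma> a" using oa b insert by auto
    note m = orbit_transpose_merge[OF \<sigma>' fin _ _ nb]
    have ob: "orbit \<sigma> b = {d'\<in>D. f d' = f a}" using \<sigma>(2) b by auto
    have \<psi>: "?\<psi> permutes insert a D" using \<sigma>' b by (intro permutes_compose permutes_swap_id) auto
    have "orbit ?\<psi> d = {d' \<in> insert a D. f d' = f d}" if d: "d \<in> insert a D" for d
    proof (cases "f d = f a")
      case True
      then have "d \<in> orbit ?\<psi> a" using m(1) b oa ob d by auto
      from orbit_eq_orbit[OF \<psi> fin this] show ?thesis using m(1) b oa ob True by auto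
    next
      case False
      then have "orbit ?\<psi> d = orbit \<sigma> d" using b oa ob d by (intro m(2)) auto
      then show ?thesis using \<sigma>(2) d False by auto
    qed
    then show ?thesis using \<psi> by blast
  qed
qed

section \<open>Euler's formula and subgraphs\<close>

lemma card_image_le_card_image:
  assumes "finite A" "\<And>x y. x \<in> A \<Longrightarrow> y \<in> A \<Longrightarrow> g x = g y \<Longrightarrow> f x = f y"
  shows "card (f ` A) \<le> card (g ` A)"
proof -
  have "f x = f (SOME y. y \<in> A \<and> g y = g x)" if x: "x \<in> A" for x
  proof -
    have "\<exists>y. y \<in> A \<and> g y = g x" using x by auto
    from someI_ex[OF this] show ?thesis using assms(2)[OF x] by metis
  qed
  then have "f ` A = (\<lambda>z. f (SOME y. y \<in> A \<and> g y = z)) ` g ` A"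
    unfolding image_image by (intro image_cong refl)
  also have "card \<dots> \<le> card (g ` A)" using assms(1) by (intro card_image_le finite_imageI)
  finally show ?thesis .
qed

lemma num_components_insert_edge:
  assumes V: "finite V" and D: "sym D"
  shows "num_components V D \<le> num_components V (insert (u, v) (insert (v, u) D)) + 1"
    and "(u, v) \<in> D\<^sup>* \<Longrightarrow> num_components V (insert (u, v) (insert (v, u) D)) = num_components V D"
proof -
  let ?D = "insert (u, v) (insert (v, u) D)"
  have sym: "(y, x) \<in> D\<^sup>*" if "(x, y) \<in> D\<^sup>*" for x y
    using that D by (metis sym_rtrancl symD)
  have symn: "(y, x) \<in> ?D\<^sup>*" if "(x, y) \<in> ?D\<^sup>*" for x y
  proof -
    have "sym ?D" using D by (auto simp: sym_def)
    then show ?thesis using that by (metis sym_rtrancl symD)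
  qed
  have new: "(x, y) \<in> ?D\<^sup>* \<longleftrightarrow> (x, y) \<in> D\<^sup>* \<or> ((x, u) \<in> D\<^sup>* \<and> (v, y) \<in> D\<^sup>*) \<or> ((x, v) \<in> D\<^sup>* \<and> (u, y) \<in> D\<^sup>*)" for x y
  proof
    assume "(x, y) \<in> ?D\<^sup>*"
    then show "(x, y) \<in> D\<^sup>* \<or> ((x, u) \<in> D\<^sup>* \<and> (v, y) \<in> D\<^sup>*) \<or> ((x, v) \<in> D\<^sup>* \<and> (u, y) \<in> D\<^sup>*)"
    proof (induct rule: rtrancl_induct)
      case (step y z)
      from step(2) consider "(y, z) = (u, v)" | "(y, z) = (v, u)" | "(y, z) \<in> D" by blast
      then show ?case
      proof cases
        case 1 then show ?thesis using step(3) by auto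
      next
        case 2 then show ?thesis using step(3) by auto
      next
        case 3 then show ?thesis using step(3) by (meson rtrancl.rtrancl_into_rtrancl)
      qed
    qed simp
  next
    have sub: "D\<^sup>* \<subseteq> ?D\<^sup>*" by (intro rtrancl_mono) auto
    have e: "(u, v) \<in> ?D\<^sup>*" "(v, u) \<in> ?D\<^sup>*" by auto
    assume "(x, y) \<in> D\<^sup>* \<or> ((x, u) \<in> D\<^sup>* \<and> (v, y) \<in> D\<^sup>*) \<or> ((x, v) \<in> D\<^sup>* \<and> (u, y) \<in> D\<^sup>*)"
    then show "(x, y) \<in> ?D\<^sup>*" using sub e by (meson rtrancl_trans subsetD)
  qed
  show "num_components V ?D = num_components V D" if uv: "(u, v) \<in> D\<^sup>*"
  proof -
    have "(x, y) \<in> ?D\<^sup>* \<longleftrightarrow> (x, y) \<in> D\<^sup>*" for x y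
      using new uv sym[OF uv] by (meson rtrancl_trans)
    then have "?D\<^sup>* = D\<^sup>*" by auto
    then show ?thesis by (simp add: num_components_def)
  qed
  let ?c = "\<lambda>v. D\<^sup>* `` {v}" and ?n = "\<lambda>v. ?D\<^sup>* `` {v}"
  \<comment> \<open>Two vertices of \<open>W\<close> that the new edge connects were connected
    before, because a detour through the new edge would join one of them to \<open>v\<close>. Hence
    only the component of \<open>v\<close> can be lost.\<close>
  define W where "W = {w \<in> V. (v, w) \<notin> D\<^sup>*}"
  have "?c ` V \<subseteq> insert (?c v) (?c ` W)"
  proof (rule image_subsetI)
    fix w assume w: "w \<in> V"
    show "?c w \<in> insert (?c v) (?c ` W)"
    proof (cases "w \<in> W")
      case False
      then have vw: "(v, w) \<in> D\<^sup>*" using w by (simp add: W_def)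
      have "?c w = ?c v"
        using rtrancl_trans[OF vw] rtrancl_trans[OF sym[OF vw]] by (intro set_eqI) auto
      then show ?thesis by simp
    qed simp
  qed
  then have "num_components V D \<le> card (insert (?c v) (?c ` W))"
    unfolding num_components_def using V by (intro card_mono) (auto simp: W_def)
  also have "\<dots> \<le> card (?c ` W) + 1" using V by (simp add: card_insert_if W_def)
  also have "card (?c ` W) \<le> card (?n ` W)"
  proof (rule card_image_le_card_image)
    fix x y assume x: "x \<in> W" and y: "y \<in> W" and eq: "?n x = ?n y"
    have ns: "(w, v) \<notin> D\<^sup>*" if "w \<in> W" for w using that sym[of w v] by (auto simp: W_def)
    have "(x, y) \<in> ?D\<^sup>*" using eq by blast
    then have "(x, y) \<in> D\<^sup>*" using new ns[OF x] y by (auto simp: W_def)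
    from rtrancl_trans[OF this] rtrancl_trans[OF sym[OF this]]
    show "?c x = ?c y" by (intro set_eqI) auto
  qed (use V in \<open>simp add: W_def\<close>)
  also have "card (?n ` W) \<le> num_components V ?D"
    unfolding num_components_def using V by (intro card_mono) (auto simp: W_def)
  finally show "num_components V D \<le> num_components V ?D + 1" by simp
qed

text \<open>
  With \<open>\<sigma>\<close> and the set \<open>D\<close> of darts fixed, only the edges in \<open>D\<^sub>0\<close> are glued; the remaining darts
  are dangling half-edges. Their presence does not change the number of faces.
\<close>

definition face_perm :: "('a \<times> 'a) set \<Rightarrow> ('a \<times> 'a \<Rightarrow> 'a \<times> 'a) \<Rightarrow> 'a \<times> 'a \<Rightarrow> 'a \<times> 'a" where
  "face_perm D\<^sub>0 \<sigma> = \<sigma> \<circ> (\<lambda>d. if d \<in> D\<^sub>0 then prod.swap d else d)"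

text \<open>Twice the genus of the surface given by \<sigma>, by Euler's formula. It is kept as a
  doubled integer because nonnegativity and evenness still have to be proved.\<close>

definition genus2 :: "'a set \<Rightarrow> ('a \<times> 'a) set \<Rightarrow> ('a \<times> 'a \<Rightarrow> 'a \<times> 'a) \<Rightarrow> int" where
  "genus2 V D \<sigma> = 2 * int (num_components V D) - int (card V) + int (card D div 2)
     - int (num_faces V D \<sigma>)"

locale embedded_graph =
  fixes V :: "'a set" and D :: "('a \<times> 'a) set" and \<sigma>
  assumes finV: "finite V" and DV: "D \<subseteq> V \<times> V" and symD: "sym D"
    and irreflD: "(u, u) \<notin> D" and rot: "rotation_system D \<sigma>"
begin

lemma finD: "finite D"
  using finite_subset[OF DV] finV by auto

lemma perm: "\<sigma> permutes D" and orb: "d \<in> D \<Longrightarrow> orbit \<sigma> d = {d'\<in>D. fst d' = fst d}"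
  using rot by (auto simp: rotation_system_def)

lemma fst_\<sigma>: "fst (\<sigma> d) = fst d"
proof (cases "d \<in> D")
  case True
  then show ?thesis using orb[OF True] orbit.base[of \<sigma> d] by auto
qed (use perm in \<open>simp add: permutes_not_in\<close>)

lemma face_perm_permutes:
  assumes "D\<^sub>0 \<subseteq> D" "sym D\<^sub>0"
  shows "face_perm D\<^sub>0 \<sigma> permutes D"
proof -
  have "(\<lambda>d. if d \<in> D\<^sub>0 then prod.swap d else d) permutes D"
  proof (rule bij_imp_permutes)
    show "bij_betw (\<lambda>d. if d \<in> D\<^sub>0 then prod.swap d else d) D D"
      using assms by (intro bij_betwI[where g = "\<lambda>d. if d \<in> D\<^sub>0 then prod.swap d else d"])
        (use assms in \<open>fastforce simp: sym_def split: if_splits\<close>)+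
  qed (use assms in auto)
  then show ?thesis unfolding face_perm_def using perm by (rule permutes_compose)
qed

lemma orbit_face_perm_connected:
  assumes "D\<^sub>0 \<subseteq> D" "sym D\<^sub>0" "e \<in> orbit (face_perm D\<^sub>0 \<sigma>) d"
  shows "(fst d, fst e) \<in> D\<^sub>0\<^sup>*"
proof -
  have *: "(fst d, fst (face_perm D\<^sub>0 \<sigma> d)) \<in> D\<^sub>0\<^sup>*" for d
    by (cases d) (auto simp: face_perm_def fst_\<sigma>)
  show ?thesis using assms(3)
    by induct (use * in \<open>auto intro: rtrancl_trans\<close>)
qed

text \<open>Interpolates between 0, when no edge is glued, and \<open>genus2 V D \<sigma>\<close>.
  The faces are counted on all of \<open>D\<close> at every stage, so that consecutive face
  permutations differ by a single transposition.\<close>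

definition partial_genus2 :: "('a \<times> 'a) set \<Rightarrow> int" where
  "partial_genus2 D\<^sub>0 = 2 * int (num_components V D\<^sub>0) - int (card V) + int (card D\<^sub>0 div 2)
     - int (card (orbit (face_perm D\<^sub>0 \<sigma>) ` D) + card {v\<in>V. v \<notin> fst ` D})"

text \<open>If both darts of the new edge lie on one face, that face splits and the components stay
  the same, so the gains of one edge and one face cancel. If they lie on different faces, these
  merge and the value rises by 2, minus 2 if two components merge as well.\<close>

lemma partial_genus2_add_edge:
  assumes D0: "D\<^sub>0 \<subseteq> D" "sym D\<^sub>0" and a: "a \<in> D - D\<^sub>0"
  defines "D\<^sub>1 \<equiv> insert a (insert (prod.swap a) D\<^sub>0)"
  shows "partial_genus2 D\<^sub>0 \<le> partial_genus2 D\<^sub>1" "even (partial_genus2 D\<^sub>1 - partial_genus2 D\<^sub>0)"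
proof -
  let ?b = "prod.swap a"
  have b: "?b \<in> D - D\<^sub>0" using a D0 symD by (cases a) (auto simp: sym_def)
  have ab: "a \<noteq> ?b" using a irreflD by (cases a) auto
  have fin: "finite D\<^sub>0" using D0 finD finite_subset by auto
  have cD: "card D\<^sub>1 div 2 = card D\<^sub>0 div 2 + 1" using a b ab fin by (simp add: D\<^sub>1_def)
  let ?\<phi> = "face_perm D\<^sub>0 \<sigma>"
  note \<phi> = face_perm_permutes[OF D0]
  have eq: "face_perm D\<^sub>1 \<sigma> = ?\<phi> \<circ> transpose a ?b"
  proof
    fix d show "face_perm D\<^sub>1 \<sigma> d = (?\<phi> \<circ> transpose a ?b) d"
      using a b ab by (cases "d = a"; cases "d = ?b") (auto simp: face_perm_def D\<^sub>1_def transpose_def)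
  qed
  obtain u v where uv: "a = (u, v)" by (cases a)
  have D1: "D\<^sub>1 = insert (u, v) (insert (v, u) D\<^sub>0)" by (simp add: D\<^sub>1_def uv)
  note comp = num_components_insert_edge[OF finV D0(2), of u v, folded D1]
  have aD: "a \<in> D" and bD: "?b \<in> D" using a b by auto
  have "partial_genus2 D\<^sub>0 \<le> partial_genus2 D\<^sub>1 \<and> even (partial_genus2 D\<^sub>1 - partial_genus2 D\<^sub>0)"
  proof (cases "?b \<in> orbit ?\<phi> a")
    case True
    have "(u, v) \<in> D\<^sub>0\<^sup>*" using orbit_face_perm_connected[OF D0 True] by (simp add: uv)
    then show ?thesis
      using comp(2) card_orbits_transpose_split[OF \<phi> finD aD bD ab True] cD
      by (simp add: partial_genus2_def eq)
  next
    case False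
    then show ?thesis
      using comp(1) card_orbits_transpose_merge[OF \<phi> finD aD bD False, symmetric] cD
      by (auto simp: partial_genus2_def eq algebra_simps)
  qed
  then show "partial_genus2 D\<^sub>0 \<le> partial_genus2 D\<^sub>1" "even (partial_genus2 D\<^sub>1 - partial_genus2 D\<^sub>0)" by auto
qed

lemma partial_genus2_mono:
  assumes "D\<^sub>0 \<subseteq> D\<^sub>1" "D\<^sub>1 \<subseteq> D" "sym D\<^sub>0" "sym D\<^sub>1"
  shows "partial_genus2 D\<^sub>0 \<le> partial_genus2 D\<^sub>1 \<and> even (partial_genus2 D\<^sub>1 - partial_genus2 D\<^sub>0)"
  using assms
proof (induction "card (D\<^sub>1 - D\<^sub>0)" arbitrary: D\<^sub>0 rule: less_induct)
  case less
  show ?case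
  proof (cases "D\<^sub>0 = D\<^sub>1")
    case False
    then obtain a where a: "a \<in> D\<^sub>1 - D\<^sub>0" using less.prems by auto
    let ?D = "insert a (insert (prod.swap a) D\<^sub>0)"
    have sub: "?D \<subseteq> D\<^sub>1" using a less.prems by (cases a) (auto simp: sym_def)
    have symn: "sym ?D" using less.prems by (cases a) (auto simp: sym_def)
    have "card (D\<^sub>1 - ?D) < card (D\<^sub>1 - D\<^sub>0)"
      using a finD less.prems by (intro psubset_card_mono) (auto intro: finite_subset)
    note 1 = less.hyps[OF this sub less.prems(2) symn less.prems(4)]
    have "D\<^sub>0 \<subseteq> D" "a \<in> D - D\<^sub>0" using less.prems a by auto
    note 2 = partial_genus2_add_edge[OF this(1) less.prems(3) this(2)]
    have "even ((partial_genus2 D\<^sub>1 - partial_genus2 ?D) + (partial_genus2 ?D - partial_genus2 D\<^sub>0))"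
      using 1 2(2) by (intro dvd_add) auto
    then show ?thesis using 1 2(1) by auto
  qed simp
qed

text \<open>Without edges, each vertex is a component and has exactly one face: the cycle of its
  dangling darts, or the face of an isolated vertex.\<close>

lemma partial_genus2_empty: "partial_genus2 {} = 0"
proof -
  have "num_components V {} = card V"
    by (simp add: num_components_def card_image inj_on_def)
  moreover have "orbit (face_perm {} \<sigma>) ` D = (\<lambda>v. {d\<in>D. fst d = v}) ` fst ` D"
    using orb by (auto simp: face_perm_def comp_def image_image intro!: image_cong)
  moreover have "card ((\<lambda>v. {d\<in>D. fst d = v}) ` fst ` D) = card (fst ` D)"
  proof (intro card_image inj_onI)
    fix v w assume "v \<in> fst ` D" and eq: "{d\<in>D. fst d = v} = {d\<in>D. fst d = w}"
    then obtain d where "d \<in> {d\<in>D. fst d = v}" by auto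
    then show "v = w" unfolding eq using \<open>d \<in> {d\<in>D. fst d = v}\<close> by auto
  qed
  moreover have "card (fst ` D) + card {v\<in>V. v \<notin> fst ` D} = card V"
  proof -
    have "card (fst ` D \<union> {v\<in>V. v \<notin> fst ` D}) = card (fst ` D) + card {v\<in>V. v \<notin> fst ` D}"
      using finD finV by (intro card_Un_disjoint) auto
    moreover have "fst ` D \<union> {v\<in>V. v \<notin> fst ` D} = V" using DV by auto
    ultimately show ?thesis by simp
  qed
  ultimately show ?thesis by (simp add: partial_genus2_def)
qed

text \<open>The map \<open>\<sigma> \<circ> prod.swap\<close> need not fix the pairs outside
  \<open>D\<close>, so in general it is not a permutation of \<open>D\<close> in the sense of
  \<open>permutes\<close>; it agrees on \<open>D\<close> with \<open>face_perm D \<sigma>\<close>,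
  which is one.\<close>

lemma partial_genus2_full: "partial_genus2 D = genus2 V D \<sigma>"
proof -
  have "orbit (face_perm D \<sigma>) d = orbit (\<sigma> \<circ> prod.swap) d" if "d \<in> D" for d
  proof (rule orbit_cong0[OF that])
    show "face_perm D \<sigma> \<in> D \<rightarrow> D" using permutes_in_image[OF face_perm_permutes[OF order_refl symD]] by auto
  qed (auto simp: face_perm_def)
  then show ?thesis by (simp add: partial_genus2_def genus2_def num_faces_def)
qed

lemma genus2_nonneg_even: "genus2 V D \<sigma> \<ge> 0" "even (genus2 V D \<sigma>)"
  using partial_genus2_mono[of "{}" D] symD partial_genus2_empty partial_genus2_full by (auto simp: sym_def)

section \<open>Embeddings induced on subgraphs\<close>

definition sub_rotation :: "('a \<times> 'a) set \<Rightarrow> 'a \<times> 'a \<Rightarrow> 'a \<times> 'a" where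
  "sub_rotation D\<^sub>0 = perm_restrict (first_return \<sigma> D\<^sub>0) D\<^sub>0"

lemma sub_rotation_agrees:
  assumes "d \<in> D\<^sub>0" "\<sigma> d \<in> D\<^sub>0"
  shows "sub_rotation D\<^sub>0 d = \<sigma> d"
  using first_return_eqI[of 1 \<sigma> d D\<^sub>0] assms by (auto simp: sub_rotation_def perm_restrict_simps)

lemma rotation_system_sub_rotation:
  assumes "D\<^sub>0 \<subseteq> D"
  shows "rotation_system D\<^sub>0 (sub_rotation D\<^sub>0)"
proof -
  have "finite D\<^sub>0" using assms finD finite_subset by auto
  moreover have "orbit (sub_rotation D\<^sub>0) d = {d' \<in> D\<^sub>0. fst d' = fst d}" if "d \<in> D\<^sub>0" for d
  proof -
    have "d \<in> D" using that assms by auto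
    then show ?thesis unfolding sub_rotation_def orbit_perm_restrict_first_return[OF perm finD that]
      using orb assms by auto
  qed
  ultimately show ?thesis
    using permutes_first_return[OF perm finD, of D\<^sub>0] by (auto simp: rotation_system_def sub_rotation_def)
qed

text \<open>On a dangling dart \<open>face_perm\<close> acts as \<sigma>, so walking along a face
  and skipping the dangling darts is the same as turning at the vertex until the next dart of the
  subgraph. The faces of the subgraph are thus the traces of the larger orbits.\<close>

lemma orbit_sub_rotation_swap:
  assumes D0: "D\<^sub>0 \<subseteq> D" "sym D\<^sub>0" and d: "d \<in> D\<^sub>0"
  shows "orbit (sub_rotation D\<^sub>0 \<circ> prod.swap) d = orbit (face_perm D\<^sub>0 \<sigma>) d \<inter> D\<^sub>0"
proof -
  let ?\<phi> = "face_perm D\<^sub>0 \<sigma>"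
  note \<phi> = face_perm_permutes[OF D0]
  have swap: "prod.swap d \<in> D\<^sub>0" if "d \<in> D\<^sub>0" for d using that D0 by (cases d) (auto simp: sym_def)
  have step: "(sub_rotation D\<^sub>0 \<circ> prod.swap) d = first_return ?\<phi> D\<^sub>0 d" if d: "d \<in> D\<^sub>0" for d
  proof -
    obtain n where n: "n > 0" "(\<sigma> ^^ n) (prod.swap d) \<in> D\<^sub>0"
      "first_return \<sigma> D\<^sub>0 (prod.swap d) = (\<sigma> ^^ n) (prod.swap d)"
      "\<And>i. 0 < i \<Longrightarrow> i < n \<Longrightarrow> (\<sigma> ^^ i) (prod.swap d) \<notin> D\<^sub>0"
      using first_return_props[OF orbit_self[OF perm finD] swap[OF d]] by metis
    have eq: "(?\<phi> ^^ i) d = (\<sigma> ^^ i) (prod.swap d)" if "0 < i" "i \<le> n" for i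
      using that
    proof (induction i)
      case (Suc i)
      show ?case
      proof (cases "i = 0")
        case True then show ?thesis using d by (simp add: face_perm_def)
      next
        case False
        then show ?thesis using Suc n(4)[of i] by (simp add: face_perm_def)
      qed
    qed simp
    have "first_return ?\<phi> D\<^sub>0 d = (?\<phi> ^^ n) d"
      using n eq by (intro first_return_eqI) auto
    then show ?thesis using n eq[of n] swap[OF d] by (simp add: sub_rotation_def perm_restrict_simps)
  qed
  have "orbit (first_return ?\<phi> D\<^sub>0) d = orbit (sub_rotation D\<^sub>0 \<circ> prod.swap) d"
  proof (rule orbit_cong0[OF d])
    show "first_return ?\<phi> D\<^sub>0 \<in> D\<^sub>0 \<rightarrow> D\<^sub>0"
      using orbit_first_return[OF \<phi> finD] orbit.base by fastforce
  qed (simp only: step)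
  then show ?thesis using orbit_first_return[OF \<phi> finD d] by simp
qed

text \<open>Orbits of \<open>face_perm\<close> come in two kinds. Those meeting
  \<open>D\<^sub>0\<close> correspond to the faces of the subgraph. The others are full rotations at
  vertices that have darts in \<open>D\<close> but none in \<open>D\<^sub>0\<close>; they account
  for the vertices that become isolated.\<close>

lemma num_faces_sub_rotation:
  assumes D0: "D\<^sub>0 \<subseteq> D" "sym D\<^sub>0"
  shows "num_faces V D\<^sub>0 (sub_rotation D\<^sub>0)
    = card (orbit (face_perm D\<^sub>0 \<sigma>) ` D) + card {v\<in>V. v \<notin> fst ` D}"
proof -
  let ?\<phi> = "face_perm D\<^sub>0 \<sigma>"
  note \<phi> = face_perm_permutes[OF D0]
  note self = orbit_self[OF \<phi> finD] and eq = orbit_eq_orbit[OF \<phi> finD]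
  have fin: "finite D\<^sub>0" using D0 finD finite_subset by auto
  let ?A = "orbit ?\<phi> ` D\<^sub>0" and ?B = "orbit ?\<phi> ` {d\<in>D. fst d \<notin> fst ` D\<^sub>0}"
  have b: "orbit ?\<phi> d = {d'\<in>D. fst d' = fst d}" if "d \<in> D" "fst d \<notin> fst ` D\<^sub>0" for d
  proof -
    have "orbit ?\<phi> d = orbit \<sigma> d"
    proof (rule orbit_cong[OF orbit_self[OF perm finD]])
      fix s assume "s \<in> orbit \<sigma> d"
      then have "fst s = fst d" using orb[OF that(1)] by simp
      then have "s \<notin> D\<^sub>0" using that(2) by (metis imageI)
      then show "?\<phi> s = \<sigma> s" by (simp add: face_perm_def)
    qed
    then show ?thesis using orb that by simp
  qed
  have meets: "\<exists>e\<in>D\<^sub>0. e \<in> orbit ?\<phi> d" if d: "d \<in> D" "fst d \<in> fst ` D\<^sub>0" for d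
  proof (rule ccontr)
    assume no: "\<not> ?thesis"
    have "orbit \<sigma> d = orbit ?\<phi> d"
    proof (rule orbit_cong[OF self])
      fix s assume "s \<in> orbit ?\<phi> d"
      then show "\<sigma> s = ?\<phi> s" using no by (auto simp: face_perm_def)
    qed
    then show False using no orb[OF d(1)] d(2) D0(1) by fastforce
  qed
  have un: "orbit ?\<phi> ` D = ?A \<union> ?B"
  proof -
    have "orbit ?\<phi> d \<in> ?A" if "d \<in> D" "fst d \<in> fst ` D\<^sub>0" for d
      using meets[OF that] eq by (metis imageI)
    then show ?thesis using D0(1) by blast
  qed
  have disj: "?A \<inter> ?B = {}"
  proof (rule ccontr)
    assume "?A \<inter> ?B \<noteq> {}"
    then obtain e d where "e \<in> D\<^sub>0" "d \<in> D" "fst d \<notin> fst ` D\<^sub>0" "orbit ?\<phi> e = orbit ?\<phi> d" by auto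
    then have "e \<in> {d' \<in> D. fst d' = fst d}" using b self[of e] by simp
    then show False using \<open>e \<in> D\<^sub>0\<close> \<open>fst d \<notin> fst ` D\<^sub>0\<close> by (metis (mono_tags, lifting) CollectD imageI)
  qed
  have cA: "card ?A = card (orbit (sub_rotation D\<^sub>0 \<circ> prod.swap) ` D\<^sub>0)"
  proof -
    have "orbit (sub_rotation D\<^sub>0 \<circ> prod.swap) ` D\<^sub>0 = (\<lambda>O'. O' \<inter> D\<^sub>0) ` ?A"
      using orbit_sub_rotation_swap[OF D0] by (auto simp: image_image)
    moreover have "inj_on (\<lambda>O'. O' \<inter> D\<^sub>0) ?A"
    proof (rule inj_onI)
      fix X Y assume X: "X \<in> ?A" and Y: "Y \<in> ?A" and XY: "X \<inter> D\<^sub>0 = Y \<inter> D\<^sub>0"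
      obtain x where x: "x \<in> D\<^sub>0" "X = orbit ?\<phi> x" using X by auto
      obtain y where y: "y \<in> D\<^sub>0" "Y = orbit ?\<phi> y" using Y by auto
      have "x \<in> X \<inter> D\<^sub>0" using x self[of x] by simp
      then have "x \<in> Y" using XY by simp
      then show "X = Y" using eq x y by simp
    qed
    ultimately show ?thesis by (simp add: card_image)
  qed
  have cB: "card ?B = card (fst ` D - fst ` D\<^sub>0)"
  proof -
    have "?B = (\<lambda>v. {d\<in>D. fst d = v}) ` (fst ` D - fst ` D\<^sub>0)"
      using b by (auto simp: image_iff)
    moreover have "inj_on (\<lambda>v. {d\<in>D. fst d = v}) (fst ` D - fst ` D\<^sub>0)"
    proof (intro inj_onI)
      fix v w assume "v \<in> fst ` D - fst ` D\<^sub>0" and eq: "{d\<in>D. fst d = v} = {d\<in>D. fst d = w}"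
      then obtain d where "d \<in> {d\<in>D. fst d = v}" by auto
      then show "v = w" unfolding eq using \<open>d \<in> {d\<in>D. fst d = v}\<close> by auto
    qed
    ultimately show ?thesis by (simp add: card_image)
  qed
  have "{v\<in>V. v \<notin> fst ` D\<^sub>0} = (fst ` D - fst ` D\<^sub>0) \<union> {v\<in>V. v \<notin> fst ` D}"
    using D0(1) DV by force
  then have "card {v\<in>V. v \<notin> fst ` D\<^sub>0} = card (fst ` D - fst ` D\<^sub>0) + card {v\<in>V. v \<notin> fst ` D}"
    using finD finV by (subst card_Un_disjoint[symmetric]) auto
  moreover have "card (orbit ?\<phi> ` D) = card ?A + card ?B"
    unfolding un using finD fin disj by (intro card_Un_disjoint) auto
  ultimately show ?thesis using cA cB by (simp add: num_faces_def)
qed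

lemma embedded_subgraph:
  assumes "D\<^sub>0 \<subseteq> D" "sym D\<^sub>0" "V\<^sub>0 \<subseteq> V" "D\<^sub>0 \<subseteq> V\<^sub>0 \<times> V\<^sub>0"
  shows "embedded_graph V\<^sub>0 D\<^sub>0 (sub_rotation D\<^sub>0)"
  using assms rotation_system_sub_rotation irreflD finV finite_subset
  by unfold_locales auto

lemma genus2_sub_rotation:
  assumes "D\<^sub>0 \<subseteq> D" "sym D\<^sub>0" "V\<^sub>0 \<subseteq> V" "D\<^sub>0 \<subseteq> V\<^sub>0 \<times> V\<^sub>0"
  shows "genus2 V\<^sub>0 D\<^sub>0 (sub_rotation D\<^sub>0) \<le> genus2 V D \<sigma>"
proof -
  have "genus2 V D\<^sub>0 (sub_rotation D\<^sub>0) = partial_genus2 D\<^sub>0"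
    using num_faces_sub_rotation[OF assms(1,2)] by (simp add: genus2_def partial_genus2_def)
  moreover have "partial_genus2 D\<^sub>0 \<le> genus2 V D \<sigma>"
    using partial_genus2_mono[of D\<^sub>0 D] assms symD by (auto simp: partial_genus2_full)
  \<comment> \<open>Every vertex outside \<open>V\<^sub>0\<close> is isolated and contributes one
    component, one vertex and one face, which cancel as 2 - 1 - 1.\<close>
  moreover have "genus2 V\<^sub>0 D\<^sub>0 (sub_rotation D\<^sub>0) = genus2 V D\<^sub>0 (sub_rotation D\<^sub>0)"
  proof -
    let ?I = "V - V\<^sub>0"
    have cV: "card V = card V\<^sub>0 + card ?I" using assms finV
      by (metis card_Diff_subset card_mono finite_subset le_add_diff_inverse)
    have iso: "D\<^sub>0\<^sup>* `` {v} = {v}" if "v \<in> ?I" for v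
    proof -
      have "w = v" if "(v, w) \<in> D\<^sub>0\<^sup>*" for w using that
        by (induct rule: rtrancl_induct) (use \<open>v \<in> ?I\<close> assms(4) in auto)
      then show ?thesis by auto
    qed
    have stay: "w \<in> V\<^sub>0" if "(v, w) \<in> D\<^sub>0\<^sup>*" "v \<in> V\<^sub>0" for v w
      using that by (induct rule: rtrancl_induct) (use assms(4) in auto)
    have "(\<lambda>v. D\<^sub>0\<^sup>* `` {v}) ` V = (\<lambda>v. D\<^sub>0\<^sup>* `` {v}) ` V\<^sub>0 \<union> (\<lambda>v. {v}) ` ?I"
    proof -
      have "(\<lambda>v. D\<^sub>0\<^sup>* `` {v}) ` ?I = (\<lambda>v. {v}) ` ?I" using iso by (intro image_cong refl)
      moreover have "V = V\<^sub>0 \<union> ?I" using assms(3) by auto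
      ultimately show ?thesis by (metis image_Un)
    qed
    moreover have "(\<lambda>v. D\<^sub>0\<^sup>* `` {v}) ` V\<^sub>0 \<inter> (\<lambda>v. {v}) ` ?I = {}"
      using stay by blast
    ultimately have "num_components V D\<^sub>0 = num_components V\<^sub>0 D\<^sub>0 + card ((\<lambda>v. {v}) ` ?I)"
      unfolding num_components_def using finV finite_subset[OF assms(3) finV]
      by (simp add: card_Un_disjoint)
    also have "card ((\<lambda>v. {v}) ` ?I) = card ?I" by (intro card_image) auto
    finally have comp: "num_components V D\<^sub>0 = num_components V\<^sub>0 D\<^sub>0 + card ?I" .
    have "{v\<in>V. v \<notin> fst ` D\<^sub>0} = {v\<in>V\<^sub>0. v \<notin> fst ` D\<^sub>0} \<union> ?I" using assms by force
    then have "card {v\<in>V. v \<notin> fst ` D\<^sub>0} = card {v\<in>V\<^sub>0. v \<notin> fst ` D\<^sub>0} + card ?I"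
      using finV finite_subset[OF assms(3) finV] by (subst card_Un_disjoint[symmetric]) auto
    then show ?thesis using comp cV by (simp add: genus2_def num_faces_def)
  qed
  ultimately show ?thesis by simp
qed

end

section \<open>The genus as a minimum over embeddings\<close>

lemma graph_genus_le:
  assumes "embedded_graph V D \<sigma>" "genus2 V D \<sigma> \<le> 2 * int \<gamma>"
  shows "graph_genus V D \<le> \<gamma>"
proof -
  interpret embedded_graph V D \<sigma> by fact
  obtain \<delta> where d: "genus2 V D \<sigma> = 2 * \<delta>" using genus2_nonneg_even by (auto elim!: evenE)
  then have "\<delta> \<ge> 0" using genus2_nonneg_even by simp
  then have "graph_genus V D \<le> nat \<delta>"
    unfolding graph_genus_def using d rot
    by (intro Least_le exI[of _ \<sigma>]) (auto simp: genus2_def)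
  also have "nat \<delta> \<le> \<gamma>" using d assms(2) by simp
  finally show ?thesis .
qed

text \<open>The \<open>LEAST\<close> in the genus is taken over a nonempty set: some rotation system
  exists, and its value of \<open>genus2\<close> is a nonnegative even number.\<close>

lemma graph_genus_attained:
  assumes "finite V" "D \<subseteq> V \<times> V" "sym D" "\<And>u. (u, u) \<notin> D"
  obtains \<sigma> where "embedded_graph V D \<sigma>" "genus2 V D \<sigma> = 2 * int (graph_genus V D)"
proof -
  have "finite D" using assms(1,2) finite_subset by blast
  from ex_permutation_with_orbits[OF this, of fst] obtain \<sigma> where \<sigma>: "rotation_system D \<sigma>"
    by (auto simp: rotation_system_def)
  let ?P = "\<lambda>\<gamma>. \<exists>\<sigma>. rotation_system D \<sigma> \<and>
     int (card V) - int (card D div 2) + int (num_faces V D \<sigma>) = 2 * int (num_components V D) - 2 * int \<gamma>"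
  interpret embedded_graph V D \<sigma> using assms \<sigma> by unfold_locales auto
  obtain \<delta> where d: "genus2 V D \<sigma> = 2 * \<delta>" "\<delta> \<ge> 0" using genus2_nonneg_even by (auto elim!: evenE)
  then have "?P (nat \<delta>)" using \<sigma> by (intro exI[of _ \<sigma>]) (auto simp: genus2_def)
  then have "?P (graph_genus V D)" unfolding graph_genus_def by (rule LeastI)
  then obtain \<sigma>' where "rotation_system D \<sigma>'" "genus2 V D \<sigma>' = 2 * int (graph_genus V D)"
    by (auto simp: genus2_def)
  then show thesis using assms by (intro that[of \<sigma>']) (unfold_locales, auto)
qed

text \<open>Restrict an optimal embedding of the large graph.\<close>

lemma graph_genus_subgraph:
  assumes "finite V" "D \<subseteq> V \<times> V" "sym D" "\<And>u. (u, u) \<notin> D"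
    and "D\<^sub>0 \<subseteq> D" "sym D\<^sub>0" "V\<^sub>0 \<subseteq> V" "D\<^sub>0 \<subseteq> V\<^sub>0 \<times> V\<^sub>0"
  shows "graph_genus V\<^sub>0 D\<^sub>0 \<le> graph_genus V D"
proof -
  obtain \<sigma> where \<sigma>: "embedded_graph V D \<sigma>" "genus2 V D \<sigma> = 2 * int (graph_genus V D)"
    using graph_genus_attained[OF assms(1-4)] .
  interpret embedded_graph V D \<sigma> by fact
  show ?thesis
    using graph_genus_le[OF embedded_subgraph[OF assms(5-8)]] genus2_sub_rotation[OF assms(5-8)] \<sigma>(2)
    by simp
qed

section \<open>Vertices adjacent to three trees\<close>

lemma num_components_le_roots:
  fixes root :: "'a \<Rightarrow> 'a"
  assumes "finite G" "\<And>v. v \<in> G \<Longrightarrow> (v, root v) \<in> D\<^sup>*" "sym D" "root ` G \<subseteq> Q" "finite Q"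
  shows "num_components G D \<le> card Q"
proof -
  have sym: "(y, x) \<in> D\<^sup>*" if "(x, y) \<in> D\<^sup>*" for x y
    using that assms(3) by (metis sym_rtrancl symD)
  have "(\<lambda>v. D\<^sup>* `` {v}) ` G \<subseteq> (\<lambda>v. D\<^sup>* `` {v}) ` Q"
  proof (rule image_subsetI)
    fix v assume v: "v \<in> G"
    note r = assms(2)[OF v]
    have "D\<^sup>* `` {v} = D\<^sup>* `` {root v}"
      using rtrancl_trans[OF r] rtrancl_trans[OF sym[OF r]] by (intro set_eqI) auto
    then show "D\<^sup>* `` {v} \<in> (\<lambda>v. D\<^sup>* `` {v}) ` Q" using v assms(4) by auto
  qed
  then have "num_components G D \<le> card ((\<lambda>v. D\<^sup>* `` {v}) ` Q)"
    unfolding num_components_def using assms(5) by (intro card_mono) auto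
  also have "\<dots> \<le> card Q" using assms(5) by (rule card_image_le)
  finally show ?thesis .
qed

text \<open>
  The trees are given by their vertices \<open>G\<close>, the parent function and the root function; a vertex
  \<open>x \<in> X\<close> has three neighbours \<open>N x\<close>, in three different trees.
\<close>

locale tripods =
  fixes G Q X :: "'a set" and parent root :: "'a \<Rightarrow> 'a" and N :: "'a \<Rightarrow> 'a set"
  assumes fin: "finite G" "finite X" and QG: "Q \<subseteq> G" and GX: "G \<inter> X = {}"
    and root_in: "v \<in> G \<Longrightarrow> root v \<in> Q"
    and parent: "v \<in> G - Q \<Longrightarrow> parent v \<in> G" "v \<in> G - Q \<Longrightarrow> root (parent v) = root v"
      "v \<in> G - Q \<Longrightarrow> parent v \<noteq> v" "v \<in> G - Q \<Longrightarrow> parent v \<in> G - Q \<Longrightarrow> parent (parent v) \<noteq> v"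
    and reach: "v \<in> G \<Longrightarrow> (v, root v) \<in> {(v, parent v) | v. v \<in> G - Q}\<^sup>*"
    and N: "x \<in> X \<Longrightarrow> N x \<subseteq> G" "x \<in> X \<Longrightarrow> card (N x) = 3" "x \<in> X \<Longrightarrow> inj_on root (N x)"
begin

definition tree_arcs :: "('a \<times> 'a) set" where "tree_arcs = (\<lambda>v. (v, parent v)) ` (G - Q)"
definition leg_darts :: "('a \<times> 'a) set" where "leg_darts = Sigma X N"
definition tree_darts :: "('a \<times> 'a) set" where "tree_darts = tree_arcs \<union> tree_arcs\<inverse>"
definition darts :: "('a \<times> 'a) set" where "darts = tree_darts \<union> leg_darts \<union> leg_darts\<inverse>"

lemma tree_darts_props:
  "tree_darts \<subseteq> G \<times> G" "sym tree_darts" "(u, v) \<in> tree_darts \<Longrightarrow> root u = root v"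
  using parent by (auto simp: tree_darts_def tree_arcs_def sym_def)

lemma darts_props: "sym darts" "darts \<subseteq> (G \<union> X) \<times> (G \<union> X)"
proof -
  show "sym darts" using tree_darts_props(2) by (auto simp: darts_def sym_def)
  have "leg_darts \<subseteq> X \<times> G" using N(1) by (auto simp: leg_darts_def)
  then show "darts \<subseteq> (G \<union> X) \<times> (G \<union> X)" using tree_darts_props(1) unfolding darts_def by blast
qed

lemma card_tree_darts: "card tree_darts = 2 * card (G - Q)"
proof -
  have c: "card tree_arcs = card (G - Q)" unfolding tree_arcs_def by (intro card_image inj_onI) auto
  have "tree_arcs \<inter> tree_arcs\<inverse> = {}" using parent(4) by (fastforce simp: tree_arcs_def)
  then have "card tree_darts = card tree_arcs + card (tree_arcs\<inverse>)"
    unfolding tree_darts_def using fin by (intro card_Un_disjoint) (auto simp: tree_arcs_def)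
  then show ?thesis using c by (simp add: card_inverse)
qed

lemma card_leg_darts: "card leg_darts = 3 * card X"
proof -
  have "finite (N x)" if "x \<in> X" for x using N(2)[OF that] by (metis card.infinite zero_neq_numeral)
  then have "card leg_darts = (\<Sum>x\<in>X. card (N x))"
    unfolding leg_darts_def using fin by (intro card_SigmaI) auto
  then show ?thesis using N(2) by simp
qed

lemma finite_darts: "finite tree_darts" "finite leg_darts" "finite darts"
proof -
  show "finite tree_darts" using fin by (auto simp: tree_darts_def tree_arcs_def)
  show "finite leg_darts" using fin N(1) unfolding leg_darts_def by (auto intro: finite_subset)
  then show "finite darts" using \<open>finite tree_darts\<close> by (auto simp: darts_def)
qed

lemma card_darts: "card darts div 2 = card (G - Q) + 3 * card X"
proof -
  have "tree_darts \<inter> leg_darts = {}" "tree_darts \<inter> leg_darts\<inverse> = {}" "leg_darts \<inter> leg_darts\<inverse> = {}"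
    using tree_darts_props(1) GX N(1) by (fastforce simp: leg_darts_def)+
  then have "card darts = card tree_darts + card leg_darts + card (leg_darts\<inverse>)"
    unfolding darts_def using finite_darts by (subst card_Un_disjoint) (auto simp: card_Un_disjoint)
  then show ?thesis using card_tree_darts card_leg_darts by (simp add: card_inverse)
qed

text \<open>The genus is nonnegative, so Euler's formula bounds the faces from above: with at most
  \<open>card Q\<close> components, \<open>card G\<close> vertices and \<open>card (G - Q)\<close>
  edges, at most \<open>card Q\<close> faces remain.\<close>

lemma forest_faces:
  assumes "embedded_graph G tree_darts \<tau>"
  shows "num_faces G tree_darts \<tau> \<le> card Q"
proof -
  interpret F: embedded_graph G tree_darts \<tau> by fact
  have "num_components G tree_darts \<le> card Q"
  proof (rule num_components_le_roots[OF fin(1)])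
    fix v assume v: "v \<in> G"
    have "{(v, parent v) | v. v \<in> G - Q} \<subseteq> tree_darts" by (auto simp: tree_darts_def tree_arcs_def)
    from rtrancl_mono[OF this] show "(v, root v) \<in> tree_darts\<^sup>*" using reach[OF v] by blast
  qed (use tree_darts_props(2) root_in QG fin finite_subset in auto)
  moreover have "card G = card Q + card (G - Q)"
    using fin(1) QG by (metis card_Diff_subset card_mono finite_subset le_add_diff_inverse)
  ultimately show ?thesis using F.genus2_nonneg_even(1) card_tree_darts by (simp add: genus2_def)
qed

text \<open>Faces without leg darts are faces of the forest and number, together with the isolated
  vertices, at most \<open>card Q\<close>. Every other face has at least two of the
  \<open>3 * card X\<close> leg darts, which are the darts from \<open>X\<close> to \<open>G\<close>
  only. Dropping the components, Euler's formula gives \<open>genus2\<close> at least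
  \<open>2|X| - 2|Q| - (3/2)|X|\<close>.\<close>

lemma card_le_of_embedding:
  assumes "embedded_graph (G \<union> X) darts \<sigma>"
  shows "int (card X) \<le> 4 * int (card Q) + 2 * genus2 (G \<union> X) darts \<sigma>"
proof -
  interpret H: embedded_graph "G \<union> X" darts \<sigma> by fact
  let ?\<tau> = "H.sub_rotation tree_darts" and ?\<phi> = "\<sigma> \<circ> prod.swap"
  have td: "tree_darts \<subseteq> darts" by (auto simp: darts_def)
  interpret F: embedded_graph G tree_darts ?\<tau>
    using H.embedded_subgraph[OF td tree_darts_props(2) _ tree_darts_props(1)] by auto
  have closed: "?\<phi> d \<in> darts" if "d \<in> darts" for d
  proof -
    have "prod.swap d \<in> darts" using that darts_props(1) by (cases d) (auto simp: sym_def)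
    then show ?thesis using H.perm by (simp add: permutes_in_image)
  qed
  have orbit_eq: "orbit ?\<phi> d = orbit (face_perm darts \<sigma>) d" if "d \<in> darts" for d
    by (rule orbit_cong0[OF that]) (use closed in \<open>auto simp: face_perm_def\<close>)
  note P = H.face_perm_permutes[OF order_refl darts_props(1)]
  have self: "d \<in> orbit ?\<phi> d" if "d \<in> darts" for d
    using orbit_self[OF P finite_darts(3)] orbit_eq[OF that] by simp
  have sub: "orbit ?\<phi> d \<subseteq> darts" if "d \<in> darts" for d
    using orbit_eq[OF that] permutes_orbit_subset[OF P that] by simp
  have oeq: "orbit ?\<phi> e = orbit ?\<phi> d" if "d \<in> darts" "e \<in> orbit ?\<phi> d" for d e
  proof -
    have "e \<in> darts" using sub that by blast
    then show ?thesis using orbit_eq_orbit[OF P finite_darts(3), of e d] that orbit_eq by simp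
  qed
  have fst\<phi>: "fst (?\<phi> d) = snd d" for d by (simp add: H.fst_\<sigma>)

  let ?I = "{v \<in> G \<union> X. v \<notin> fst ` darts}"
  let ?Z = "{O' \<in> orbit ?\<phi> ` darts. O' \<inter> leg_darts = {}}"
  let ?L = "{O' \<in> orbit ?\<phi> ` darts. O' \<inter> leg_darts \<noteq> {}}"
  \<comment> \<open>A face that enters a vertex of \<open>X\<close> leaves it by a leg dart. A face
    without leg darts therefore stays in the forest, where \<sigma> agrees with the induced
    rotation.\<close>
  have "?Z \<subseteq> orbit (?\<tau> \<circ> prod.swap) ` tree_darts"
  proof
    fix O' assume "O' \<in> ?Z"
    then obtain d where d: "d \<in> darts" "O' = orbit ?\<phi> d" "O' \<inter> leg_darts = {}" by auto
    have Ot: "O' \<subseteq> tree_darts"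
    proof
      fix e assume e: "e \<in> O'"
      have "?\<phi> e \<in> O'" using e unfolding d(2) by (rule orbit.step)
      then have "?\<phi> e \<notin> leg_darts" "?\<phi> e \<in> darts" using d(3) sub[OF d(1)] d(2) by blast+
      then have "fst (?\<phi> e) \<notin> X" using tree_darts_props(1) GX N(1) by (fastforce simp: darts_def leg_darts_def)
      then have "snd e \<notin> X" using fst\<phi>[of e] by simp
      moreover have "e \<in> darts" "e \<notin> leg_darts" using e d(2,3) sub[OF d(1)] by blast+
      ultimately show "e \<in> tree_darts" by (auto simp: darts_def leg_darts_def)
    qed
    have dt: "d \<in> tree_darts" using Ot self[OF d(1)] d(2) by auto
    have "orbit (?\<tau> \<circ> prod.swap) d = orbit ?\<phi> d"
    proof (rule orbit_cong[OF self[OF d(1)]])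
      fix s assume s: "s \<in> orbit ?\<phi> d"
      then have "s \<in> tree_darts" "?\<phi> s \<in> tree_darts" using Ot d(2) orbit.step[OF s] by auto
      moreover have "prod.swap s \<in> tree_darts" using \<open>s \<in> tree_darts\<close> tree_darts_props(2) by (cases s) (auto simp: sym_def)
      ultimately show "(?\<tau> \<circ> prod.swap) s = ?\<phi> s" using H.sub_rotation_agrees by auto
    qed
    then show "O' \<in> orbit (?\<tau> \<circ> prod.swap) ` tree_darts" using dt d(2) by (metis imageI)
  qed
  then have "card ?Z \<le> card (orbit (?\<tau> \<circ> prod.swap) ` tree_darts)"
    using finite_darts by (intro card_mono) auto
  moreover have "?I \<subseteq> {v \<in> G. v \<notin> fst ` tree_darts}"
  proof -
    have "x \<in> fst ` darts" if "x \<in> X" for x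
    proof -
      have "N x \<noteq> {}" using N(2)[OF that] by auto
      then obtain a where "a \<in> N x" by auto
      then have "(x, a) \<in> darts" using that by (auto simp: darts_def leg_darts_def)
      then show ?thesis by force
    qed
    then show ?thesis using td by force
  qed
  then have "card ?I \<le> card {v \<in> G. v \<notin> fst ` tree_darts}" using fin by (intro card_mono) auto
  ultimately have ZI: "card ?Z + card ?I \<le> card Q"
    using forest_faces[OF F.embedded_graph_axioms] by (simp add: num_faces_def)

  \<comment> \<open>With a single leg dart \<open>(x, a)\<close>, the face enters the tree of
    \<open>a\<close>, cannot visit another vertex of \<open>X\<close> and must come back to
    \<open>x\<close> from this tree. Since \<open>x\<close> has only one neighbour there, it returns
    along \<open>(a, x)\<close>, so \<sigma> fixes \<open>(x, a)\<close> and \<open>x\<close> has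
    degree 1 instead of 3.\<close>
  have two: "card (O' \<inter> leg_darts) \<ge> 2" if O': "O' \<in> ?L" for O'
  proof (rule ccontr)
    assume less: "\<not> 2 \<le> card (O' \<inter> leg_darts)"
    obtain d where d: "d \<in> darts" "O' = orbit ?\<phi> d" "O' \<inter> leg_darts \<noteq> {}" using O' by auto
    then obtain x a where xa: "(x, a) \<in> O'" "(x, a) \<in> leg_darts" by auto
    have uniq: "e = (x, a)" if "e \<in> O'" "e \<in> leg_darts" for e
    proof (rule ccontr)
      assume "e \<noteq> (x, a)"
      then have "card {e, (x, a)} = 2" by simp
      moreover have "card {e, (x, a)} \<le> card (O' \<inter> leg_darts)"
        using that xa finite_darts by (intro card_mono) auto
      ultimately show False using less by simp
    qed
    have xX: "x \<in> X" and aN: "a \<in> N x" using xa by (auto simp: leg_darts_def)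
    have xad: "(x, a) \<in> darts" using xa by (auto simp: darts_def)
    have O'eq: "O' = orbit ?\<phi> (x, a)" using oeq[OF d(1)] xa(1) d(2) by simp
    have stepO: "?\<phi> e \<in> O'" if "e \<in> O'" for e using that unfolding d(2) by (rule orbit.step)
    have OD: "O' \<subseteq> darts" using d(2) sub[OF d(1)] by simp
    \<comment> \<open>The darts available to such a face: its leg dart, the darts of the tree of
      \<open>a\<close>, and the darts from this tree back to \<open>x\<close>.\<close>
    define S where "S = {(x, a)} \<union> {(u, v) \<in> tree_darts. root v = root a} \<union> {(b, x) | b. b \<in> N x \<and> root b = root a}"
    have leave: "e \<in> S" if e: "e \<in> O'" "fst e \<in> G" "root (fst e) = root a" for e
    proof (cases "e \<in> tree_darts")
      case True
      then show ?thesis using e tree_darts_props(3) by (cases e) (auto simp: S_def)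
    next
      case False
      have "e \<notin> leg_darts" using e(2) GX by (auto simp: leg_darts_def)
      then obtain y b where e': "e = (b, y)" "y \<in> X" "b \<in> N y"
        using False OD e(1) by (auto simp: darts_def leg_darts_def)
      have "fst (?\<phi> e) = y" using fst\<phi>[of e] e' by simp
      moreover have "?\<phi> e \<in> darts" using stepO[OF e(1)] OD by auto
      ultimately have "?\<phi> e \<in> leg_darts"
        using e'(2) tree_darts_props(1) GX N(1) by (fastforce simp: darts_def leg_darts_def)
      from uniq[OF stepO[OF e(1)] this] \<open>fst (?\<phi> e) = y\<close> have "y = x" by simp
      then show ?thesis using e e' by (auto simp: S_def)
    qed
    have O'S: "O' \<subseteq> S"
    proof -
      have "orbit ?\<phi> (x, a) \<subseteq> S \<inter> O'"
      proof (rule orbit_least)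
        have aG: "a \<in> G" using aN N(1) xX by auto
        have "?\<phi> (x, a) \<in> O'" using stepO[OF xa(1)] .
        then show "?\<phi> (x, a) \<in> S \<inter> O'" using leave[of "?\<phi> (x, a)"] fst\<phi>[of "(x, a)"] aG by auto
        fix e assume e: "e \<in> S \<inter> O'"
        then consider "e = (x, a)" | u v where "e = (u, v)" "(u, v) \<in> tree_darts" "root v = root a"
          | b where "e = (b, x)" by (auto simp: S_def)
        then show "?\<phi> e \<in> S \<inter> O'"
        proof cases
          case 1 then show ?thesis using \<open>?\<phi> (x, a) \<in> S \<inter> O'\<close> by simp
        next
          case 2
          then show ?thesis using leave[of "?\<phi> e"] stepO[of e] e fst\<phi>[of e] tree_darts_props(1) by auto
        next
          case 3
          have fe: "fst (?\<phi> e) = x" using fst\<phi>[of e] 3 by simp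
          have eO: "?\<phi> e \<in> O'" using stepO[of e] e by blast
          then have "?\<phi> e \<in> darts" using OD by blast
          then have "?\<phi> e \<in> leg_darts"
            using fe xX tree_darts_props(1) GX N(1) by (fastforce simp: darts_def leg_darts_def)
          then have "?\<phi> e = (x, a)" using uniq[OF eO] by simp
          then show ?thesis using xa(1) by (simp add: S_def)
        qed
      qed
      then show ?thesis using O'eq by auto
    qed
    have "(x, a) \<in> orbit ?\<phi> (x, a)" using self[OF xad] .
    then have "\<exists>e. e \<in> O' \<and> (x, a) = ?\<phi> e"
    proof cases
      case base then show ?thesis using xa(1) by blast
    next
      case (step y) then show ?thesis unfolding O'eq by blast
    qed
    then obtain e where e: "e \<in> O'" "(x, a) = ?\<phi> e" by blast
    then have "snd e = x" using fst\<phi>[of e] by (metis fst_conv)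
    moreover have "e \<in> S" using O'S e by auto
    moreover have "x \<noteq> a" "x \<notin> G" using GX xX aN N(1)[OF xX] by auto
    ultimately obtain b where b: "e = (b, x)" "b \<in> N x" "root b = root a"
      using tree_darts_props(1) by (cases e) (auto simp: S_def)
    have "b = a" using N(3)[OF xX] b aN by (auto dest: inj_onD)
    then have "\<sigma> (x, a) = (x, a)" using e b by simp
    then have "orbit \<sigma> (x, a) = {(x, a)}" by (simp add: orbit_eq_singleton_iff)
    moreover have "orbit \<sigma> (x, a) = {d' \<in> darts. fst d' = x}" using H.orb[OF xad] by simp
    moreover have "{x} \<times> N x \<subseteq> {d' \<in> darts. fst d' = x}" using xX by (auto simp: darts_def leg_darts_def)
    ultimately have "{x} \<times> N x \<subseteq> {(x, a)}" by simp
    then have "N x \<subseteq> {a}" by auto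
    then have "card (N x) \<le> 1" using card_mono[of "{a}" "N x"] by simp
    then show False using N(2)[OF xX] by simp
  qed
  have "2 * card ?L \<le> (\<Sum>O'\<in>?L. card (O' \<inter> leg_darts))"
    using sum_mono[of ?L "\<lambda>_. 2" "\<lambda>O'. card (O' \<inter> leg_darts)"] two by simp
  also have "\<dots> = card (\<Union>O'\<in>?L. O' \<inter> leg_darts)"
  proof (rule card_UN_disjoint[symmetric])
    show "finite ?L" using finite_darts by auto
    show "\<forall>O'\<in>?L. finite (O' \<inter> leg_darts)" using finite_darts by auto
    show "\<forall>A\<in>?L. \<forall>B\<in>?L. A \<noteq> B \<longrightarrow> A \<inter> leg_darts \<inter> (B \<inter> leg_darts) = {}"
    proof (intro ballI impI)
      fix A B assume "A \<in> ?L" "B \<in> ?L" "A \<noteq> B"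
      then obtain c d where AB: "A = orbit ?\<phi> c" "c \<in> darts" "B = orbit ?\<phi> d" "d \<in> darts" by auto
      have "e \<notin> B" if "e \<in> A" for e
      proof
        assume "e \<in> B"
        then have "A = B" using that oeq[OF AB(2), of e] oeq[OF AB(4), of e] AB(1,3) by simp
        then show False using \<open>A \<noteq> B\<close> by simp
      qed
      then show "A \<inter> leg_darts \<inter> (B \<inter> leg_darts) = {}" by blast
    qed
  qed
  also have "\<dots> \<le> card leg_darts" using finite_darts by (intro card_mono) auto
  finally have L: "2 * card ?L \<le> 3 * card X" using card_leg_darts by simp
  have "orbit ?\<phi> ` darts = ?Z \<union> ?L" by auto
  then have "card (orbit ?\<phi> ` darts) \<le> card ?Z + card ?L" using card_Un_le[of ?Z ?L] by presburger
  then have faces: "num_faces (G \<union> X) darts \<sigma> \<le> card Q + card ?L"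
    using ZI by (simp add: num_faces_def)
  have "card G = card Q + card (G - Q)"
    using fin(1) QG by (metis card_Diff_subset card_mono finite_subset le_add_diff_inverse)
  moreover have "card (G \<union> X) = card G + card X" using fin GX by (simp add: card_Un_disjoint)
  ultimately have "genus2 (G \<union> X) darts \<sigma> \<ge> 2 * int (card X) - 2 * int (card Q) - int (card ?L)"
    using faces card_darts unfolding genus2_def by simp
  then show ?thesis using L by linarith
qed

lemma card_le_graph_genus:
  assumes "finite V" "D \<subseteq> V \<times> V" "sym D" "\<And>u. (u, u) \<notin> D"
    and "G \<union> X \<subseteq> V" "darts \<subseteq> D"
  shows "card X \<le> 4 * card Q + 4 * graph_genus V D"
proof -
  obtain \<sigma> where \<sigma>: "embedded_graph V D \<sigma>" "genus2 V D \<sigma> = 2 * int (graph_genus V D)"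
    using graph_genus_attained[OF assms(1-4)] .
  interpret E: embedded_graph V D \<sigma> by fact
  note s = assms(6) darts_props(1) assms(5) darts_props(2)
  from card_le_of_embedding[OF E.embedded_subgraph[OF s]] E.genus2_sub_rotation[OF s] \<sigma>(2)
  show ?thesis by linarith
qed

end

section \<open>Polynomial-time tree functions\<close>

lemma tsize_pos [simp]: "tsize x > 0"
  by (cases x) auto

lemma tsize_ge_1 [simp]: "Suc 0 \<le> tsize x"
  using tsize_pos[of x] by linarith

lemma runs_output_size: "runs p x y \<tau> \<Longrightarrow> tsize y \<le> \<tau>"
proof (induct rule: runs.induct)
  case (runs_Left x) show ?case by (cases x) auto
next
  case (runs_Right x) show ?case by (cases x) auto
next
  case (runs_Eq x) show ?case by (cases "left x = right x") auto
next
  case (runs_Pair p x y a q z b) then show ?case using tsize_ge_1[of x] by (simp del: tsize_ge_1)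
qed auto

text \<open>A single constant serves as factor and as exponent. Sizes are at least 1, so enlarging
  it only weakens the bound, which makes closure under sums and products simple.\<close>

definition polyb :: "(tree \<Rightarrow> nat) \<Rightarrow> bool" where
  "polyb b \<longleftrightarrow> (\<exists>c. \<forall>x. b x \<le> c * tsize x ^ c)"

lemma polyb_mono: "polyb g \<Longrightarrow> (\<And>x. f x \<le> g x) \<Longrightarrow> polyb f"
  unfolding polyb_def by (meson order_trans)

lemma polyb_const: "polyb (\<lambda>_. k)"
  unfolding polyb_def by (intro exI[of _ k]) auto

lemma polyb_tsize: "polyb tsize"
  unfolding polyb_def by (intro exI[of _ 1]) auto

lemma polyb_add: assumes "polyb f" "polyb g" shows "polyb (\<lambda>x. f x + g x)"
proof -
  obtain c d where c: "\<And>x. f x \<le> c * tsize x ^ c" and d: "\<And>x. g x \<le> d * tsize x ^ d"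
    using assms by (auto simp: polyb_def)
  have "f x + g x \<le> (c + d) * tsize x ^ (c + d)" for x
  proof -
    have "c * tsize x ^ c \<le> c * tsize x ^ (c + d)" "d * tsize x ^ d \<le> d * tsize x ^ (c + d)"
      by (intro mult_left_mono power_increasing; simp)+
    then show ?thesis using c[of x] d[of x] unfolding distrib_right by linarith
  qed
  then show ?thesis unfolding polyb_def by blast
qed

lemma polyb_mult: assumes "polyb f" "polyb g" shows "polyb (\<lambda>x. f x * g x)"
proof -
  obtain c d where c: "\<And>x. f x \<le> c * tsize x ^ c" and d: "\<And>x. g x \<le> d * tsize x ^ d"
    using assms by (auto simp: polyb_def)
  have "f x * g x \<le> (c * d + c + d) * tsize x ^ (c * d + c + d)" for x
  proof -
    have "f x * g x \<le> (c * tsize x ^ c) * (d * tsize x ^ d)" using c d by (intro mult_mono) auto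
    also have "\<dots> = (c * d) * tsize x ^ (c + d)" by (simp add: power_add)
    also have "\<dots> \<le> (c * d + c + d) * tsize x ^ (c * d + c + d)"
      by (intro mult_mono power_increasing) auto
    finally show ?thesis .
  qed
  then show ?thesis unfolding polyb_def by blast
qed

lemma polyb_power: "polyb f \<Longrightarrow> polyb (\<lambda>x. f x ^ k)"
  by (induct k) (auto intro: polyb_const polyb_mult)

lemmas polyb_intros = polyb_const polyb_tsize polyb_add polyb_mult polyb_power

text \<open>The bound is required on all trees, not only on valid encodings. Closure properties then
  need no side conditions, and well-formedness appears only in the correctness proofs.\<close>

definition ptime :: "(tree \<Rightarrow> tree) \<Rightarrow> bool" where
  "ptime F \<longleftrightarrow> (\<exists>p T. polyb T \<and> (\<forall>x. \<exists>\<tau>. runs p x (F x) \<tau> \<and> \<tau> \<le> T x))"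

lemma ptimeI:
  assumes "polyb T" "\<And>x. \<exists>\<tau>. runs p x (F x) \<tau> \<and> \<tau> \<le> T x"
  shows "ptime F"
  using assms by (auto simp: ptime_def)

lemma ptimeE:
  assumes "ptime F"
  obtains p c where "\<And>x. \<exists>\<tau>. runs p x (F x) \<tau> \<and> \<tau> \<le> c * tsize x ^ c"
  using assms unfolding ptime_def polyb_def by (meson order_trans)

lemma ptime_size:
  assumes "ptime F"
  shows "polyb (\<lambda>x. tsize (F x))"
  using assms unfolding ptime_def by (metis polyb_mono runs_output_size order_trans)

lemma ptime_id: "ptime (\<lambda>x. x)"
  by (rule ptimeI[OF polyb_tsize, of PId]) (auto intro: runs.intros)

lemma ptime_comp:
  assumes "ptime G" "ptime F"
  shows "ptime (\<lambda>x. G (F x))"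
proof -
  obtain p c where p: "\<And>x. \<exists>\<tau>. runs p x (F x) \<tau> \<and> \<tau> \<le> c * tsize x ^ c" by (rule ptimeE[OF assms(2)]) blast
  obtain q d where q: "\<And>x. \<exists>\<tau>. runs q x (G x) \<tau> \<and> \<tau> \<le> d * tsize x ^ d" by (rule ptimeE[OF assms(1)]) blast
  show ?thesis
  proof (rule ptimeI[of "\<lambda>x. c * tsize x ^ c + d * tsize (F x) ^ d + tsize x" "PSeq p q"])
    show "polyb (\<lambda>x. c * tsize x ^ c + d * tsize (F x) ^ d + tsize x)"
      by (intro polyb_intros ptime_size assms)
    fix x
    obtain a b where "runs p x (F x) a" "a \<le> c * tsize x ^ c" "runs q (F x) (G (F x)) b" "b \<le> d * tsize (F x) ^ d"
      using p q by metis
    then show "\<exists>\<tau>. runs (PSeq p q) x (G (F x)) \<tau> \<and> \<tau> \<le> c * tsize x ^ c + d * tsize (F x) ^ d + tsize x"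
      by (intro exI[of _ "a + b + tsize x"]) (auto intro: runs_Seq)
  qed
qed

lemma ptime_Node:
  assumes "ptime F" "ptime G"
  shows "ptime (\<lambda>x. Node (F x) (G x))"
proof -
  obtain p c where p: "\<And>x. \<exists>\<tau>. runs p x (F x) \<tau> \<and> \<tau> \<le> c * tsize x ^ c" by (rule ptimeE[OF assms(1)]) blast
  obtain q d where q: "\<And>x. \<exists>\<tau>. runs q x (G x) \<tau> \<and> \<tau> \<le> d * tsize x ^ d" by (rule ptimeE[OF assms(2)]) blast
  show ?thesis
  proof (rule ptimeI[of "\<lambda>x. c * tsize x ^ c + d * tsize x ^ d + tsize x" "PPair p q"])
    show "polyb (\<lambda>x. c * tsize x ^ c + d * tsize x ^ d + tsize x)" by (intro polyb_intros)
    fix x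
    obtain a b where "runs p x (F x) a" "a \<le> c * tsize x ^ c" "runs q x (G x) b" "b \<le> d * tsize x ^ d"
      using p q by metis
    then show "\<exists>\<tau>. runs (PPair p q) x (Node (F x) (G x)) \<tau> \<and> \<tau> \<le> c * tsize x ^ c + d * tsize x ^ d + tsize x"
      by (intro exI[of _ "a + b + tsize x"]) (auto intro: runs_Pair)
  qed
qed

lemma ptime_left: "ptime F \<Longrightarrow> ptime (\<lambda>x. left (F x))"
  by (rule ptime_comp[of left], rule ptimeI[OF polyb_tsize, of PLeft]) (auto intro: runs.intros)

lemma ptime_right: "ptime F \<Longrightarrow> ptime (\<lambda>x. right (F x))"
  by (rule ptime_comp[of right], rule ptimeI[OF polyb_tsize, of PRight]) (auto intro: runs.intros)

text \<open>Under a bounded quantifier or inside a map, the input becomes the pair of the bound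
  element and the old input. This lemma carries functions of the old input into that
  context.\<close>

lemma ptime_weaken: "ptime F \<Longrightarrow> ptime (\<lambda>x. F (right x))"
  by (rule ptime_comp[OF _ ptime_right[OF ptime_id]])

lemma ptime_const: "ptime (\<lambda>_. t)"
proof (induct t)
  case Leaf show ?case by (rule ptimeI[OF polyb_tsize, of PNil]) (auto intro: runs.intros)
qed (rule ptime_Node)

definition pdec :: "(tree \<Rightarrow> bool) \<Rightarrow> bool" where
  "pdec P \<longleftrightarrow> ptime (\<lambda>x. enc_bool (P x))"

lemma enc_bool_Leaf [simp]: "enc_bool b = Leaf \<longleftrightarrow> \<not> b" "Leaf = enc_bool b \<longleftrightarrow> \<not> b"
  by (cases b; simp)+

lemma ptime_if_tree:
  assumes "ptime H" "ptime F" "ptime G"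
  shows "ptime (\<lambda>x. if H x \<noteq> Leaf then F x else G x)"
proof -
  obtain p c where p: "\<And>x. \<exists>\<tau>. runs p x (F x) \<tau> \<and> \<tau> \<le> c * tsize x ^ c" by (rule ptimeE[OF assms(2)]) blast
  obtain q d where q: "\<And>x. \<exists>\<tau>. runs q x (G x) \<tau> \<and> \<tau> \<le> d * tsize x ^ d" by (rule ptimeE[OF assms(3)]) blast
  obtain r e where r: "\<And>x. \<exists>\<tau>. runs r x (H x) \<tau> \<and> \<tau> \<le> e * tsize x ^ e" by (rule ptimeE[OF assms(1)]) blast
  let ?T = "\<lambda>x. c * tsize x ^ c + d * tsize x ^ d + e * tsize x ^ e + tsize x"
  show ?thesis
  proof (rule ptimeI[of ?T "PIf r p q"])
    show "polyb ?T" by (intro polyb_intros)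
    fix x
    obtain a1 a2 a3 where a: "runs p x (F x) a1" "a1 \<le> c * tsize x ^ c" "runs q x (G x) a2" "a2 \<le> d * tsize x ^ d"
      "runs r x (H x) a3" "a3 \<le> e * tsize x ^ e"
      using p q r by metis
    show "\<exists>\<tau>. runs (PIf r p q) x (if H x \<noteq> Leaf then F x else G x) \<tau> \<and> \<tau> \<le> ?T x"
    proof (cases "H x = Leaf")
      case True
      then have "runs (PIf r p q) x (G x) (a3 + a2 + tsize x)" using a by (intro runs_If_False) auto
      then show ?thesis using True a by (intro exI[of _ "a3 + a2 + tsize x"]) auto
    next
      case False
      then have "runs (PIf r p q) x (F x) (a3 + a1 + tsize x)" using a by (intro runs_If_True) auto
      then show ?thesis using False a by (intro exI[of _ "a3 + a1 + tsize x"]) auto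
    qed
  qed
qed

lemma ptime_if:
  assumes "pdec P" "ptime F" "ptime G"
  shows "ptime (\<lambda>x. if P x then F x else G x)"
  using ptime_if_tree[OF assms[unfolded pdec_def]] by simp

lemma pdec_eq:
  assumes "ptime F" "ptime G"
  shows "pdec (\<lambda>x. F x = G x)"
proof -
  have "ptime (\<lambda>x. enc_bool (left x = right x))"
    by (rule ptimeI[of "\<lambda>x. tsize x + 2" PEq], intro polyb_intros) (blast intro: runs.intros)
  from ptime_comp[OF this ptime_Node[OF assms]] show ?thesis by (simp add: pdec_def)
qed

lemma pdec_const: "pdec (\<lambda>_. b)"
  unfolding pdec_def by (rule ptime_const)

lemma pdec_not: assumes "pdec P" shows "pdec (\<lambda>x. \<not> P x)"
proof -
  have "ptime (\<lambda>x. if P x then enc_bool False else enc_bool True)"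
    by (intro ptime_if ptime_const assms)
  also have "(\<lambda>x. if P x then enc_bool False else enc_bool True) = (\<lambda>x. enc_bool (\<not> P x))" by auto
  finally show ?thesis by (simp add: pdec_def)
qed

lemma pdec_conj: assumes "pdec P" "pdec Q" shows "pdec (\<lambda>x. P x \<and> Q x)"
proof -
  have "ptime (\<lambda>x. if P x then enc_bool (Q x) else enc_bool False)"
    by (intro ptime_if ptime_const assms assms(2)[unfolded pdec_def])
  also have "(\<lambda>x. if P x then enc_bool (Q x) else enc_bool False) = (\<lambda>x. enc_bool (P x \<and> Q x))" by auto
  finally show ?thesis by (simp add: pdec_def)
qed

lemma pdec_disj: assumes "pdec P" "pdec Q" shows "pdec (\<lambda>x. P x \<or> Q x)"
  using pdec_not[OF pdec_conj[OF assms[THEN pdec_not]]] by simp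

lemma pdec_imp: assumes "pdec P" "pdec Q" shows "pdec (\<lambda>x. P x \<longrightarrow> Q x)"
  unfolding imp_conv_disj by (intro pdec_disj pdec_not assms)

text \<open>The loop runs while the left component of the state, a counter or the rest of a list, is
  nonempty. Its cost is measured by a bound \<open>M\<close> on the states instead of the input, so
  that it also covers loops whose states are not of polynomial size.\<close>

lemma while_runs:
  assumes "ptime F"
  obtains p c where "\<And>m x M. (\<And>i. i < m \<Longrightarrow> left ((F ^^ i) x) \<noteq> Leaf) \<Longrightarrow> left ((F ^^ m) x) = Leaf \<Longrightarrow>
      (\<And>i. i \<le> m \<Longrightarrow> tsize ((F ^^ i) x) \<le> M) \<Longrightarrow>
      \<exists>\<tau>. runs p x ((F ^^ m) x) \<tau> \<and> \<tau> \<le> (m + 1) * (c * M ^ c)"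
proof -
  obtain q d where q: "\<And>x. \<exists>\<tau>. runs q x (F x) \<tau> \<and> \<tau> \<le> d * tsize x ^ d" by (rule ptimeE[OF assms]) blast
  let ?p = "PWhile PLeft q" and ?c = "d + 2"
  have bound: "d * n ^ d + 2 * n \<le> ?c * M ^ ?c" if "n \<le> M" "1 \<le> n" for n M :: nat
  proof -
    have "n ^ d \<le> M ^ d" using that by (intro power_mono) auto
    moreover have "M ^ d \<le> M ^ ?c" using that by (intro power_increasing) auto
    ultimately have "n ^ d \<le> M ^ ?c" by (rule order_trans)
    then have "d * n ^ d \<le> d * M ^ ?c" by (intro mult_left_mono) auto
    moreover have "n \<le> M ^ ?c" using that order_trans[OF that(1) self_le_power[of M ?c]] by auto
    ultimately show ?thesis unfolding distrib_right by linarith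
  qed
  show thesis
  proof (rule that[of ?p ?c])
    fix m x M
    assume "\<And>i. i < m \<Longrightarrow> left ((F ^^ i) x) \<noteq> Leaf" "left ((F ^^ m) x) = Leaf"
      "\<And>i. i \<le> m \<Longrightarrow> tsize ((F ^^ i) x) \<le> M"
    then show "\<exists>\<tau>. runs ?p x ((F ^^ m) x) \<tau> \<and> \<tau> \<le> (m + 1) * (?c * M ^ ?c)"
    proof (induction m arbitrary: x)
      case 0
      have "runs ?p x x (tsize x + tsize x)"
        using 0 by (intro runs_While_stop) (metis funpow_0 runs_Left)
      moreover have "tsize x + tsize x \<le> ?c * M ^ ?c" using bound[of "tsize x" M] 0(3)[of 0] by simp
      ultimately show ?case by auto
    next
      case (Suc m)
      have e: "(F ^^ i) (F x) = (F ^^ Suc i) x" for i by (simp add: funpow_swap1)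
      have "\<exists>\<tau>. runs ?p (F x) ((F ^^ m) (F x)) \<tau> \<and> \<tau> \<le> (m + 1) * (?c * M ^ ?c)"
      proof (rule Suc.IH)
        show "left ((F ^^ i) (F x)) \<noteq> Leaf" if "i < m" for i unfolding e using that by (intro Suc.prems) auto
        show "left ((F ^^ m) (F x)) = Leaf" unfolding e by (rule Suc.prems)
        show "tsize ((F ^^ i) (F x)) \<le> M" if "i \<le> m" for i unfolding e using that by (intro Suc.prems) auto
      qed
      then obtain \<tau> where \<tau>: "runs ?p (F x) ((F ^^ m) (F x)) \<tau>" "\<tau> \<le> (m + 1) * (?c * M ^ ?c)" by auto
      obtain b where b: "runs q x (F x) b" "b \<le> d * tsize x ^ d" using q by metis
      have "runs ?p x ((F ^^ m) (F x)) (tsize x + b + \<tau> + tsize x)"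
        by (rule runs_While_step[OF runs_Left _ b(1) \<tau>(1)]) (use Suc.prems(1)[of 0] in auto)
      moreover have "tsize x + b + \<tau> + tsize x \<le> (Suc m + 1) * (?c * M ^ ?c)"
        using bound[of "tsize x" M] b(2) \<tau>(2) Suc.prems(3)[of 0] by (simp add: algebra_simps)
      ultimately show ?case unfolding e by blast
    qed
  qed
qed

subsection \<open>Trees as lists\<close>

text \<open>Every tree is the list of the left subtrees along its right spine. Hence
  \<open>to_list\<close> and \<open>of_list\<close> are mutually inverse, and list functions are
  total functions on trees.\<close>

fun to_list :: "tree \<Rightarrow> tree list" where
  "to_list Leaf = []"
| "to_list (Node a l) = a # to_list l"

abbreviation "of_list \<equiv> enc_list (\<lambda>x. x)"

lemma to_list_of_list [simp]: "to_list (of_list xs) = xs"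
  by (induct xs) auto

lemma of_list_to_list [simp]: "of_list (to_list x) = x"
  by (induct x) auto

lemma enc_list_conv: "enc_list e xs = of_list (map e xs)"
  by (induct xs) auto

lemma to_list_enc_list [simp]: "to_list (enc_list e xs) = map e xs"
  by (induct xs) auto

lemma to_list_enc_unary [simp]: "to_list (enc_unary n) = replicate n Leaf"
  by (induct n) auto

lemma of_list_replicate: "of_list (replicate n Leaf) = enc_unary n"
  by (induct n) auto

lemma tsize_of_list_le: "(\<And>x. x \<in> set xs \<Longrightarrow> tsize x \<le> b) \<Longrightarrow> tsize (of_list xs) \<le> Suc (length xs * Suc b)"
  by (induct xs) force+

lemma length_to_list: "length (to_list x) \<le> tsize x"
  by (induct x) auto

lemma tsize_elem: "a \<in> set (to_list x) \<Longrightarrow> tsize a \<le> tsize x"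
  by (induct x) auto

lemma tsize_drop: "tsize (of_list (drop n (to_list x))) \<le> tsize x"
proof (induct n arbitrary: x)
  case (Suc n)
  show ?case
  proof (cases x)
    case (Node a l)
    show ?thesis using Suc[of l] Node by simp
  qed simp
qed simp

text \<open>A while loop whose state holds the rest of the list, the input and the accumulator. The
  bound \<open>B\<close> on all intermediate accumulators is essential, since iterating a
  polynomial-time function may lead to exponential size.\<close>

lemma ptime_fold:
  assumes l: "ptime l" and init: "ptime i" and F: "ptime (\<lambda>y. F (left y) (left (right y)) (right (right y)))"
    and B: "polyb B" "\<And>x j. tsize (fold (\<lambda>a. F a x) (take j (to_list (l x))) (i x)) \<le> B x"
  shows "ptime (\<lambda>x. fold (\<lambda>a. F a x) (to_list (l x)) (i x))"
proof -
  let ?step = "\<lambda>s. Node (right (left s)) (Node (left (right s)) (F (left (left s)) (left (right s)) (right (right s))))"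
  have "ptime (\<lambda>s. (\<lambda>y. F (left y) (left (right y)) (right (right y))) (Node (left (left s)) (right s)))"
    by (rule ptime_comp[OF F]) (intro ptime_Node ptime_left ptime_right ptime_id)
  then have "ptime ?step" by (intro ptime_Node ptime_left ptime_right ptime_id) simp
  then obtain p c where p: "\<And>m x M. (\<And>i. i < m \<Longrightarrow> left ((?step ^^ i) x) \<noteq> Leaf) \<Longrightarrow> left ((?step ^^ m) x) = Leaf \<Longrightarrow>
      (\<And>i. i \<le> m \<Longrightarrow> tsize ((?step ^^ i) x) \<le> M) \<Longrightarrow>
      \<exists>\<tau>. runs p x ((?step ^^ m) x) \<tau> \<and> \<tau> \<le> (m + 1) * (c * M ^ c)"
    by (rule while_runs) blast
  let ?init = "\<lambda>x. Node (l x) (Node x (i x))"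
  have pin: "ptime ?init" by (intro ptime_Node ptime_id l init)
  let ?st = "\<lambda>x j. Node (of_list (drop j (to_list (l x)))) (Node x (fold (\<lambda>a. F a x) (take j (to_list (l x))) (i x)))"
  have st: "(?step ^^ j) (?init x) = ?st x j" if "j \<le> length (to_list (l x))" for x j
    using that
  proof (induction j)
    case (Suc j)
    have d: "drop j (to_list (l x)) = to_list (l x) ! j # drop (Suc j) (to_list (l x))"
      using Suc.prems by (simp add: Cons_nth_drop_Suc)
    have t: "take (Suc j) (to_list (l x)) = take j (to_list (l x)) @ [to_list (l x) ! j]"
      using Suc.prems by (simp add: take_Suc_conv_app_nth)
    show ?case unfolding t using Suc by (simp add: d)
  qed simp
  let ?M = "\<lambda>x. tsize (l x) + tsize x + B x + 2"
  let ?T = "\<lambda>x. (tsize (l x) + 1) * (c * ?M x ^ c)"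
  have "\<exists>\<tau>. runs p (?init x) (?st x (length (to_list (l x)))) \<tau> \<and> \<tau> \<le> ?T x" for x
  proof -
    let ?m = "length (to_list (l x))"
    have "\<exists>\<tau>. runs p (?init x) ((?step ^^ ?m) (?init x)) \<tau> \<and> \<tau> \<le> (?m + 1) * (c * ?M x ^ c)"
    proof (rule p)
      show "left ((?step ^^ j) (?init x)) \<noteq> Leaf" if "j < ?m" for j
      proof -
        have "drop j (to_list (l x)) = to_list (l x) ! j # drop (Suc j) (to_list (l x))"
          using that by (simp add: Cons_nth_drop_Suc)
        then show ?thesis using st[of j x] that by simp
      qed
      show "left ((?step ^^ ?m) (?init x)) = Leaf" using st[of ?m x] by simp
      show "tsize ((?step ^^ j) (?init x)) \<le> ?M x" if "j \<le> ?m" for j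
        using st[OF that] B(2)[where x=x and j=j] tsize_drop[of j "l x"] by simp
    qed
    moreover have "(?m + 1) * (c * ?M x ^ c) \<le> ?T x" using length_to_list[of "l x"] by (intro mult_right_mono) auto
    ultimately obtain \<tau> where "runs p (?init x) ((?step ^^ ?m) (?init x)) \<tau>" "\<tau> \<le> ?T x"
      by (meson order_trans)
    then show ?thesis unfolding st[OF order_refl] by blast
  qed
  note pr = this
  obtain q d where q: "\<And>x. \<exists>\<tau>. runs q x (?init x) \<tau> \<and> \<tau> \<le> d * tsize x ^ d" by (rule ptimeE[OF pin]) blast
  have "ptime (\<lambda>x. ?st x (length (to_list (l x))))"
  proof (rule ptimeI[of "\<lambda>x. d * tsize x ^ d + ?T x + tsize x" "PSeq q p"])
    show "polyb (\<lambda>x. d * tsize x ^ d + ?T x + tsize x)" by (intro polyb_intros B(1) ptime_size l)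
    fix x
    obtain a b where "runs q x (?init x) a" "a \<le> d * tsize x ^ d"
      "runs p (?init x) (?st x (length (to_list (l x)))) b" "b \<le> ?T x"
      using q pr by metis
    then show "\<exists>\<tau>. runs (PSeq q p) x (?st x (length (to_list (l x)))) \<tau> \<and> \<tau> \<le> d * tsize x ^ d + ?T x + tsize x"
      by (intro exI[of _ "a + b + tsize x"]) (auto intro: runs_Seq)
  qed
  from ptime_right[OF ptime_right[OF this]] show ?thesis by simp
qed

definition elems :: "tree \<Rightarrow> tree set" where
  "elems x = set (to_list x)"

text \<open>A fold with a truth value as accumulator, whose size never exceeds 3.\<close>

lemma pdec_Bex:
  assumes l: "ptime l" and P: "pdec (\<lambda>y. P (left y) (right y))"
  shows "pdec (\<lambda>x. \<exists>a\<in>elems (l x). P a x)"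
proof -
  let ?F = "\<lambda>a x acc. enc_bool (acc \<noteq> Leaf \<or> P a x)"
  have eq: "fold (\<lambda>a. ?F a x) xs (enc_bool b) = enc_bool (b \<or> (\<exists>a\<in>set xs. P a x))" for xs b x
  proof (induct xs arbitrary: b)
    case (Cons a xs)
    have "fold (\<lambda>a. ?F a x) (a # xs) (enc_bool b) = fold (\<lambda>a. ?F a x) xs (enc_bool (b \<or> P a x))"
      by (cases b) auto
    also have "\<dots> = enc_bool (b \<or> (\<exists>a\<in>set (a # xs). P a x))" unfolding Cons by (simp add: disj_assoc)
    finally show ?case .
  qed simp
  have "ptime (\<lambda>x. fold (\<lambda>a. ?F a x) (to_list (l x)) (enc_bool False))"
  proof (rule ptime_fold[OF l ptime_const _ polyb_const[of 3]])
    have P': "pdec (\<lambda>y. P (left y) (left (right y)))"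
      using ptime_comp[OF P[unfolded pdec_def], of "\<lambda>y. Node (left y) (left (right y))"]
      by (simp add: pdec_def ptime_Node ptime_left ptime_right ptime_id)
    show "ptime (\<lambda>y. ?F (left y) (left (right y)) (right (right y)))"
      by (fold pdec_def, intro pdec_disj P' pdec_not pdec_eq ptime_right ptime_id ptime_const)
    show "tsize (fold (\<lambda>a. ?F a x) (take j (to_list (l x))) (enc_bool False)) \<le> 3" for x j
      unfolding eq by (cases "\<exists>a\<in>set (take j (to_list (l x))). P a x") auto
  qed
  then show ?thesis unfolding eq pdec_def elems_def by simp
qed

lemma pdec_Ball:
  assumes "ptime l" "pdec (\<lambda>y. P (left y) (right y))"
  shows "pdec (\<lambda>x. \<forall>a\<in>elems (l x). P a x)"
  using pdec_not[OF pdec_Bex[OF assms(1) pdec_not[OF assms(2)]]] by simp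

lemma pdec_mem:
  assumes "ptime f" "ptime l"
  shows "pdec (\<lambda>x. f x \<in> elems (l x))"
proof -
  have "pdec (\<lambda>x. \<exists>a\<in>elems (l x). a = f x)"
    by (intro pdec_Bex assms pdec_eq ptime_left ptime_id ptime_weaken)
  then show ?thesis by simp
qed

lemma fold_Cons: "fold (\<lambda>a. Node a) xs (of_list ys) = of_list (rev xs @ ys)"
proof (induct xs arbitrary: ys)
  case (Cons a xs)
  show ?case using Cons[of "a # ys"] by simp
qed simp

lemma ptime_rev_append:
  assumes "ptime l" "ptime k"
  shows "ptime (\<lambda>x. of_list (rev (to_list (l x)) @ to_list (k x)))"
proof -
  have "ptime (\<lambda>x. fold (\<lambda>a. Node a) (to_list (l x)) (k x))"
  proof (rule ptime_fold[OF assms])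
    show "ptime (\<lambda>y. Node (left y) (right (right y)))" by (intro ptime_Node ptime_left ptime_right ptime_id)
    show "polyb (\<lambda>x. tsize (l x) + tsize (k x))" by (intro polyb_intros ptime_size assms)
    have *: "tsize (fold Node (take j (to_list t)) u) \<le> tsize t + tsize u" for j t u
    proof (induct t arbitrary: j u)
      case (Node a t)
      show ?case using Node(2)[of "j - 1" "Node a u"] by (cases j) auto
    qed simp
    show "tsize (fold Node (take j (to_list (l x))) (k x)) \<le> tsize (l x) + tsize (k x)" for x j
      by (rule *)
  qed
  moreover have "fold (\<lambda>a. Node a) (to_list (l x)) (k x) = of_list (rev (to_list (l x)) @ to_list (k x))" for x
    using fold_Cons[of "to_list (l x)" "to_list (k x)"] by simp
  ultimately show ?thesis by simp
qed

lemma ptime_rev: "ptime l \<Longrightarrow> ptime (\<lambda>x. of_list (rev (to_list (l x))))"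
  using ptime_rev_append[OF _ ptime_const[of Leaf]] by simp

lemma ptime_append:
  assumes "ptime l" "ptime k"
  shows "ptime (\<lambda>x. of_list (to_list (l x) @ to_list (k x)))"
  using ptime_rev_append[OF ptime_rev[OF assms(1)] assms(2)] by simp

lemma ptime_concat_map:
  assumes l: "ptime l" and F: "ptime (\<lambda>y. F (left y) (right y))"
  shows "ptime (\<lambda>x. of_list (concat (map (\<lambda>a. to_list (F a x)) (to_list (l x)))))"
proof -
  let ?G = "\<lambda>a x acc. of_list (to_list (F a x) @ to_list acc)"
  have eq: "fold (\<lambda>a. ?G a x) xs (of_list ys) = of_list (concat (map (\<lambda>a. to_list (F a x)) (rev xs)) @ ys)" for xs ys x
    by (induct xs arbitrary: ys) auto
  obtain c where c: "\<And>x. tsize (F (left x) (right x)) \<le> c * tsize x ^ c"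
    using ptime_size[OF F] by (auto simp: polyb_def)
  let ?B = "\<lambda>x. tsize (l x) * (c * (tsize (l x) + tsize x + 1) ^ c) + 1"
  \<comment> \<open>The accumulator grows at its front, so the list is traversed from the back to
    keep the order.\<close>
  let ?r = "\<lambda>x. of_list (rev (to_list (l x)))"
  have "ptime (\<lambda>x. fold (\<lambda>a. ?G a x) (to_list (?r x)) Leaf)"
  proof (rule ptime_fold[OF ptime_rev[OF l] ptime_const])
    have "ptime (\<lambda>y. F (left y) (left (right y)))"
      using ptime_comp[OF F, of "\<lambda>y. Node (left y) (left (right y))"]
      by (simp add: ptime_Node ptime_left ptime_right ptime_id)
    then show "ptime (\<lambda>y. ?G (left y) (left (right y)) (right (right y)))"
      by (intro ptime_append ptime_right ptime_id)
    show "polyb ?B" by (intro polyb_intros ptime_size l)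
    fix x j
    have 1: "tsize (F a x) \<le> c * (tsize (l x) + tsize x + 1) ^ c" if "a \<in> set (to_list (l x))" for a
    proof -
      have "tsize (F a x) \<le> c * tsize (Node a x) ^ c" using c[of "Node a x"] by simp
      also have "\<dots> \<le> c * (tsize (l x) + tsize x + 1) ^ c"
        using tsize_elem[OF that] by (intro mult_left_mono power_mono) auto
      finally show ?thesis .
    qed
    have 2: "tsize (of_list (concat (map (\<lambda>a. to_list (F a x)) xs))) \<le> length xs * (c * (tsize (l x) + tsize x + 1) ^ c) + 1"
      if "set xs \<subseteq> set (to_list (l x))" for xs
      using that
    proof (induct xs)
      case (Cons a xs)
      have "tsize (of_list (to_list t @ ys)) + 1 = tsize t + tsize (of_list ys)" for t ys
        by (induct t) auto
      from this[of "F a x" "concat (map (\<lambda>a. to_list (F a x)) xs)"] Cons 1[of a] show ?case by simp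
    qed simp
    let ?xs = "take j (to_list (?r x))"
    have "tsize (fold (\<lambda>a. ?G a x) ?xs (of_list [])) \<le> length (rev ?xs) * (c * (tsize (l x) + tsize x + 1) ^ c) + 1"
      unfolding eq using set_take_subset[of j "rev (to_list (l x))"] by (simp only: append_Nil2, intro 2) auto
    also have "\<dots> \<le> ?B x"
      using length_to_list[of "l x"] by (intro add_right_mono mult_right_mono) (auto simp: min_def)
    finally show "tsize (fold (\<lambda>a. ?G a x) ?xs Leaf) \<le> ?B x" by simp
  qed
  then show ?thesis using eq[of _ _ "[]"] by simp
qed

lemma ptime_filter:
  assumes l: "ptime l" and P: "pdec (\<lambda>y. P (left y) (right y))"
  shows "ptime (\<lambda>x. of_list (filter (\<lambda>a. P a x) (to_list (l x))))"
proof -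
  have "ptime (\<lambda>y. if P (left y) (right y) then Node (left y) Leaf else Leaf)"
    by (intro ptime_if P ptime_Node ptime_left ptime_id ptime_const)
  from ptime_concat_map[OF l this]
  have "ptime (\<lambda>x. of_list (concat (map (\<lambda>a. to_list (if P a x then Node a Leaf else Leaf)) (to_list (l x)))))" .
  moreover have "concat (map (\<lambda>a. to_list (if P a x then Node a Leaf else Leaf)) xs) = filter (\<lambda>a. P a x) xs" for x xs
    by (induct xs) auto
  ultimately show ?thesis by simp
qed

lemma ptime_map:
  assumes l: "ptime l" and F: "ptime (\<lambda>y. F (left y) (right y))"
  shows "ptime (\<lambda>x. of_list (map (\<lambda>a. F a x) (to_list (l x))))"
proof -
  have "ptime (\<lambda>y. Node (F (left y) (right y)) Leaf)" by (intro ptime_Node F ptime_const)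
  from ptime_concat_map[OF l this]
  show ?thesis by (simp add: concat_map_singleton)
qed

text \<open>Lists also serve as unary numbers: dropping as many elements as another list has is
  truncated subtraction, and testing the result for emptiness compares lengths.\<close>

lemma ptime_drop:
  assumes "ptime l" "ptime k"
  shows "ptime (\<lambda>x. of_list (drop (length (to_list (l x))) (to_list (k x))))"
proof -
  have r: "right t = of_list (tl (to_list t))" for t by (cases t) auto
  have eq: "fold (\<lambda>a. right) xs t = of_list (drop (length xs) (to_list t))" for xs t
    by (induct xs arbitrary: t) (auto simp: r drop_Suc)
  have "ptime (\<lambda>x. fold (\<lambda>a. right) (to_list (l x)) (k x))"
  proof (rule ptime_fold[OF assms])
    show "ptime (\<lambda>y. right (right (right y)))" by (intro ptime_right ptime_id)
    show "polyb (\<lambda>x. tsize (k x))" by (intro ptime_size assms)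
  qed (simp add: eq tsize_drop)
  then show ?thesis by (simp add: eq)
qed

lemma ptime_take:
  assumes "ptime l" "ptime k"
  shows "ptime (\<lambda>x. of_list (take (length (to_list (l x))) (to_list (k x))))"
proof -
  have "ptime (\<lambda>x. of_list (rev (to_list (of_list (drop (length (to_list
      (of_list (drop (length (to_list (l x))) (to_list (k x)))))) (to_list (of_list (rev (to_list (k x))))))))))"
    by (intro ptime_rev ptime_drop assms)
  moreover have "rev (drop (length (drop m ys)) (rev ys)) = take m ys" for m and ys :: "tree list"
    by (cases "m \<le> length ys") (auto simp: rev_drop)
  ultimately show ?thesis by simp
qed

lemmas ptime_intros = ptime_id ptime_const ptime_Node ptime_left ptime_right ptime_if ptime_rev ptime_append
  ptime_filter ptime_map ptime_concat_map ptime_drop ptime_take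
  pdec_const pdec_eq pdec_mem pdec_not pdec_conj pdec_disj pdec_imp pdec_Bex pdec_Ball

section \<open>Monotone \<open>\<Pi>\<^sub>t\<close> circuits\<close>

text \<open>The number of proper predecessors strictly increases along each arc. This bounds all
  path lengths, so that the \<open>Max\<close> defining the depth ranges over a finite set.\<close>

lemma acyclic_path_length:
  assumes "finite r" "acyclic r" "(v, w) \<in> r ^^ l"
  shows "l + card {u. (u, v) \<in> r\<^sup>+} \<le> card {u. (u, w) \<in> r\<^sup>+}"
  using assms(3)
proof (induction l arbitrary: w)
  case (Suc l)
  then obtain x where x: "(v, x) \<in> r ^^ l" "(x, w) \<in> r" by auto
  have fin: "finite {u. (u, w) \<in> r\<^sup>+}"
    using finite_subset[of "{u. (u, w) \<in> r\<^sup>+}" "fst ` (r\<^sup>+)"] assms(1) by force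
  have "{u. (u, x) \<in> r\<^sup>+} \<subset> {u. (u, w) \<in> r\<^sup>+}"
    using x(2) assms(2) by (auto simp: acyclic_def intro: trancl_into_trancl)
  then have "card {u. (u, x) \<in> r\<^sup>+} < card {u. (u, w) \<in> r\<^sup>+}" by (rule psubset_card_mono[OF fin])
  then show ?case using Suc.IH[OF x(1)] by simp
qed simp

locale wsat_circuit =
  fixes t :: nat and C :: circuit
  assumes inst: "wsat_mono_instance t C"
begin

abbreviation "A \<equiv> arc_rel C"
abbreviation "L \<equiv> lit_verts C"

lemma circ: "is_circuit C" and pi: "pi_circuit t C" and mon: "monotone_circuit C"
  using inst by (auto simp: wsat_mono_instance_def pi_circuit_def)

lemma label_unique: "(v, l) \<in> set (nodes C) \<Longrightarrow> (v, l') \<in> set (nodes C) \<Longrightarrow> l = l'"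
  using circ by (auto simp: is_circuit_def dest: eq_key_imp_eq_value)

lemma verts_split: "verts C = gates C \<union> L"
proof -
  have "v \<in> gates C \<union> L" if "(v, l) \<in> set (nodes C)" for v l
    using that by (cases l) (auto simp: gates_def and_gates_def or_gates_def lit_verts_def)
  moreover have "v \<in> verts C" if "(v, l) \<in> set (nodes C)" for v l
    unfolding verts_def using imageI[OF that, of fst] by simp
  moreover have "\<exists>l. (v, l) \<in> set (nodes C)" if "v \<in> verts C" for v using that by (auto simp: verts_def)
  ultimately show ?thesis unfolding gates_def and_gates_def or_gates_def lit_verts_def by blast
qed

lemma gates_lits_disjoint: "gates C \<inter> L = {}" and and_or_disjoint: "and_gates C \<inter> or_gates C = {}"
  using label_unique by (fastforce simp: gates_def and_gates_def or_gates_def lit_verts_def)+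

lemma finite_verts [simp]: "finite (verts C)" "finite L" "finite (gates C)" "finite A"
proof -
  show "finite (verts C)" by (simp add: verts_def)
  then show "finite L" "finite (gates C)" using verts_split by auto
  show "finite A" by (simp add: arc_rel_def)
qed

lemma acyc: "acyclic A"
  using circ by (simp add: is_circuit_def)

lemma wf_arcs: "wf A"
  using acyc finite_verts(4) by (rule finite_acyclic_wf[rotated])

lemma arc_verts: "(u, v) \<in> A \<Longrightarrow> u \<in> verts C" "(u, v) \<in> A \<Longrightarrow> v \<in> verts C"
  using circ by (auto simp: is_circuit_def)

lemma arc_irrefl: "(u, u) \<notin> A"
  using acyc by (auto simp: acyclic_def)

lemma lit_no_incoming: "v \<in> L \<Longrightarrow> (u, v) \<notin> A"
  using circ by (auto simp: is_circuit_def)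

lemma arc_to_gate: "(u, v) \<in> A \<Longrightarrow> v \<in> gates C"
  using arc_verts(2) verts_split lit_no_incoming by blast

lemma gate_has_incoming: "v \<in> gates C \<Longrightarrow> \<exists>u. (u, v) \<in> A"
proof (rule ccontr)
  assume v: "v \<in> gates C" and "\<nexists>u. (u, v) \<in> A"
  then have "v \<in> L" using circ verts_split by (auto simp: is_circuit_def)
  then show False using v gates_lits_disjoint by auto
qed

lemma out_and: "out C \<in> and_gates C"
  using pi by (simp add: pi_circuit_def)

lemma out_gate: "out C \<in> gates C"
  using out_and by (simp add: gates_def)

lemma gate_reaches_out: "v \<in> gates C \<Longrightarrow> (v, out C) \<in> A\<^sup>*"
  using circ by (simp add: is_circuit_def)

lemma out_no_outgoing: "(out C, w) \<notin> A"
proof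
  assume "(out C, w) \<in> A"
  moreover have "(w, out C) \<in> A\<^sup>*" using arc_to_gate[OF calculation] gate_reaches_out by blast
  ultimately have "(out C, out C) \<in> A\<^sup>+" by (rule rtrancl_into_trancl2)
  then show False using acyc by (auto simp: acyclic_def)
qed

lemma gate_parent_unique:
  assumes "v \<in> gates C" "(v, w) \<in> A" "(v, w') \<in> A"
  shows "w = w'"
proof -
  have "card {w. (v, w) \<in> A} \<le> 1" using pi assms(1) by (simp add: pi_circuit_def)
  moreover have "finite {w. (v, w) \<in> A}"
    using finite_subset[of "{w. (v, w) \<in> A}" "snd ` A"] by force
  ultimately show ?thesis using assms(2,3) card_le_Suc0_iff_eq by auto
qed

lemma critical_gate: "p \<in> critical_gates C \<Longrightarrow> p \<in> gates C" "p \<in> critical_gates C \<Longrightarrow> (p, out C) \<in> A"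
  by (auto simp: critical_gates_def gates_def)

lemma finite_critical_gates [simp]: "finite (critical_gates C)"
  by (rule finite_subset[of _ "gates C"]) (use critical_gate in auto)

lemma literal_below:
  assumes "v \<in> verts C"
  shows "\<exists>u\<in>L. \<exists>l. (u, v) \<in> A ^^ l"
  using assms
proof (induction v rule: wf_induct_rule[OF wf_arcs])
  case (1 v)
  show ?case
  proof (cases "v \<in> L")
    case True then show ?thesis by (intro bexI[of _ v] exI[of _ 0]) auto
  next
    case False
    then have "v \<in> gates C" using 1(2) verts_split by auto
    then obtain u where u: "(u, v) \<in> A" using gate_has_incoming by auto
    then obtain w l where "w \<in> L" "(w, u) \<in> A ^^ l" using 1(1) arc_verts by blast
    then show ?thesis using u by (intro bexI[of _ w] exI[of _ "Suc l"]) auto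
  qed
qed

lemma depth_set: "finite {l. \<exists>v\<in>L. (v, out C) \<in> A ^^ l}" "{l. \<exists>v\<in>L. (v, out C) \<in> A ^^ l} \<noteq> {}"
proof -
  have "{l. \<exists>v\<in>L. (v, out C) \<in> A ^^ l} \<subseteq> {..card {u. (u, out C) \<in> A\<^sup>+}}"
    using acyclic_path_length[OF finite_verts(4) acyc] by (fastforce dest: add_leD1)
  then show "finite {l. \<exists>v\<in>L. (v, out C) \<in> A ^^ l}" by (rule finite_subset) simp
  show "{l. \<exists>v\<in>L. (v, out C) \<in> A ^^ l} \<noteq> {}"
    using literal_below[of "out C"] out_gate verts_split by auto
qed

text \<open>Prolonged downwards to a literal, the path becomes one that the depth counts.\<close>

lemma path_to_out_le: assumes "v \<in> verts C" "(v, out C) \<in> A ^^ j" shows "j \<le> t"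
proof -
  obtain u l where "u \<in> L" "(u, v) \<in> A ^^ l" using literal_below assms(1) by blast
  then have "(u, out C) \<in> A ^^ (l + j)" using assms(2) by (auto intro: relpow_trans)
  then have "l + j \<le> depth C" unfolding depth_def using \<open>u \<in> L\<close> by (intro Max_ge depth_set) auto
  also have "depth C \<le> t" using pi by (simp add: pi_circuit_def)
  finally show ?thesis by simp
qed

subsection \<open>Assignments as sets of literal vertices\<close>

text \<open>In a monotone circuit literal vertices and variables correspond bijectively. Working
  with sets of literal vertices puts assignments and graph on the same vertices.\<close>

definition asg :: "nat set \<Rightarrow> nat set" where
  "asg S = {x. \<exists>v\<in>S. (v, Lit True x) \<in> set (nodes C)}"

definition ev :: "nat set \<Rightarrow> nat \<Rightarrow> bool" where
  "ev S v \<longleftrightarrow> evaluates C (asg S) v"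

lemma lit_node: "v \<in> L \<Longrightarrow> \<exists>x. (v, Lit True x) \<in> set (nodes C)"
  using mon by (auto simp: lit_verts_def monotone_circuit_def) metis

lemma lit_unique: "(u, Lit b x) \<in> set (nodes C) \<Longrightarrow> (v, Lit b x) \<in> set (nodes C) \<Longrightarrow> u = v"
  using circ unfolding is_circuit_def by blast

lemma ev_lit: "v \<in> L \<Longrightarrow> ev S v \<longleftrightarrow> v \<in> S"
proof -
  assume v: "v \<in> L"
  then obtain x where x: "(v, Lit True x) \<in> set (nodes C)" using lit_node by auto
  have in_asg: "x \<in> asg S \<longleftrightarrow> v \<in> S" using x lit_unique by (auto simp: asg_def)
  have ng: "v \<notin> and_gates C" "v \<notin> or_gates C" using v gates_lits_disjoint by (auto simp: gates_def)
  show ?thesis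
  proof
    assume "ev S v"
    then show "v \<in> S" unfolding ev_def
    proof cases
      case (1 b y)
      then have "Lit b y = Lit True x" using x label_unique by blast
      then show ?thesis using 1 in_asg by auto
    qed (use ng in auto)
  next
    assume "v \<in> S"
    then show "ev S v" unfolding ev_def using x in_asg by (intro evaluates.intros(1)[of v True x]) auto
  qed
qed

lemma ev_and: "v \<in> and_gates C \<Longrightarrow> ev S v \<longleftrightarrow> (\<forall>u. (u, v) \<in> A \<longrightarrow> ev S u)"
proof -
  assume v: "v \<in> and_gates C"
  then have n: "v \<notin> or_gates C" "\<And>b x. (v, Lit b x) \<notin> set (nodes C)"
    using and_or_disjoint label_unique by (auto simp: and_gates_def)
  show ?thesis unfolding ev_def
  proof
    assume "evaluates C (asg S) v"
    then show "\<forall>u. (u, v) \<in> A \<longrightarrow> evaluates C (asg S) u" by cases (use n in auto)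
  qed (use v in \<open>auto intro: evaluates.intros(2)\<close>)
qed

lemma ev_or: "v \<in> or_gates C \<Longrightarrow> ev S v \<longleftrightarrow> (\<exists>u. (u, v) \<in> A \<and> ev S u)"
proof -
  assume v: "v \<in> or_gates C"
  then have n: "v \<notin> and_gates C" "\<And>b x. (v, Lit b x) \<notin> set (nodes C)"
    using and_or_disjoint label_unique by (auto simp: or_gates_def)
  show ?thesis unfolding ev_def
  proof
    assume "evaluates C (asg S) v"
    then show "\<exists>u. (u, v) \<in> A \<and> evaluates C (asg S) u" by cases (use n in auto)
  qed (use v in \<open>auto intro: evaluates.intros(3)\<close>)
qed

lemma vertex_cases:
  assumes "v \<in> verts C"
  obtains "v \<in> L" | "v \<in> and_gates C" | "v \<in> or_gates C"
  using assms verts_split by (auto simp: gates_def)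

lemma ev_mono:
  assumes "S \<subseteq> S'" "v \<in> verts C" "ev S v"
  shows "ev S' v"
  using assms(2,3)
proof (induction v rule: wf_induct_rule[OF wf_arcs])
  case (1 v)
  from 1(2) show ?case
  proof (cases rule: vertex_cases)
    case 1 then show ?thesis using \<open>ev S v\<close> ev_lit assms(1) by auto
  next
    case 2 then show ?thesis using 1 ev_and arc_verts by metis
  next
    case 3 then show ?thesis using 1 ev_or arc_verts by metis
  qed
qed

text \<open>Every gate has an incoming arc, so there are no vacuously true AND-gates and a true
  vertex always has a true literal below it.\<close>

lemma ev_nonempty:
  assumes "v \<in> verts C" "ev S v"
  shows "S \<noteq> {}"
  using assms
proof (induction v rule: wf_induct_rule[OF wf_arcs])
  case (1 v)
  from 1(2) show ?case
  proof (cases rule: vertex_cases)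
    case 1 then show ?thesis using \<open>ev S v\<close> ev_lit by auto
  next
    case 2
    then obtain u where "(u, v) \<in> A" using gate_has_incoming by (auto simp: gates_def)
    then show ?thesis using 1 2 ev_and arc_verts by metis
  next
    case 3 then show ?thesis using 1 ev_or arc_verts by metis
  qed
qed

lemma bij_asg: "bij_betw (\<lambda>v. THE x. (v, Lit True x) \<in> set (nodes C)) L (variables C)"
  and asg_eq: "S \<subseteq> L \<Longrightarrow> asg S = (\<lambda>v. THE x. (v, Lit True x) \<in> set (nodes C)) ` S"
proof -
  let ?f = "\<lambda>v. THE x. (v, Lit True x) \<in> set (nodes C)"
  have f: "(v, Lit True (?f v)) \<in> set (nodes C)" if "v \<in> L" for v
    using lit_node[OF that] by (rule exE) (rule theI2, auto dest: label_unique)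
  have f2: "?f v = x" if "(v, Lit True x) \<in> set (nodes C)" for v x
    using that by (rule the_equality) (use that label_unique in blast)
  have "inj_on ?f L" using f lit_unique by (metis (no_types, lifting) inj_onI)
  moreover have "?f ` L = variables C"
  proof
    show "?f ` L \<subseteq> variables C" using f by (auto simp: variables_def)
    show "variables C \<subseteq> ?f ` L"
    proof
      fix x assume "x \<in> variables C"
      then obtain v b where "(v, Lit b x) \<in> set (nodes C)" by (auto simp: variables_def)
      moreover have b using calculation mon by (auto simp: monotone_circuit_def)
      ultimately have v: "(v, Lit True x) \<in> set (nodes C)" by simp
      then have "v \<in> L" by (auto simp: lit_verts_def)
      then show "x \<in> ?f ` L" using f2[OF v] by auto
    qed
  qed
  ultimately show "bij_betw ?f L (variables C)" by (simp add: bij_betw_def)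
  show "asg S = ?f ` S" if "S \<subseteq> L"
  proof
    show "asg S \<subseteq> ?f ` S" unfolding asg_def using f2[symmetric] by blast
    show "?f ` S \<subseteq> asg S" unfolding asg_def using f that by blast
  qed
qed

lemma card_variables: "card (variables C) = card L"
  using bij_betw_same_card[OF bij_asg] by simp

lemma yes_instance_iff: "yes_instance C k \<longleftrightarrow> (\<exists>S\<subseteq>L. card S = k \<and> ev S (out C))"
proof -
  let ?f = "\<lambda>v. THE x. (v, Lit True x) \<in> set (nodes C)"
  have inj: "inj_on ?f L" and im: "?f ` L = variables C" using bij_asg by (auto simp: bij_betw_def)
  show ?thesis
  proof
    assume "yes_instance C k"
    then obtain B where B: "B \<subseteq> variables C" "card B = k" "evaluates C B (out C)" by (auto simp: yes_instance_def)
    have "B \<subseteq> ?f ` L" using B(1) im by blast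
    then obtain S where S: "S \<subseteq> L" "B = ?f ` S" by (rule subset_imageE)
    then have "card S = k" using B(2) card_image[OF inj_on_subset[OF inj S(1)]] by simp
    then show "\<exists>S\<subseteq>L. card S = k \<and> ev S (out C)" using S B asg_eq[OF S(1)] by (auto simp: ev_def)
  next
    assume "\<exists>S\<subseteq>L. card S = k \<and> ev S (out C)"
    then obtain S where S: "S \<subseteq> L" "card S = k" "ev S (out C)" by auto
    then have "asg S \<subseteq> variables C" "card (asg S) = k"
      using asg_eq[OF S(1)] im inj by (auto simp: card_image inj_on_subset)
    then show "yes_instance C k" using S(3) by (auto simp: yes_instance_def ev_def)
  qed
qed

lemma card_variables_pos: "card (variables C) > 0"
  unfolding card_variables using literal_below[of "out C"] out_gate verts_split by (auto simp: card_gt_0_iff)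

subsection \<open>Subtrees of critical gates\<close>

abbreviation "GA \<equiv> A \<inter> gates C \<times> gates C"

lemma subtree_gate: "q \<in> subtree C p \<Longrightarrow> q \<in> gates C"
  by (auto simp: subtree_def)

lemma subtree_self: "p \<in> gates C \<Longrightarrow> p \<in> subtree C p"
  by (auto simp: subtree_def)

lemma subtree_child: "(u, v) \<in> A \<Longrightarrow> v \<in> subtree C p \<Longrightarrow> u \<in> gates C \<Longrightarrow> u \<in> subtree C p"
  by (auto simp: subtree_def intro: converse_rtrancl_into_rtrancl)

lemma out_stuck: "(out C, w) \<in> GA\<^sup>* \<Longrightarrow> w = out C"
  using out_no_outgoing by (auto elim: converse_rtranclE)

lemma out_not_in_subtree: "p \<in> critical_gates C \<Longrightarrow> out C \<notin> subtree C p"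
proof
  assume p: "p \<in> critical_gates C" and "out C \<in> subtree C p"
  then have "p = out C" using out_stuck by (auto simp: subtree_def)
  then show False using critical_gate(2)[OF p] arc_irrefl by auto
qed

lemma critical_above_stuck:
  assumes "p \<in> critical_gates C" "q \<in> critical_gates C" "(p, q) \<in> GA\<^sup>*"
  shows "p = q"
  using assms(3)
proof (cases rule: converse_rtranclE)
  case (step y)
  then have "y = out C" using gate_parent_unique critical_gate assms(1) by blast
  then have "out C \<in> subtree C q" using step out_gate by (auto simp: subtree_def)
  then show ?thesis using out_not_in_subtree assms(2) by auto
qed simp

text \<open>Parents are unique, so two upward paths from \<open>v\<close> are comparable. Above a
  critical gate there is only the output gate, so neither of \<open>p\<close> and \<open>q\<close>
  can lie properly above the other.\<close>

lemma subtree_unique: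
  assumes "p \<in> critical_gates C" "q \<in> critical_gates C" "v \<in> subtree C p" "v \<in> subtree C q"
  shows "p = q"
proof -
  have "single_valued GA" using gate_parent_unique by (auto simp: single_valued_def)
  then have "(p, q) \<in> GA\<^sup>* \<or> (q, p) \<in> GA\<^sup>*"
    using assms(3,4) by (intro single_valued_confluent) (auto simp: subtree_def)
  then show ?thesis using critical_above_stuck assms by blast
qed

definition touches :: "nat \<Rightarrow> nat \<Rightarrow> bool" where
  "touches x p \<longleftrightarrow> (\<exists>q\<in>subtree C p. (x, q) \<in> A)"

lemma critical_gates_of_var_eq:
  assumes "(v, Lit b x) \<in> set (nodes C)"
  shows "critical_gates_of_var C x = {p \<in> critical_gates C. touches v p}"
proof -
  have "b' \<and> v' = v" if "(v', Lit b' x) \<in> set (nodes C)" for v' b'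
  proof -
    have "b'" "b" using that assms mon by (auto simp: monotone_circuit_def)
    then show ?thesis using that assms lit_unique by simp
  qed
  then show ?thesis using assms unfolding critical_gates_of_var_def touches_def by blast
qed

definition graph_verts :: "nat set" where "graph_verts = verts C - {out C}"
definition graph_darts :: "(nat \<times> nat) set" where
  "graph_darts = (A \<union> A\<inverse>) \<inter> graph_verts \<times> graph_verts"

lemma circuit_genus_eq: "circuit_genus C = graph_genus graph_verts graph_darts"
  by (simp add: circuit_genus_def graph_verts_def graph_darts_def Let_def)

lemma graph_props: "finite graph_verts" "graph_darts \<subseteq> graph_verts \<times> graph_verts" "sym graph_darts"
  "(u, u) \<notin> graph_darts"
  using arc_irrefl by (auto simp: graph_verts_def graph_darts_def sym_def)

text \<open>With the output gate removed, the subtrees of the gates in \<open>Q\<close> are disjoint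
  trees rooted in \<open>Q\<close>. Each literal in \<open>X\<close> keeps one arc into each of
  three of them, which is the configuration of \<open>tripods\<close>. These arcs avoid the output
  gate and so belong to the graph whose genus is measured.\<close>

lemma card_triple_touching:
  assumes Q: "Q \<subseteq> critical_gates C"
  defines "X \<equiv> {x\<in>L. 3 \<le> card {p\<in>Q. touches x p}}"
  shows "card X \<le> 4 * card Q + 4 * circuit_genus C"
proof -
  let ?G = "\<Union>p\<in>Q. subtree C p"
  let ?parent = "\<lambda>v. THE w. (v, w) \<in> A" and ?root = "\<lambda>v. THE p. p \<in> Q \<and> v \<in> subtree C p"
  have root: "?root v = p" if "p \<in> Q" "v \<in> subtree C p" for p v
    using that Q subtree_unique by (intro the_equality) blast+
  have parent: "?parent v = w" if "v \<in> gates C" "(v, w) \<in> A" for v w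
    using that gate_parent_unique by (intro the_equality) auto
  have finQ: "finite Q" using Q finite_critical_gates finite_subset by blast
  have up: "\<exists>w. (v, w) \<in> A \<and> w \<in> subtree C p \<and> ?parent v = w" if "p \<in> Q" "v \<in> subtree C p" "v \<notin> Q" for p v
  proof -
    have vg: "v \<in> gates C" using that subtree_gate by auto
    have "(v, p) \<in> GA\<^sup>*" using that by (auto simp: subtree_def)
    then show ?thesis
    proof (cases rule: converse_rtranclE)
      case base then show ?thesis using that by auto
    next
      case (step y) then show ?thesis using parent[OF vg] by (auto simp: subtree_def)
    qed
  qed
  have ex: "\<exists>N. N \<subseteq> ?G \<and> card N = 3 \<and> inj_on ?root N \<and> (\<forall>q\<in>N. (x, q) \<in> A)" if x: "x \<in> X" for x
  proof -
    obtain P where P: "P \<subseteq> {p\<in>Q. touches x p}" "card P = 3"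
      using obtain_subset_with_card_n[of 3 "{p\<in>Q. touches x p}"] x unfolding X_def by blast
    then have "\<forall>p\<in>P. \<exists>q. q \<in> subtree C p \<and> (x, q) \<in> A" by (auto simp: touches_def)
    then obtain f where f: "\<And>p. p \<in> P \<Longrightarrow> f p \<in> subtree C p" "\<And>p. p \<in> P \<Longrightarrow> (x, f p) \<in> A" by metis
    have rf: "?root (f p) = p" if "p \<in> P" for p using root[of p "f p"] f(1)[OF that] P(1) that by blast
    have "inj_on f P"
    proof (rule inj_onI)
      fix p q assume pq: "p \<in> P" "q \<in> P" "f p = f q"
      have "p = ?root (f p)" using rf[OF pq(1)] by (rule sym)
      also have "\<dots> = ?root (f q)" by (simp only: pq(3))
      also have "\<dots> = q" by (rule rf[OF pq(2)])
      finally show "p = q" .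
    qed
    then have "card (f ` P) = 3" using P by (simp add: card_image)
    moreover have "inj_on ?root (f ` P)"
    proof (rule inj_onI)
      fix a b assume "a \<in> f ` P" "b \<in> f ` P" and eq: "?root a = ?root b"
      then obtain p q where pq: "p \<in> P" "q \<in> P" "a = f p" "b = f q" by blast
      have "p = ?root (f p)" using rf[OF pq(1)] by (rule sym)
      also have "\<dots> = ?root (f q)" using eq pq(3,4) by (simp only:)
      also have "\<dots> = q" by (rule rf[OF pq(2)])
      finally show "a = b" using pq by simp
    qed
    moreover have "f ` P \<subseteq> ?G" using f(1) P by blast
    ultimately show ?thesis using f(2) by blast
  qed
  define N where "N x = (SOME N. N \<subseteq> ?G \<and> card N = 3 \<and> inj_on ?root N \<and> (\<forall>q\<in>N. (x, q) \<in> A))" for x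
  have N': "N x \<subseteq> ?G" "card (N x) = 3" "inj_on ?root (N x)" "\<forall>q\<in>N x. (x, q) \<in> A" if "x \<in> X" for x
    using someI_ex[OF ex[OF that]] unfolding N_def by blast+
  have QG: "Q \<subseteq> ?G" using Q critical_gate(1) subtree_self by blast
  have GX: "?G \<inter> X = {}" using subtree_gate gates_lits_disjoint unfolding X_def by blast
  interpret tripods ?G Q X ?parent ?root N
  proof
    show "finite ?G" using finQ by (auto intro: finite_subset[OF _ finite_verts(3)] simp: subtree_def)
    show "finite X" by (simp add: X_def)
    show "Q \<subseteq> ?G" "?G \<inter> X = {}" by fact+
    show "?root v \<in> Q" if "v \<in> ?G" for v using that root by auto
    show "?parent v \<in> ?G" if "v \<in> ?G - Q" for v using that up by auto
    show "?root (?parent v) = ?root v" if v: "v \<in> ?G - Q" for v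
    proof -
      obtain p where p: "p \<in> Q" "v \<in> subtree C p" using v by auto
      then show ?thesis using up[OF p] v root by auto
    qed
    show "?parent v \<noteq> v" if "v \<in> ?G - Q" for v using that up arc_irrefl by (metis DiffE UN_E)
    show "?parent (?parent v) \<noteq> v" if v: "v \<in> ?G - Q" and w: "?parent v \<in> ?G - Q" for v
    proof -
      have "(v, ?parent v) \<in> A" "(?parent v, ?parent (?parent v)) \<in> A" using up v w by (metis DiffE UN_E)+
      then have "(v, ?parent (?parent v)) \<in> A\<^sup>+" by (rule trancl_into_trancl[OF r_into_trancl])
      then show ?thesis using acyc by (auto simp: acyclic_def)
    qed
    show "(v, ?root v) \<in> {(v, ?parent v) |v. v \<in> ?G - Q}\<^sup>*" if v: "v \<in> ?G" for v
    proof -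
      obtain p where p: "p \<in> Q" "v \<in> subtree C p" using v by auto
      have "(v, p) \<in> GA\<^sup>*" using p by (auto simp: subtree_def)
      then have "(v, p) \<in> {(v, ?parent v) |v. v \<in> ?G - Q}\<^sup>*"
      proof (induction rule: converse_rtrancl_induct)
        case (step y z)
        have y: "y \<in> subtree C p" using step by (auto simp: subtree_def intro: converse_rtrancl_into_rtrancl)
        have "?parent y = z" using step parent by auto
        show ?case
        proof (cases "y \<in> Q")
          case True
          then have "y = p" using critical_above_stuck[of y p] y p Q by (auto simp: subtree_def)
          then show ?thesis by simp
        next
          case False
          then have "(y, z) \<in> {(v, ?parent v) |v. v \<in> ?G - Q}" using \<open>?parent y = z\<close> y p by blast
          then show ?thesis using step.IH by (rule converse_rtrancl_into_rtrancl)
        qed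
      qed simp
      then show ?thesis using root[OF p] by simp
    qed
    show "N x \<subseteq> ?G" "card (N x) = 3" "inj_on ?root (N x)" if "x \<in> X" for x using N' that by auto
  qed
  have Gv: "?G \<subseteq> graph_verts" using subtree_gate out_not_in_subtree Q verts_split unfolding graph_verts_def by blast
  have Xv: "X \<subseteq> graph_verts" using out_gate gates_lits_disjoint verts_split unfolding graph_verts_def X_def by blast
  have "tree_arcs \<subseteq> A \<inter> graph_verts \<times> graph_verts"
  proof
    fix e assume "e \<in> tree_arcs"
    then obtain v where v: "v \<in> ?G - Q" "e = (v, ?parent v)" by (auto simp: tree_arcs_def)
    then obtain p where p: "p \<in> Q" "v \<in> subtree C p" by auto
    show "e \<in> A \<inter> graph_verts \<times> graph_verts" using up[OF p] v p Gv by blast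
  qed
  moreover have "leg_darts \<subseteq> A \<inter> graph_verts \<times> graph_verts"
    using N'(1,4) Gv Xv unfolding leg_darts_def by blast
  ultimately have "darts \<subseteq> graph_darts" unfolding darts_def tree_darts_def graph_darts_def by blast
  then show ?thesis unfolding circuit_genus_eq
    using Gv Xv by (intro card_le_graph_genus graph_props) auto
qed

text \<open>Evaluation below \<open>p\<close> reads only literals that are incoming to its subtree,
  and by monotonicity only those set to 1 by \<open>S'\<close> have to be present in
  \<open>S\<close>.\<close>

lemma ev_subtree_cong:
  assumes p: "p \<in> gates C" and S: "\<And>u. u \<in> L \<Longrightarrow> touches u p \<Longrightarrow> u \<in> S' \<Longrightarrow> u \<in> S" and "ev S' p"
  shows "ev S p"
proof -
  have "ev S v" if "v \<in> subtree C p" "ev S' v" for v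
    using that
  proof (induction v rule: wf_induct_rule[OF wf_arcs])
    case (1 v)
    have child: "ev S u" if u: "(u, v) \<in> A" "ev S' u" for u
    proof (cases "u \<in> L")
      case True
      then show ?thesis using u ev_lit S 1(2) by (auto simp: touches_def)
    next
      case False
      then have "u \<in> gates C" using u arc_verts verts_split by blast
      then show ?thesis using 1 u subtree_child by blast
    qed
    have "v \<in> gates C" using 1 subtree_gate by auto
    then consider "v \<in> and_gates C" | "v \<in> or_gates C" by (auto simp: gates_def)
    then show ?case
    proof cases
      case 1 then show ?thesis using ev_and child \<open>ev S' v\<close> by metis
    next
      case 2 then show ?thesis using ev_or child \<open>ev S' v\<close> by metis
    qed
  qed
  then show ?thesis using assms(3) subtree_self[OF p] by blast
qed

end

section \<open>Fixing the values of some literals\<close>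

context wsat_circuit
begin

text \<open>The literals in \<open>S\<close> are fixed to 1 and those in \<open>X\<close> to 0. By
  monotonicity \<open>S\<close> and \<open>L - X\<close> are the extreme assignments that remain, so
  a vertex still depends on the free literals exactly when it is 0 under the first and 1 under the
  second.\<close>

definition undetermined :: "nat set \<Rightarrow> nat set \<Rightarrow> nat \<Rightarrow> bool" where
  "undetermined S X v \<longleftrightarrow> \<not> ev S v \<and> ev (L - X) v"

text \<open>Gates below a determined gate go as well, even if they are undetermined themselves:
  otherwise they would lose their path to the output gate, which a circuit must not allow.\<close>

definition kept_gates :: "nat set \<Rightarrow> nat set \<Rightarrow> nat set" where
  "kept_gates S X = {v \<in> gates C. \<forall>w. (v, w) \<in> A\<^sup>* \<longrightarrow> undetermined S X w}"

definition kept :: "nat set \<Rightarrow> nat set \<Rightarrow> nat set" where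
  "kept S X = kept_gates S X \<union> (L - S - X)"

definition restrict_circuit :: "nat set \<Rightarrow> nat set \<Rightarrow> circuit" where
  "restrict_circuit S X = \<lparr>nodes = filter (\<lambda>(v, l). v \<in> kept S X) (nodes C),
     arcs = filter (\<lambda>(u, v). u \<in> kept S X \<and> v \<in> kept S X) (arcs C), out = out C\<rparr>"

end

locale restriction = wsat_circuit +
  fixes S X :: "nat set"
  assumes SL: "S \<subseteq> L" and SX: "S \<inter> X = {}"
    and undet_out: "undetermined S X (out C)"
begin

abbreviation "C' \<equiv> restrict_circuit S X"
abbreviation "W \<equiv> kept S X"
abbreviation "K \<equiv> kept_gates S X"

lemma undetermined_lit: "v \<in> L \<Longrightarrow> undetermined S X v \<longleftrightarrow> v \<in> L - S - X"
  by (auto simp: undetermined_def ev_lit)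

lemma kept_undetermined: "v \<in> W \<Longrightarrow> undetermined S X v"
  using undetermined_lit by (auto simp: kept_def kept_gates_def)

lemma kept_gates_parent: "v \<in> K \<Longrightarrow> (v, w) \<in> A \<Longrightarrow> w \<in> K"
  using arc_to_gate by (auto simp: kept_gates_def intro: converse_rtrancl_into_rtrancl)

text \<open>The only parent of a gate \<open>u\<close> below \<open>v\<close> is \<open>v\<close>,
  so whatever lies above \<open>u\<close> is \<open>u\<close> itself or is reached through
  \<open>v\<close>, where everything is already undetermined.\<close>

lemma kept_child_iff: assumes v: "v \<in> K" and uv: "(u, v) \<in> A" shows "u \<in> W \<longleftrightarrow> undetermined S X u"
proof (cases "u \<in> L")
  case True
  then have "u \<notin> K" using gates_lits_disjoint by (auto simp: kept_gates_def)
  then show ?thesis using True undetermined_lit by (auto simp: kept_def)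
next
  case False
  then have u: "u \<in> gates C" using arc_verts(1)[OF uv] verts_split by auto
  have "u \<in> K" if und: "undetermined S X u"
  proof -
    have "undetermined S X w" if "(u, w) \<in> A\<^sup>*" for w
      using that
    proof (cases rule: converse_rtranclE)
      case base then show ?thesis using und by simp
    next
      case (step y)
      then have "y = v" using gate_parent_unique[OF u] uv by simp
      then show ?thesis using step v by (auto simp: kept_gates_def)
    qed
    then show ?thesis using u by (auto simp: kept_gates_def)
  qed
  then show ?thesis using kept_undetermined by (auto simp: kept_def)
qed

lemma out_kept: "out C \<in> K"
proof -
  have "w = out C" if "(out C, w) \<in> A\<^sup>*" for w
    using that out_no_outgoing by (auto elim: converse_rtranclE)
  then show ?thesis using undet_out out_gate by (auto simp: kept_gates_def)
qed

lemma kept_verts: "W \<subseteq> verts C"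
  using verts_split by (auto simp: kept_def kept_gates_def)

lemma nodes': "set (nodes C') = {(v, l) \<in> set (nodes C). v \<in> W}"
  by (auto simp: restrict_circuit_def)

lemma out' [simp]: "out C' = out C"
  by (simp add: restrict_circuit_def)

lemma arcs': "arc_rel C' = A \<inter> W \<times> W"
  by (auto simp: restrict_circuit_def arc_rel_def)

lemma verts': "verts C' = W"
proof
  show "verts C' \<subseteq> W" by (auto simp: verts_def nodes')
  show "W \<subseteq> verts C'"
  proof
    fix v assume v: "v \<in> W"
    then obtain l where "(v, l) \<in> set (nodes C)" using kept_verts by (auto simp: verts_def)
    then have "(v, l) \<in> set (nodes C')" using v by (simp add: nodes')
    then show "v \<in> verts C'" by (force simp: verts_def)
  qed
qed

lemma and_gates': "and_gates C' = and_gates C \<inter> K" and or_gates': "or_gates C' = or_gates C \<inter> K"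
  and gates': "gates C' = K" and lit_verts': "lit_verts C' = L - S - X"
proof -
  have g: "v \<in> K" if "v \<in> W" "v \<in> gates C" for v using that gates_lits_disjoint by (auto simp: kept_def)
  show 1: "and_gates C' = and_gates C \<inter> K" "or_gates C' = or_gates C \<inter> K"
    using g by (auto simp: and_gates_def or_gates_def nodes' gates_def kept_def)
  show "gates C' = K" unfolding gates_def 1 by (auto simp: kept_gates_def gates_def)
  have "lit_verts C' = L \<inter> W" by (auto simp: lit_verts_def nodes')
  then show "lit_verts C' = L - S - X" using gates_lits_disjoint by (auto simp: kept_def kept_gates_def)
qed

text \<open>An AND-gate that is 0 under \<open>S\<close> has a child that is 0 under
  \<open>S\<close>, and this child is 1 under \<open>L - X\<close> together with the gate. For
  OR-gates the argument is dual. Thus no gate turns into a source, and the sources of the new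
  circuit are again its literals.\<close>

lemma kept_gate_child: assumes v: "v \<in> K" shows "\<exists>u\<in>W. (u, v) \<in> A"
proof -
  have "v \<in> gates C" "undetermined S X v" using v by (auto simp: kept_gates_def)
  then consider "v \<in> and_gates C" | "v \<in> or_gates C" by (auto simp: gates_def)
  then have "\<exists>u. (u, v) \<in> A \<and> undetermined S X u"
  proof cases
    case 1
    then show ?thesis using \<open>undetermined S X v\<close> ev_and[OF 1] by (auto simp: undetermined_def)
  next
    case 2
    then show ?thesis using \<open>undetermined S X v\<close> ev_or[OF 2] by (auto simp: undetermined_def)
  qed
  then show ?thesis using kept_child_iff[OF v] by blast
qed

lemma kept_gate_reaches_out: assumes "v \<in> K" shows "(v, out C) \<in> (arc_rel C')\<^sup>*"
proof -
  have "(v, out C) \<in> A\<^sup>*" using assms gate_reaches_out by (auto simp: kept_gates_def)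
  then show ?thesis using assms
  proof (induction rule: converse_rtrancl_induct)
    case (step y z)
    then have "z \<in> K" using kept_gates_parent by blast
    moreover have "(y, z) \<in> arc_rel C'" using step \<open>z \<in> K\<close> by (auto simp: arcs' kept_def)
    ultimately show ?case using step.IH by (blast intro: converse_rtrancl_into_rtrancl)
  qed simp
qed

lemma is_circuit': "is_circuit C'"
proof -
  have "distinct (map fst (nodes C'))"
    using circ by (auto simp: is_circuit_def restrict_circuit_def distinct_map inj_on_def)
  moreover have "distinct (arcs C')" using circ by (auto simp: is_circuit_def restrict_circuit_def)
  moreover have "arc_rel C' \<subseteq> verts C' \<times> verts C'" by (auto simp: arcs' verts')
  moreover have "acyclic (arc_rel C')" using acyc by (rule acyclic_subset) (auto simp: arcs')
  moreover have "lit_verts C' = {v \<in> verts C'. \<nexists>u. (u, v) \<in> arc_rel C'}"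
  proof -
    have "\<exists>u. (u, v) \<in> arc_rel C'" if "v \<in> K" for v
      using kept_gate_child[OF that] that by (auto simp: arcs' kept_def)
    moreover have "(u, v) \<notin> arc_rel C'" if "v \<in> L" for u v using lit_no_incoming[OF that] by (auto simp: arcs')
    ultimately show ?thesis unfolding lit_verts' verts' by (auto simp: kept_def)
  qed
  moreover have "u = v" if "(u, Lit b x) \<in> set (nodes C')" "(v, Lit b x) \<in> set (nodes C')" for u v b x
    using that lit_unique by (auto simp: nodes')
  ultimately show ?thesis
    unfolding is_circuit_def out' gates' using kept_gate_reaches_out out_kept by blast
qed

lemma instance': "wsat_mono_instance t C'"
proof -
  have sub: "arc_rel C' \<subseteq> A" by (auto simp: arcs')
  have "depth C' \<le> depth C"
    unfolding depth_def
  proof (rule Max_mono)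
    have "arc_rel C' ^^ l \<subseteq> A ^^ l" for l using sub by (induct l) auto
    then show "{l. \<exists>v\<in>lit_verts C'. (v, out C') \<in> arc_rel C' ^^ l} \<subseteq> {l. \<exists>v\<in>L. (v, out C) \<in> A ^^ l}"
      by (auto simp: lit_verts')
    \<comment> \<open>The comparison of the two maxima needs a path from a literal to the output
      gate in the smaller circuit, so the descent to a literal is repeated inside it.\<close>
    have "\<exists>u\<in>L - S - X. \<exists>l. (u, v) \<in> arc_rel C' ^^ l" if "v \<in> W" for v
      using that
    proof (induction v rule: wf_induct_rule[OF wf_arcs])
      case (1 v)
      show ?case
      proof (cases "v \<in> K")
        case True
        then obtain u where u: "u \<in> W" "(u, v) \<in> A" using kept_gate_child by auto
        then obtain w l where w: "w \<in> L - S - X" "(w, u) \<in> arc_rel C' ^^ l" using 1(1) by blast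
        have "(u, v) \<in> arc_rel C'" using u 1(2) by (auto simp: arcs')
        then have "(w, v) \<in> arc_rel C' ^^ Suc l" using w by auto
        then show ?thesis using w(1) by blast
      next
        case False
        then have "v \<in> L - S - X" using 1(2) by (auto simp: kept_def)
        then show ?thesis by (intro bexI[of _ v] exI[of _ 0]) auto
      qed
    qed
    then show "{l. \<exists>v\<in>lit_verts C'. (v, out C') \<in> arc_rel C' ^^ l} \<noteq> {}"
      using out_kept by (fastforce simp: lit_verts' kept_def)
  qed (rule depth_set)
  then have "depth C' \<le> t" using pi by (simp add: pi_circuit_def)
  moreover have "card {w. (v, w) \<in> arc_rel C'} \<le> 1" if "v \<in> K" for v
  proof -
    have "{w. (v, w) \<in> arc_rel C'} \<subseteq> {w. (v, w) \<in> A}" using sub by auto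
    moreover have "finite {w. (v, w) \<in> A}"
      using finite_subset[of "{w. (v, w) \<in> A}" "snd ` A"] by force
    ultimately have "card {w. (v, w) \<in> arc_rel C'} \<le> card {w. (v, w) \<in> A}" by (intro card_mono)
    also have "\<dots> \<le> 1" using pi that by (auto simp: pi_circuit_def kept_gates_def)
    finally show ?thesis .
  qed
  moreover have "v \<in> and_gates C' \<longleftrightarrow> w \<in> or_gates C'" if "v \<in> K" "w \<in> K" "(v, w) \<in> arc_rel C'" for v w
    using pi that sub by (auto simp: pi_circuit_def and_gates' or_gates' kept_gates_def)
  moreover have "monotone_circuit C'" using mon by (auto simp: monotone_circuit_def nodes')
  ultimately show ?thesis
    unfolding wsat_mono_instance_def pi_circuit_def gates'
    using is_circuit' out_and out_kept by (auto simp: and_gates')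
qed

sublocale C': wsat_circuit t C'
  by unfold_locales (rule instance')

text \<open>The children that are cut off do not matter. Below a kept AND-gate they are constantly
  1, since a child that is constantly 0 would make the gate constantly 0; below a kept OR-gate they
  are constantly 0.\<close>

lemma ev':
  assumes "S \<subseteq> B" "B \<subseteq> L - X" "v \<in> W"
  shows "C'.ev (B - S) v \<longleftrightarrow> ev B v"
  using assms(3)
proof (induction v rule: wf_induct_rule[OF wf_arcs])
  case (1 v)
  show ?case
  proof (cases "v \<in> K")
    case False
    then have v: "v \<in> L - S - X" using 1(2) by (auto simp: kept_def)
    then show ?thesis using C'.ev_lit[of v "B - S"] ev_lit[of v B] lit_verts' by auto
  next
    case True
    have child: "(u, v) \<in> arc_rel C' \<longleftrightarrow> (u, v) \<in> A \<and> undetermined S X u" for u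
      using kept_child_iff[OF True] 1(2) by (auto simp: arcs')
    have IH: "C'.ev (B - S) u \<longleftrightarrow> ev B u" if "(u, v) \<in> A" "undetermined S X u" for u
      using 1(1)[OF that(1)] kept_child_iff[OF True that(1)] that(2) by blast
    have und: "undetermined S X v" using True by (auto simp: kept_gates_def)
    have up: "ev B u" if "ev S u" "(u, v) \<in> A" for u using ev_mono[OF assms(1)] that arc_verts by blast
    have down: "ev (L - X) u" if "ev B u" "(u, v) \<in> A" for u using ev_mono[OF assms(2)] that arc_verts by blast
    have "v \<in> gates C" using True by (auto simp: kept_gates_def)
    then consider "v \<in> and_gates C" | "v \<in> or_gates C" by (auto simp: gates_def)
    then show ?thesis
    proof cases
      case 1
      have "C'.ev (B - S) v \<longleftrightarrow> (\<forall>u. (u, v) \<in> arc_rel C' \<longrightarrow> C'.ev (B - S) u)"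
        using 1 True by (intro C'.ev_and) (auto simp: and_gates')
      also have "\<dots> \<longleftrightarrow> (\<forall>u. (u, v) \<in> A \<and> undetermined S X u \<longrightarrow> ev B u)" unfolding child using IH by blast
      also have "\<dots> \<longleftrightarrow> (\<forall>u. (u, v) \<in> A \<longrightarrow> ev B u)"
        using und up ev_and[OF 1] unfolding undetermined_def by blast
      also have "\<dots> \<longleftrightarrow> ev B v" using ev_and[OF 1] by simp
      finally show ?thesis .
    next
      case 2
      have "C'.ev (B - S) v \<longleftrightarrow> (\<exists>u. (u, v) \<in> arc_rel C' \<and> C'.ev (B - S) u)"
        using 2 True by (intro C'.ev_or) (auto simp: or_gates')
      also have "\<dots> \<longleftrightarrow> (\<exists>u. (u, v) \<in> A \<and> undetermined S X u \<and> ev B u)" unfolding child using IH by blast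
      also have "\<dots> \<longleftrightarrow> (\<exists>u. (u, v) \<in> A \<and> ev B u)"
        using und down ev_or[OF 2] unfolding undetermined_def by blast
      also have "\<dots> \<longleftrightarrow> ev B v" using ev_or[OF 2] by simp
      finally show ?thesis .
    qed
  qed
qed

lemma yes_instance':
  "yes_instance C' j \<longleftrightarrow> (\<exists>B. S \<subseteq> B \<and> B \<subseteq> L - X \<and> card B = card S + j \<and> ev B (out C))"
proof -
  have outW: "out C \<in> W" using out_kept by (auto simp: kept_def)
  have finS: "finite S" using SL finite_verts(2) finite_subset by blast
  show ?thesis
  proof
    assume "yes_instance C' j"
    then obtain B where B: "B \<subseteq> L - S - X" "card B = j" "C'.ev B (out C)"
      using C'.yes_instance_iff lit_verts' by auto
    have "finite B" using B(1) finite_verts(2) finite_subset by blast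
    then have "card (S \<union> B) = card S + j" using B finS by (subst card_Un_disjoint) auto
    moreover have "S \<union> B - S = B" using B(1) by auto
    moreover have "S \<union> B \<subseteq> L - X" using B(1) SL SX by auto
    ultimately show "\<exists>B. S \<subseteq> B \<and> B \<subseteq> L - X \<and> card B = card S + j \<and> ev B (out C)"
      using B(3) ev'[of "S \<union> B" "out C"] outW by (intro exI[of _ "S \<union> B"]) auto
  next
    assume "\<exists>B. S \<subseteq> B \<and> B \<subseteq> L - X \<and> card B = card S + j \<and> ev B (out C)"
    then obtain B where B: "S \<subseteq> B" "B \<subseteq> L - X" "card B = card S + j" "ev B (out C)" by auto
    then have "card (B - S) = j" using finS by (simp add: card_Diff_subset)
    moreover have "B - S \<subseteq> lit_verts C'" using B(2) lit_verts' by auto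
    ultimately show "yes_instance C' j"
      using B ev'[OF B(1,2) outW] C'.yes_instance_iff by auto
  qed
qed

lemma critical_gates': "critical_gates C' \<subseteq> {p \<in> critical_gates C. \<not> ev S p}"
  by (auto simp: critical_gates_def or_gates' arcs' kept_gates_def undetermined_def)

lemma subtree': "subtree C' p \<subseteq> subtree C p"
proof -
  have "(arc_rel C' \<inter> gates C' \<times> gates C')\<^sup>* \<subseteq> GA\<^sup>*"
    by (rule rtrancl_mono) (auto simp: arcs' gates' kept_gates_def)
  then show ?thesis by (auto simp: subtree_def gates' kept_gates_def)
qed

lemma critical_gates_of_var':
  assumes "x \<in> variables C'"
  obtains v where "v \<in> L - S - X" "critical_gates_of_var C' x \<subseteq> {p \<in> critical_gates C. \<not> ev S p \<and> touches v p}"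
proof -
  obtain v b where v: "(v, Lit b x) \<in> set (nodes C')" using assms by (auto simp: variables_def)
  then have "v \<in> lit_verts C'" by (auto simp: lit_verts_def)
  moreover have "touches v p" if "C'.touches v p" for p
    using that subtree' arcs' unfolding C'.touches_def touches_def by blast
  ultimately show thesis
    using C'.critical_gates_of_var_eq[OF v] critical_gates' lit_verts' by (intro that[of v]) auto
qed

lemma circuit_genus': "circuit_genus C' \<le> circuit_genus C"
  unfolding circuit_genus_eq C'.circuit_genus_eq
  using kept_verts by (intro graph_genus_subgraph graph_props C'.graph_props)
    (auto simp: C'.graph_darts_def graph_darts_def C'.graph_verts_def graph_verts_def verts' arcs')

end

section \<open>The search tree\<close>

text \<open>A satisfied node of the search tree is represented by a single literal below the output gate.\<close>

definition trivial_yes :: "circuit \<times> nat" where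
  "trivial_yes = (\<lparr>nodes = [(0, And), (1, Lit True 0)], arcs = [(1, 0)], out = 0\<rparr>, 1)"

lemma trivial_yes_instance:
  assumes "1 \<le> t"
  shows "wsat_mono_instance t (fst trivial_yes)"
proof -
  let ?C = "fst trivial_yes"
  have A: "arc_rel ?C = {(1, 0)}" and V: "verts ?C = {0, 1}" and G: "gates ?C = {0}"
    and An: "and_gates ?C = {0}" and O: "or_gates ?C = {}" and Li: "lit_verts ?C = {1}" and o: "out ?C = 0"
    by (auto simp: trivial_yes_def arc_rel_def verts_def gates_def and_gates_def or_gates_def lit_verts_def)
  have pow: "l \<le> 1" if "(1, 0) \<in> {(1::nat, 0::nat)} ^^ l" for l
  proof (rule ccontr)
    assume "\<not> l \<le> 1"
    then obtain m where "l = Suc (Suc m)" by (metis One_nat_def Suc_le_eq less_Suc_eq_le not_less_eq not0_implies_Suc le_zero_eq linorder_not_le)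
    then show False using that by auto
  qed
  have "acyclic (arc_rel ?C)"
    unfolding A by (rule acyclicI_order[where f = id]) auto
  then have "is_circuit ?C"
    unfolding is_circuit_def V G Li o A by (auto simp: trivial_yes_def)
  moreover have "depth ?C \<le> 1"
    unfolding depth_def Li o A
  proof (rule Max.boundedI)
    have "{l. \<exists>v\<in>{1}. (v, 0) \<in> {(1::nat, 0::nat)} ^^ l} \<subseteq> {..1}" using pow by auto
    then show "finite {l. \<exists>v\<in>{1}. (v, 0) \<in> {(1::nat, 0::nat)} ^^ l}" by (rule finite_subset) simp
    have "(1, 0) \<in> {(1::nat, 0::nat)} ^^ 1" by simp
    then show "{l. \<exists>v\<in>{1}. (v, 0) \<in> {(1::nat, 0::nat)} ^^ l} \<noteq> {}" by blast
  qed (use pow in auto)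
  moreover have "card {w. (v, w) \<in> {(1::nat, 0::nat)}} \<le> 1" for v
    by (cases "v = 1") (auto simp: card_le_Suc0_iff_eq)
  ultimately show ?thesis
    using assms unfolding wsat_mono_instance_def pi_circuit_def G An O o A
    by (auto simp: monotone_circuit_def trivial_yes_def)
qed

lemma trivial_yes_props:
  "yes_instance (fst trivial_yes) (snd trivial_yes)" "critical_gates (fst trivial_yes) = {}"
  "circuit_genus (fst trivial_yes) = 0"
proof -
  let ?C = "fst trivial_yes"
  have A: "arc_rel ?C = {(1, 0)}" and An: "and_gates ?C = {0}" and O: "or_gates ?C = {}" and o: "out ?C = 0"
    and V: "verts ?C = {0, 1}" and var: "variables ?C = {0}"
    by (auto simp: trivial_yes_def arc_rel_def and_gates_def or_gates_def verts_def variables_def)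
  show "critical_gates ?C = {}" by (auto simp: critical_gates_def O)
  have lit: "evaluates ?C {0} 1" by (rule evaluates.intros(1)[of _ True 0]) (auto simp: trivial_yes_def)
  have "evaluates ?C {0} 0" by (rule evaluates.intros(2)) (use lit in \<open>auto simp: A An\<close>)
  then show "yes_instance ?C (snd trivial_yes)"
    unfolding yes_instance_def var o by (intro exI[of _ "{0}"]) (auto simp: trivial_yes_def)
  have "circuit_genus ?C = graph_genus {1::nat} {}"
  proof -
    have "{0, 1} - {0} = {1::nat}" "({(1::nat, 0::nat)} \<union> {(1, 0)}\<inverse>) \<inter> {1} \<times> {1} = {}" by auto
    then show ?thesis by (simp only: circuit_genus_def A o V Let_def)
  qed
  also have "\<dots> = 0"
    unfolding graph_genus_def
    by (intro Least_eq_0 exI[of _ id]) (auto simp: rotation_system_def permutes_id num_faces_def num_components_def)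
  finally show "circuit_genus ?C = 0" .
qed

lemma ex_three_iff:
  assumes "finite M"
  shows "(\<exists>p\<in>M. \<exists>q\<in>M. \<exists>r\<in>M. p \<noteq> q \<and> p \<noteq> r \<and> q \<noteq> r) \<longleftrightarrow> 3 \<le> card M"
proof
  assume "\<exists>p\<in>M. \<exists>q\<in>M. \<exists>r\<in>M. p \<noteq> q \<and> p \<noteq> r \<and> q \<noteq> r"
  then obtain p q r where "{p, q, r} \<subseteq> M" "card {p, q, r} = 3" by auto
  then show "3 \<le> card M" using card_mono[OF assms] by metis
next
  assume "3 \<le> card M"
  then obtain M' where M': "M' \<subseteq> M" "card M' = 3" using obtain_subset_with_card_n by metis
  then obtain p q r where "M' = {p, q, r}" "p \<noteq> q" "p \<noteq> r" "q \<noteq> r" by (auto simp: card_3_iff)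
  then show "\<exists>p\<in>M. \<exists>q\<in>M. \<exists>r\<in>M. p \<noteq> q \<and> p \<noteq> r \<and> q \<noteq> r" using M'(1) by blast
qed

context wsat_circuit
begin

text \<open>A list in the order of \<open>nodes C\<close>, as are \<open>front\<close> and
  \<open>branch\<close>, so that the program can be shown to produce literally the same
  output.\<close>

definition unsat :: "nat list \<Rightarrow> nat list" where
  "unsat S = filter (\<lambda>v. v \<in> critical_gates C \<and> \<not> ev (set S) v) (map fst (nodes C))"

definition front :: "nat \<Rightarrow> nat list \<Rightarrow> nat list" where
  "front k S = take (Suc (2 * (k - length S))) (unsat S)"

definition branch :: "nat \<Rightarrow> nat list \<Rightarrow> nat list" where
  "branch k S = filter (\<lambda>v. v \<in> L \<and> v \<notin> set S \<and>
     (\<exists>p\<in>set (front k S). \<exists>q\<in>set (front k S). \<exists>r\<in>set (front k S).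
        p \<noteq> q \<and> p \<noteq> r \<and> q \<noteq> r \<and> touches v p \<and> touches v q \<and> touches v r)) (map fst (nodes C))"

text \<open>The search tree cut off at depth \<open>i\<close>, built level by level so that it
  becomes one loop. The empty assignment is added again in each round, which keeps the shallower
  nodes in the list.\<close>

fun search :: "nat \<Rightarrow> nat \<Rightarrow> nat list list" where
  "search k 0 = [[]]"
| "search k (Suc i) = [] # concat (map (\<lambda>S. map (\<lambda>x. x # S) (branch k S)) (search k i))"

text \<open>Every node of the search tree, inner nodes included, contributes at most one instance:
  the one in which all its branching literals are 0. No instance arises if too many critical gates
  are unsatisfied or if these zeros already falsify the output.\<close>

definition leaf :: "nat \<Rightarrow> nat list \<Rightarrow> (circuit \<times> nat) list" where
  "leaf k S = (if ev (set S) (out C) then [trivial_yes]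
     else if 2 * (k - length S) < length (unsat S) \<or> \<not> ev (L - set (branch k S)) (out C) then []
     else [(restrict_circuit (set S) (set (branch k S)), k - length S)])"

text \<open>The weight has to be exactly \<open>k\<close>. A satisfied node is a yes-instance only
  if its assignment can be enlarged to \<open>k\<close> literals, which is why \<open>k\<close> is
  compared with their number.\<close>

definition reduction :: "nat \<Rightarrow> (circuit \<times> nat) list" where
  "reduction k = (if k \<le> card L then concat (map (leaf k) (search k k)) else [])"

lemma distinct_nodes: "distinct (map fst (nodes C))"
  using circ by (simp add: is_circuit_def)

lemma set_node_names: "set (map fst (nodes C)) = verts C"
  by (simp add: verts_def)

lemma unsat_props: "distinct (unsat S)" "set (unsat S) = {p \<in> critical_gates C. \<not> ev (set S) p}"
proof -
  show "distinct (unsat S)" using distinct_nodes by (simp add: unsat_def)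
  have "critical_gates C \<subseteq> verts C" using critical_gate(1) verts_split by blast
  then show "set (unsat S) = {p \<in> critical_gates C. \<not> ev (set S) p}"
    unfolding unsat_def set_filter set_node_names by blast
qed

lemma front_props: "set (front k S) \<subseteq> set (unsat S)" "distinct (front k S)"
  "card (set (front k S)) \<le> Suc (2 * (k - length S))"
proof -
  show "set (front k S) \<subseteq> set (unsat S)" by (simp add: front_def set_take_subset)
  show "distinct (front k S)" using unsat_props(1) by (simp add: front_def)
  show "card (set (front k S)) \<le> Suc (2 * (k - length S))"
    by (rule order_trans[OF card_length]) (simp add: front_def)
qed

lemma set_branch: "set (branch k S) = {x \<in> L. x \<notin> set S \<and> 3 \<le> card {p \<in> set (front k S). touches x p}}"
proof -
  have "L \<subseteq> verts C" using verts_split by auto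
  then have "set (branch k S) = {x \<in> L. x \<notin> set S \<and>
      (\<exists>p\<in>{p \<in> set (front k S). touches x p}. \<exists>q\<in>{p \<in> set (front k S). touches x p}.
       \<exists>r\<in>{p \<in> set (front k S). touches x p}. p \<noteq> q \<and> p \<noteq> r \<and> q \<noteq> r)}"
    unfolding branch_def set_filter set_node_names by blast
  also have "\<dots> = {x \<in> L. x \<notin> set S \<and> 3 \<le> card {p \<in> set (front k S). touches x p}}"
    by (subst ex_three_iff) auto
  finally show ?thesis .
qed

text \<open>The front has at most \<open>2 * k + 1\<close> gates, and four times this number is
  \<open>8 * k + 4\<close>.\<close>

lemma length_branch: "length (branch k S) \<le> 8 * k + 4 + 4 * circuit_genus C"
proof -
  have "length (branch k S) = card (set (branch k S))"
    using distinct_nodes unfolding branch_def by (intro distinct_card[symmetric] distinct_filter)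
  also have "\<dots> \<le> card {x \<in> L. 3 \<le> card {p \<in> set (front k S). touches x p}}"
    unfolding set_branch by (intro card_mono) auto
  also have "\<dots> \<le> 4 * card (set (front k S)) + 4 * circuit_genus C"
    using front_props(1) unsat_props(2) by (intro card_triple_touching) auto
  also have "\<dots> \<le> 8 * k + 4 + 4 * circuit_genus C" using front_props(3)[of k S] by simp
  finally show ?thesis .
qed

text \<open>With at most \<open>b\<close> children per node, one more level turns a bound
  \<open>H\<close> into \<open>1 + H * b\<close>, which is at most \<open>H * (b + 1)\<close>; this
  is where 4 becomes 5.\<close>

lemma length_search: "length (search k i) \<le> (8 * k + 5 + 4 * circuit_genus C) ^ i"
proof (induct i)
  case (Suc i)
  let ?b = "8 * k + 4 + 4 * circuit_genus C" and ?B = "8 * k + 5 + 4 * circuit_genus C"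
  have "length (concat (map (\<lambda>S. map (\<lambda>x. x # S) (branch k S)) xs)) \<le> length xs * ?b" for xs
    using length_branch by (induct xs) (auto simp: add_mono)
  from this[of "search k i"] have "length (search k (Suc i)) \<le> 1 + length (search k i) * ?b" by simp
  also have "\<dots> \<le> ?B ^ i + ?B ^ i * ?b" using Suc by (intro add_mono mult_right_mono) auto
  also have "\<dots> = ?B ^ i * (?b + 1)" by (simp only: distrib_left mult_1_right add.commute)
  also have "?b + 1 = ?B" by simp
  finally show ?case by (simp add: mult.commute)
qed simp

lemma search_mem: "S \<in> set (search k i) \<Longrightarrow> set S \<subseteq> L \<and> distinct S \<and> length S \<le> i"
proof (induct i arbitrary: S)
  case (Suc i)
  then consider "S = []" | x S' where "S = x # S'" "S' \<in> set (search k i)" "x \<in> set (branch k S')" by auto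
  then show ?case
  proof cases
    case 2 then show ?thesis using Suc(1) set_branch by fastforce
  qed simp
qed simp

lemma search_mono: "i \<le> j \<Longrightarrow> set (search k i) \<subseteq> set (search k j)"
proof -
  have "set (search k i) \<subseteq> set (search k (Suc i))" for i
  proof (induct i)
    case (Suc i)
    have "set (search k (Suc i)) = insert [] (\<Union>S\<in>set (search k i). (\<lambda>x. x # S) ` set (branch k S))" by auto
    also have "\<dots> \<subseteq> insert [] (\<Union>S\<in>set (search k (Suc i)). (\<lambda>x. x # S) ` set (branch k S))" using Suc by blast
    also have "\<dots> = set (search k (Suc (Suc i)))" by (subst (2) search.simps) simp
    finally show ?case .
  qed simp
  then show "i \<le> j \<Longrightarrow> set (search k i) \<subseteq> set (search k j)" by (rule lift_Suc_mono_le)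
qed

lemma length_reduction: "length (reduction k) \<le> (8 * k + 5 + 4 * circuit_genus C) ^ k"
proof -
  have "length (concat (map (leaf k) xs)) \<le> length xs" for xs
  proof (induct xs)
    case (Cons S xs)
    have "length (leaf k S) \<le> 1" by (simp add: leaf_def)
    then show ?case using Cons by simp
  qed simp
  then show ?thesis using length_search[of k k] by (auto simp: reduction_def intro: order_trans)
qed

lemma leaf_restriction:
  assumes "set S \<subseteq> L" "\<not> ev (set S) (out C)" "ev (L - set (branch k S)) (out C)"
  shows "restriction t C (set S) (set (branch k S))"
  using assms set_branch by unfold_locales (auto simp: undetermined_def)

lemma leaf_sound:
  assumes "t \<ge> 1" "S \<in> set (search k k)" "(C', k') \<in> set (leaf k S)" "k \<le> card L"
  shows "wsat_mono_instance t C'" "k' \<le> k" "card (critical_gates C') \<le> 2 * k'"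
    "\<forall>x\<in>variables C'. card (critical_gates_of_var C' x) \<le> 2" "circuit_genus C' \<le> circuit_genus C"
    "yes_instance C' k' \<Longrightarrow> yes_instance C k"
proof -
  have S: "set S \<subseteq> L" "distinct S" "length S \<le> k" using search_mem[OF assms(2)] by auto
  have "wsat_mono_instance t C' \<and> k' \<le> k \<and> card (critical_gates C') \<le> 2 * k' \<and>
    (\<forall>x\<in>variables C'. card (critical_gates_of_var C' x) \<le> 2) \<and> circuit_genus C' \<le> circuit_genus C \<and>
    (yes_instance C' k' \<longrightarrow> yes_instance C k)"
  proof (cases "ev (set S) (out C)")
    case True
    then have "(C', k') = trivial_yes" using assms(3) by (simp add: leaf_def)
    then have eq: "C' = fst trivial_yes" "k' = snd trivial_yes" by (metis fst_conv, metis snd_conv)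
    \<comment> \<open>The substitute instance has weight 1, so a satisfied node must not occur for
      \<open>k = 0\<close>.\<close>
    have "set S \<noteq> {}" using ev_nonempty[OF _ True] out_gate verts_split by auto
    then have "1 \<le> k" using S by (cases S) auto
    have "card (set S) \<le> k" using S by (simp add: distinct_card)
    then obtain B where B: "set S \<subseteq> B" "B \<subseteq> L" "card B = k"
      using exists_subset_between[of "set S" k L] S assms(4) by auto
    then have "ev B (out C)" using ev_mono[OF B(1) _ True] out_gate verts_split by auto
    then have "yes_instance C k" using yes_instance_iff B by auto
    then show ?thesis using \<open>1 \<le> k\<close> trivial_yes_instance[OF assms(1)] trivial_yes_props eq
      by (auto simp: critical_gates_of_var_def trivial_yes_def)
  next
    case False
    then have eq: "C' = restrict_circuit (set S) (set (branch k S))" "k' = k - length S"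
      and le: "length (unsat S) \<le> 2 * k'" and ev: "ev (L - set (branch k S)) (out C)"
      using assms(3) by (auto simp: leaf_def split: if_splits)
    interpret R: restriction t C "set S" "set (branch k S)"
      by (rule leaf_restriction[OF S(1) False ev])
    \<comment> \<open>Nothing has been cut off: the front consists of all unsatisfied critical
      gates. A literal that is not branched on therefore touches at most two critical gates of the
      new circuit.\<close>
    have front: "front k S = unsat S" using le eq by (simp add: front_def)
    have "card (critical_gates C') \<le> card (set (unsat S))"
      unfolding eq using R.critical_gates' unsat_props(2) by (intro card_mono) auto
    also have "\<dots> \<le> 2 * k'" using le card_length[of "unsat S"] by simp
    finally have 1: "card (critical_gates C') \<le> 2 * k'" .
    have 2: "card (critical_gates_of_var C' x) \<le> 2" if x: "x \<in> variables C'" for x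
    proof -
      obtain v where v: "v \<in> L - set S - set (branch k S)"
        "critical_gates_of_var C' x \<subseteq> {p \<in> critical_gates C. \<not> ev (set S) p \<and> touches v p}"
        unfolding eq(1) by (rule R.critical_gates_of_var'[OF x[unfolded eq(1)]])
      have "{p \<in> critical_gates C. \<not> ev (set S) p \<and> touches v p} = {p \<in> set (front k S). touches v p}"
        unfolding front unsat_props(2) by auto
      then have "card (critical_gates_of_var C' x) \<le> card {p \<in> set (front k S). touches v p}"
        using v(2) by (intro card_mono) auto
      also have "\<not> 3 \<le> card {p \<in> set (front k S). touches v p}" using v(1) unfolding set_branch by blast
      then have "card {p \<in> set (front k S). touches v p} < 3" by simp
      finally show ?thesis by simp
    qed
    have 3: "yes_instance C k" if "yes_instance C' k'"
    proof -
      have "\<exists>B. set S \<subseteq> B \<and> B \<subseteq> L - set (branch k S) \<and> card B = card (set S) + k' \<and> ev B (out C)"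
        using that R.yes_instance' unfolding eq(1) by blast
      moreover have "card (set S) + k' = k" using S eq by (simp add: distinct_card)
      ultimately show ?thesis using yes_instance_iff by auto
    qed
    have "k' \<le> k" using eq(2) by simp
    then show ?thesis using R.instance' R.circuit_genus' 1 2 3 unfolding eq(1) by blast
  qed
  then show "wsat_mono_instance t C'" "k' \<le> k" "card (critical_gates C') \<le> 2 * k'"
    "\<forall>x\<in>variables C'. card (critical_gates_of_var C' x) \<le> 2" "circuit_genus C' \<le> circuit_genus C"
    "yes_instance C' k' \<Longrightarrow> yes_instance C k" by auto
qed

text \<open>
  A solution \<open>B \<supseteq> S\<close> avoiding all literals in \<open>branch k S\<close> hits at most \<open>2 * (k - length S)\<close> of the
  gates in \<open>front k S\<close>, but has to hit all of them.
\<close>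

lemma few_unsat:
  assumes "set S \<subseteq> B" "B \<subseteq> L" "distinct S" "card B = k" "ev B (out C)" "B \<inter> set (branch k S) = {}"
  shows "length (unsat S) \<le> 2 * (k - length S)"
proof (rule ccontr)
  assume "\<not> ?thesis"
  then have "length (front k S) = Suc (2 * (k - length S))" by (simp add: front_def)
  then have cF: "card (set (front k S)) = Suc (2 * (k - length S))" using distinct_card[OF front_props(2)] by simp
  have finB: "finite B" using assms(2) finite_verts(2) finite_subset by blast
  \<comment> \<open>The output is an AND-gate, so \<open>B\<close> satisfies every critical gate.
    One that \<open>S\<close> leaves unsatisfied needs a literal of \<open>B - set S\<close>
    incoming to its subtree.\<close>
  have hit: "\<exists>x\<in>B - set S. touches x p" if p: "p \<in> set (front k S)" for p
  proof (rule ccontr)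
    assume no: "\<not> ?thesis"
    have p': "p \<in> critical_gates C" "\<not> ev (set S) p" using p front_props(1) unsat_props(2) by auto
    have "ev B p" using ev_and[OF out_and] assms(5) critical_gate(2)[OF p'(1)] by blast
    then have "ev (set S) p" using ev_subtree_cong[OF critical_gate(1)[OF p'(1)], of B "set S"] no by blast
    then show False using p' by simp
  qed
  have "set (front k S) \<subseteq> (\<Union>x\<in>B - set S. {p \<in> set (front k S). touches x p})" using hit by blast
  then have "card (set (front k S)) \<le> card (\<Union>x\<in>B - set S. {p \<in> set (front k S). touches x p})"
    using finB by (intro card_mono) auto
  also have "\<dots> \<le> (\<Sum>x\<in>B - set S. card {p \<in> set (front k S). touches x p})" using finB by (intro card_UN_le) auto
  also have "\<dots> \<le> (\<Sum>x\<in>B - set S. 2)"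
  proof (rule sum_mono)
    fix x assume "x \<in> B - set S"
    then have "\<not> 3 \<le> card {p \<in> set (front k S). touches x p}" using assms(2,6) set_branch by blast
    then show "card {p \<in> set (front k S). touches x p} \<le> 2" by simp
  qed
  also have "\<dots> = 2 * (k - length S)"
    using assms by (simp add: card_Diff_subset distinct_card)
  finally show False using cF by simp
qed

text \<open>The solution \<open>B\<close> guides the descent: while it contains a branching literal,
  that literal is added to \<open>S\<close>. This ends after at most \<open>k\<close> steps, and at
  the node reached \<open>B\<close> avoids all branching literals, so it survives in the instance of
  that node.\<close>

lemma search_complete:
  assumes "B \<subseteq> L" "card B = k" "ev B (out C)"
    and "S \<in> set (search k (length S))" "set S \<subseteq> B"
  shows "\<exists>S'\<in>set (search k k). \<exists>(C', k')\<in>set (leaf k S'). yes_instance C' k'"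
  using assms(4,5)
proof (induction "k - length S" arbitrary: S rule: less_induct)
  case less
  have S: "set S \<subseteq> L" "distinct S" using search_mem[OF less.prems(1)] by auto
  have finB: "finite B" using assms(1) finite_verts(2) finite_subset by blast
  have lenS: "length S \<le> k" using card_mono[OF finB less.prems(2)] S assms(2) by (simp add: distinct_card)
  show ?case
  proof (cases "B \<inter> set (branch k S) = {}")
    case False
    then obtain x where x: "x \<in> B" "x \<in> set (branch k S)" by auto
    then have "x \<notin> set S" using set_branch by auto
    then have "card (set (x # S)) = Suc (length S)" using S by (simp add: distinct_card)
    moreover have "card (set (x # S)) \<le> k" using card_mono[OF finB, of "set (x # S)"] x less.prems(2) assms(2) by simp
    ultimately have "k - length (x # S) < k - length S" by simp
    moreover have "x # S \<in> set (search k (length (x # S)))" using x less.prems(1) by auto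
    ultimately show ?thesis using less.hyps[of "x # S"] x less.prems by auto
  next
    case True
    have Sk: "S \<in> set (search k k)" using search_mono[OF lenS] less.prems(1) by auto
    show ?thesis
    proof (cases "ev (set S) (out C)")
      case ev: True
      then have "trivial_yes \<in> set (leaf k S)" by (simp add: leaf_def)
      then show ?thesis using Sk trivial_yes_props(1) by (intro bexI[OF _ Sk] bexI[of _ trivial_yes]) (auto simp: case_prod_beta)
    next
      case False
      have sub: "B \<subseteq> L - set (branch k S)" using True assms(1) by auto
      then have ev: "ev (L - set (branch k S)) (out C)" using ev_mono[OF sub _ assms(3)] out_gate verts_split by auto
      have le: "length (unsat S) \<le> 2 * (k - length S)"
        using few_unsat[OF less.prems(2) assms(1) S(2) assms(2,3) True] .
      interpret R: restriction t C "set S" "set (branch k S)"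
        by (rule leaf_restriction[OF S(1) False ev])
      have "yes_instance (restrict_circuit (set S) (set (branch k S))) (k - length S)"
        unfolding R.yes_instance' using less.prems(2) sub assms lenS S(2)
        by (intro exI[of _ B]) (auto simp: distinct_card)
      moreover have "(restrict_circuit (set S) (set (branch k S)), k - length S) \<in> set (leaf k S)"
        using le ev False by (simp add: leaf_def)
      ultimately show ?thesis using Sk by blast
    qed
  qed
qed

lemma reduction_correct:
  assumes "t \<ge> 1"
  shows "yes_instance C k \<longleftrightarrow> (\<exists>(C', k') \<in> set (reduction k). yes_instance C' k')"
    and "\<forall>(C', k') \<in> set (reduction k). wsat_mono_instance t C' \<and> k' \<le> k \<and>
      card (critical_gates C') \<le> 2 * k' \<and>
      (\<forall>x \<in> variables C'. card (critical_gates_of_var C' x) \<le> 2) \<and> circuit_genus C' \<le> circuit_genus C"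
proof -
  have mem: "\<exists>S\<in>set (search k k). (C', k') \<in> set (leaf k S) \<and> k \<le> card L" if "(C', k') \<in> set (reduction k)" for C' k'
    using that by (auto simp: reduction_def split: if_splits)
  show "\<forall>(C', k') \<in> set (reduction k). wsat_mono_instance t C' \<and> k' \<le> k \<and>
      card (critical_gates C') \<le> 2 * k' \<and>
      (\<forall>x \<in> variables C'. card (critical_gates_of_var C' x) \<le> 2) \<and> circuit_genus C' \<le> circuit_genus C"
  proof (intro ballI, clarify)
    fix C' k' assume "(C', k') \<in> set (reduction k)"
    then obtain S where "S \<in> set (search k k)" "(C', k') \<in> set (leaf k S)" "k \<le> card L" using mem by blast
    from leaf_sound(1-5)[OF assms this]
    show "wsat_mono_instance t C' \<and> k' \<le> k \<and> card (critical_gates C') \<le> 2 * k' \<and>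
      (\<forall>x \<in> variables C'. card (critical_gates_of_var C' x) \<le> 2) \<and> circuit_genus C' \<le> circuit_genus C" by blast
  qed
  show "yes_instance C k \<longleftrightarrow> (\<exists>(C', k') \<in> set (reduction k). yes_instance C' k')"
  proof
    assume "yes_instance C k"
    then obtain B where B: "B \<subseteq> L" "card B = k" "ev B (out C)" using yes_instance_iff by auto
    then have "k \<le> card L" using card_mono[OF finite_verts(2)] by auto
    then show "\<exists>(C', k') \<in> set (reduction k). yes_instance C' k'"
      using search_complete[OF B, of "[]"] by (auto simp: reduction_def)
  next
    assume "\<exists>(C', k') \<in> set (reduction k). yes_instance C' k'"
    then show "yes_instance C k" using mem leaf_sound(6)[OF assms] by blast
  qed
qed

end

section \<open>The reduction as a program\<close>

text \<open>
  Since the depth of the circuit is at most \<open>t\<close>, evaluation and reachability unfold to formulas with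
  quantifiers over the lists of nodes and arcs, nested to a constant depth \<open>m\<close>.
\<close>

fun evT :: "tree \<Rightarrow> tree \<Rightarrow> tree \<Rightarrow> nat \<Rightarrow> tree \<Rightarrow> bool" where
  "evT ns as S 0 v = False"
| "evT ns as S (Suc i) v =
    (((\<exists>a\<in>elems ns. left a = v \<and> left (right a) \<noteq> Leaf) \<and> v \<in> elems S) \<or>
     (Node v (enc_label And) \<in> elems ns \<and> (\<forall>e\<in>elems as. right e = v \<longrightarrow> evT ns as S i (left e))) \<or>
     (Node v (enc_label Or) \<in> elems ns \<and> (\<exists>e\<in>elems as. right e = v \<and> evT ns as S i (left e))))"

fun reachT :: "tree \<Rightarrow> nat \<Rightarrow> tree \<Rightarrow> tree \<Rightarrow> bool" where
  "reachT as 0 v p = (v = p)"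
| "reachT as (Suc i) v p = (v = p \<or> (\<exists>e\<in>elems as. left e = v \<and> reachT as i (right e) p))"

definition touchT :: "tree \<Rightarrow> nat \<Rightarrow> tree \<Rightarrow> tree \<Rightarrow> bool" where
  "touchT as i u p \<longleftrightarrow> (\<exists>e\<in>elems as. left e = u \<and> reachT as i (right e) p)"

text \<open>The list \<open>Y\<close> holds the literals not fixed to 0, so that the two evaluations
  together decide whether \<open>v\<close> is undetermined. The value \<open>True\<close> at 0 only
  ends the upward walk.\<close>

fun keptT :: "nat \<Rightarrow> tree \<Rightarrow> tree \<Rightarrow> tree \<Rightarrow> tree \<Rightarrow> nat \<Rightarrow> tree \<Rightarrow> bool" where
  "keptT m ns as S Y 0 v = True"
| "keptT m ns as S Y (Suc i) v = (\<not> evT ns as S m v \<and> evT ns as Y m v \<and>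
     (\<forall>e\<in>elems as. left e = v \<longrightarrow> keptT m ns as S Y i (right e)))"

text \<open>The number \<open>i\<close> belongs to the program and not to its input, so each
  quantifier may raise the degree of the polynomial. The arguments are generalised because they are
  weakened under each quantifier.\<close>

lemma pdec_evT:
  assumes "ptime a" "ptime b" "ptime c" "ptime v"
  shows "pdec (\<lambda>x. evT (a x) (b x) (c x) i (v x))"
  using assms
proof (induction i arbitrary: a b c v)
  case (Suc i)
  show ?case unfolding evT.simps
    by (intro pdec_disj pdec_conj pdec_Bex pdec_Ball pdec_mem pdec_eq pdec_not pdec_imp Suc.IH
        ptime_Node ptime_left ptime_right ptime_id ptime_const Suc.prems
        Suc.prems(1)[THEN ptime_weaken] Suc.prems(2)[THEN ptime_weaken] Suc.prems(3)[THEN ptime_weaken]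
        Suc.prems(4)[THEN ptime_weaken])
qed (simp add: pdec_const)

lemma pdec_reachT:
  assumes "ptime a" "ptime v" "ptime p"
  shows "pdec (\<lambda>x. reachT (a x) i (v x) (p x))"
  using assms
proof (induction i arbitrary: a v p)
  case (Suc i)
  show ?case unfolding reachT.simps
    by (intro pdec_disj pdec_conj pdec_Bex pdec_eq Suc.IH ptime_left ptime_right ptime_id Suc.prems
        Suc.prems(1)[THEN ptime_weaken] Suc.prems(2)[THEN ptime_weaken] Suc.prems(3)[THEN ptime_weaken])
qed (simp add: pdec_eq)

lemma pdec_touchT:
  assumes "ptime a" "ptime v" "ptime p"
  shows "pdec (\<lambda>x. touchT (a x) i (v x) (p x))"
  unfolding touchT_def
  by (intro pdec_conj pdec_Bex pdec_eq pdec_reachT ptime_left ptime_right ptime_id assms assms[THEN ptime_weaken])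

lemma pdec_keptT:
  assumes "ptime a" "ptime b" "ptime c" "ptime d" "ptime v"
  shows "pdec (\<lambda>x. keptT m (a x) (b x) (c x) (d x) i (v x))"
  using assms
proof (induction i arbitrary: a b c d v)
  case (Suc i)
  show ?case unfolding keptT.simps
    by (intro pdec_conj pdec_Ball pdec_eq pdec_not pdec_imp pdec_evT Suc.IH
        ptime_left ptime_right ptime_id Suc.prems
        Suc.prems(1)[THEN ptime_weaken] Suc.prems(2)[THEN ptime_weaken] Suc.prems(3)[THEN ptime_weaken]
        Suc.prems(4)[THEN ptime_weaken] Suc.prems(5)[THEN ptime_weaken])
qed (simp add: pdec_const)

text \<open>The functions below are applied to a pair \<open>y\<close> of a partial assignment and the instance.\<close>

abbreviation "nodesT y \<equiv> left (left (right y))"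
abbreviation "arcsT y \<equiv> left (right (left (right y)))"
abbreviation "outT y \<equiv> right (right (left (right y)))"

text \<open>The remaining weight \<open>k - length S\<close> in unary.\<close>

definition restT :: "tree \<Rightarrow> tree" where
  "restT y = of_list (drop (length (to_list (left y))) (to_list (right (right y))))"

definition unsatT :: "nat \<Rightarrow> tree \<Rightarrow> tree" where
  "unsatT m y = of_list (filter (\<lambda>a. right a = enc_label Or \<and> Node (left a) (outT y) \<in> elems (arcsT y) \<and>
     \<not> evT (nodesT y) (arcsT y) (left y) m (left a)) (to_list (nodesT y)))"

text \<open>Doubling the unary remaining weight and adding one leaf gives the number
  \<open>2 * (k - length S) + 1\<close>.\<close>

definition frontT :: "nat \<Rightarrow> tree \<Rightarrow> tree" where
  "frontT m y = of_list (take (length (to_list (Node Leaf (of_list (to_list (restT y) @ to_list (restT y))))))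
     (to_list (unsatT m y)))"

text \<open>The entry \<open>a\<close> is an encoded node; \<open>left (right a)\<close> differs
  from \<open>Leaf\<close> exactly for labels that are literals.\<close>

definition branchT :: "nat \<Rightarrow> tree \<Rightarrow> tree" where
  "branchT m y = of_list (map (\<lambda>a. left a) (to_list (of_list (filter (\<lambda>a. left (right a) \<noteq> Leaf \<and> left a \<notin> elems (left y) \<and>
     (\<exists>p\<in>elems (frontT m y). \<exists>q\<in>elems (frontT m y). \<exists>r\<in>elems (frontT m y).
        left p \<noteq> left q \<and> left p \<noteq> left r \<and> left q \<noteq> left r \<and> touchT (arcsT y) m (left a) (left p) \<and>
        touchT (arcsT y) m (left a) (left q) \<and> touchT (arcsT y) m (left a) (left r))) (to_list (nodesT y))))))"

definition remainingT :: "nat \<Rightarrow> tree \<Rightarrow> tree" where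
  "remainingT m y = of_list (map (\<lambda>a. left a) (to_list (of_list (filter (\<lambda>a. left (right a) \<noteq> Leaf \<and>
     left a \<notin> elems (branchT m y)) (to_list (nodesT y))))))"

definition nodesT' :: "nat \<Rightarrow> tree \<Rightarrow> tree" where
  "nodesT' m y = of_list (filter (\<lambda>a. (left (right a) \<noteq> Leaf \<and> left a \<notin> elems (left y) \<and> left a \<notin> elems (branchT m y)) \<or>
      (left (right a) = Leaf \<and> keptT m (nodesT y) (arcsT y) (left y) (remainingT m y) m (left a))) (to_list (nodesT y)))"

definition arcsT' :: "nat \<Rightarrow> tree \<Rightarrow> tree" where
  "arcsT' m y = of_list (filter (\<lambda>e. (\<exists>a\<in>elems (nodesT' m y). left a = left e) \<and>
      (\<exists>a\<in>elems (nodesT' m y). left a = right e)) (to_list (arcsT y)))"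

text \<open>A nonempty rest after dropping twice the remaining weight from the unsatisfied gates
  says that there are too many of them.\<close>

definition leafT :: "nat \<Rightarrow> tree \<Rightarrow> tree" where
  "leafT m y = (if evT (nodesT y) (arcsT y) (left y) m (outT y) then Node (enc_instance trivial_yes) Leaf
     else if of_list (drop (length (to_list (of_list (to_list (restT y) @ to_list (restT y))))) (to_list (unsatT m y))) \<noteq> Leaf
       \<or> \<not> evT (nodesT y) (arcsT y) (remainingT m y) m (outT y) then Leaf
     else Node (Node (Node (nodesT' m y) (Node (arcsT' m y) (outT y))) (restT y)) Leaf)"

text \<open>The state of the loop is a unary counter, the list of partial assignments and the instance.\<close>

definition stepT :: "nat \<Rightarrow> tree \<Rightarrow> tree" where
  "stepT m s = Node (right (left s)) (Node (Node Leaf (of_list (concat (map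
     (\<lambda>S. to_list (of_list (map (\<lambda>x. Node x S) (to_list (branchT m (Node S (right (right s)))))))) (to_list (left (right s)))))))
     (right (right s)))"

text \<open>The leading \<open>Node Leaf Leaf\<close> is the tag of \<open>Reduced\<close>. The
  emptiness test compares \<open>k\<close>, in unary, with the number of literal nodes.\<close>

definition finalT :: "nat \<Rightarrow> tree \<Rightarrow> tree" where
  "finalT m s = Node (Node Leaf Leaf)
     (if of_list (drop (length (to_list (of_list (filter (\<lambda>a. left (right a) \<noteq> Leaf) (to_list (left (left (right (right s)))))))))
        (to_list (right (right (right s))))) = Leaf
      then of_list (concat (map (\<lambda>S. to_list (leafT m (Node S (right (right s))))) (to_list (left (right s)))))
      else Leaf)"

section \<open>Polynomial time for a single step of the search\<close>

lemma ptime_restT: "ptime f \<Longrightarrow> ptime (\<lambda>x. restT (f x))"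
  unfolding restT_def by (intro ptime_intros)

lemma ptime_unsatT: assumes "ptime f" shows "ptime (\<lambda>x. unsatT m (f x))"
proof -
  have "ptime (unsatT m)" unfolding unsatT_def by (intro ptime_intros pdec_evT)
  then show ?thesis by (rule ptime_comp[OF _ assms])
qed

lemma ptime_frontT: "ptime f \<Longrightarrow> ptime (\<lambda>x. frontT m (f x))"
  unfolding frontT_def by (intro ptime_intros ptime_restT ptime_unsatT)

lemma ptime_branchT: assumes "ptime f" shows "ptime (\<lambda>x. branchT m (f x))"
proof -
  have "ptime (branchT m)" unfolding branchT_def by (intro ptime_intros pdec_touchT ptime_frontT)
  then show ?thesis by (rule ptime_comp[OF _ assms])
qed

lemma ptime_remainingT: assumes "ptime f" shows "ptime (\<lambda>x. remainingT m (f x))"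
proof -
  have "ptime (remainingT m)" unfolding remainingT_def by (intro ptime_intros ptime_branchT)
  then show ?thesis by (rule ptime_comp[OF _ assms])
qed

lemma ptime_nodesT': assumes "ptime f" shows "ptime (\<lambda>x. nodesT' m (f x))"
proof -
  have "ptime (nodesT' m)" unfolding nodesT'_def by (intro ptime_intros ptime_branchT ptime_remainingT pdec_keptT)
  then show ?thesis by (rule ptime_comp[OF _ assms])
qed

lemma ptime_arcsT': assumes "ptime f" shows "ptime (\<lambda>x. arcsT' m (f x))"
proof -
  have "ptime (arcsT' m)" unfolding arcsT'_def by (intro ptime_intros ptime_nodesT')
  then show ?thesis by (rule ptime_comp[OF _ assms])
qed

lemma ptime_leafT: assumes "ptime f" shows "ptime (\<lambda>x. leafT m (f x))"
proof -
  have "ptime (leafT m)" unfolding leafT_def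
    by (intro ptime_intros ptime_nodesT' ptime_arcsT' ptime_remainingT ptime_restT ptime_unsatT pdec_evT)
  then show ?thesis by (rule ptime_comp[OF _ assms])
qed

lemma ptime_stepT: "ptime (stepT m)"
  unfolding stepT_def by (intro ptime_intros ptime_branchT)

lemma ptime_finalT: "ptime (finalT m)"
  unfolding finalT_def by (intro ptime_intros ptime_leafT)

subsection \<open>Correctness of the program\<close>

lemma enc_binary_0: "enc_binary n = Leaf \<longleftrightarrow> n = 0"
  by (subst enc_binary.simps) simp

lemma enc_binary_inj [simp]: "enc_binary m = enc_binary n \<longleftrightarrow> m = n"
proof
  show "enc_binary m = enc_binary n \<Longrightarrow> m = n"
  proof (induction m arbitrary: n rule: less_induct)
    case (less m)
    show ?case
    proof (cases "m = 0 \<or> n = 0")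
      case True
      then show ?thesis using less.prems enc_binary_0[of m] enc_binary_0[of n] enc_binary_0[of 0] by auto
    next
      case False
      then have eq: "enc_bool (odd m) = enc_bool (odd n)" "enc_binary (m div 2) = enc_binary (n div 2)"
        using less.prems enc_binary.simps[of m] enc_binary.simps[of n] by auto
      have "m div 2 = n div 2" using False by (intro less.IH eq) simp
      moreover have "odd m = odd n" using eq(1) by (cases "odd m"; cases "odd n") auto
      ultimately show ?thesis by (cases "odd m") (auto elim!: oddE evenE)
    qed
  qed
qed simp

lemma enc_bool_inj [simp]: "enc_bool a = enc_bool b \<longleftrightarrow> a = b"
  by (cases a; cases b) auto

lemma enc_label_inj [simp]: "enc_label l = enc_label l' \<longleftrightarrow> l = l'"
  by (cases l; cases l') auto

lemma left_enc_label [simp]: "left (enc_label l) = Leaf \<longleftrightarrow> (\<forall>b x. l \<noteq> Lit b x)"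
  by (cases l) auto

declare enc_label.simps [simp del]

lemma elems_enc_list [simp]: "elems (enc_list e xs) = e ` set xs"
  by (simp add: elems_def)

lemma of_list_map_enc: "of_list (map e xs) = enc_list e xs"
  by (rule enc_list_conv[symmetric])

abbreviation encN :: "nat \<times> label \<Rightarrow> tree" where
  "encN \<equiv> \<lambda>(v, l). Node (enc_binary v) (enc_label l)"

abbreviation encA :: "nat \<times> nat \<Rightarrow> tree" where
  "encA \<equiv> \<lambda>(u, v). Node (enc_binary u) (enc_binary v)"

abbreviation encS :: "nat list \<Rightarrow> tree" where
  "encS \<equiv> enc_list enc_binary"

context wsat_circuit
begin

abbreviation "nsC \<equiv> enc_list encN (nodes C)"
abbreviation "asC \<equiv> enc_list encA (arcs C)"

lemma node_label_iff:
  "Node (enc_binary v) (enc_label l) \<in> elems nsC \<longleftrightarrow> (v, l) \<in> set (nodes C)"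
  by (force simp: image_iff)

lemma lit_node_iff: "(\<exists>a\<in>elems nsC. left a = enc_binary v \<and> left (right a) \<noteq> Leaf) \<longleftrightarrow> v \<in> L"
  by (force simp: lit_verts_def)

lemma arcs_in: "(\<exists>e\<in>elems asC. right e = enc_binary v \<and> P (left e)) \<longleftrightarrow> (\<exists>u. (u, v) \<in> A \<and> P (enc_binary u))"
  "(\<forall>e\<in>elems asC. right e = enc_binary v \<longrightarrow> P (left e)) \<longleftrightarrow> (\<forall>u. (u, v) \<in> A \<longrightarrow> P (enc_binary u))"
  by (force simp: arc_rel_def)+

lemma arcs_out: "(\<exists>e\<in>elems asC. left e = enc_binary v \<and> P (right e)) \<longleftrightarrow> (\<exists>u. (v, u) \<in> A \<and> P (enc_binary u))"
  "(\<forall>e\<in>elems asC. left e = enc_binary v \<longrightarrow> P (right e)) \<longleftrightarrow> (\<forall>u. (v, u) \<in> A \<longrightarrow> P (enc_binary u))"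
  by (force simp: arc_rel_def)+

text \<open>At distance \<open>j\<close> from the output, fuel \<open>i\<close> with
  \<open>i + j\<close> above \<open>t\<close> cannot run out, because no path to the output is
  longer than \<open>t\<close>.\<close>

lemma evT_correct:
  assumes "v \<in> verts C" "(v, out C) \<in> A ^^ j" "t < i + j"
  shows "evT nsC asC (encS S) i (enc_binary v) \<longleftrightarrow> ev (set S) v"
  using assms
proof (induction i arbitrary: v j)
  case 0
  then show ?case using path_to_out_le[of v j] by simp
next
  case (Suc i)
  have IH: "evT nsC asC (encS S) i (enc_binary u) \<longleftrightarrow> ev (set S) u" if "(u, v) \<in> A" for u
  proof (rule Suc.IH)
    show "u \<in> verts C" using that arc_verts by blast
    show "(u, out C) \<in> A ^^ Suc j" using that Suc.prems(2) by (rule relpow_Suc_I2)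
    show "t < i + Suc j" using Suc.prems by simp
  qed
  have eq: "evT nsC asC (encS S) (Suc i) (enc_binary v) \<longleftrightarrow>
     (v \<in> L \<and> v \<in> set S) \<or> (v \<in> and_gates C \<and> (\<forall>u. (u, v) \<in> A \<longrightarrow> ev (set S) u)) \<or>
     (v \<in> or_gates C \<and> (\<exists>u. (u, v) \<in> A \<and> ev (set S) u))"
    unfolding evT.simps lit_node_iff arcs_in[where P = "evT nsC asC (encS S) i"] node_label_iff
    using IH by (auto simp: and_gates_def or_gates_def)
  from Suc.prems(1) show ?case
  proof (cases rule: vertex_cases)
    case 1 then show ?thesis unfolding eq using ev_lit gates_lits_disjoint by (auto simp: gates_def)
  next
    case 2 then show ?thesis unfolding eq ev_and[OF 2] using gates_lits_disjoint and_or_disjoint by (auto simp: gates_def)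
  next
    case 3 then show ?thesis unfolding eq ev_or[OF 3] using gates_lits_disjoint and_or_disjoint by (auto simp: gates_def)
  qed
qed

lemma evT_gate: "v \<in> gates C \<Longrightarrow> evT nsC asC (encS S) (Suc t) (enc_binary v) \<longleftrightarrow> ev (set S) v"
proof -
  assume v: "v \<in> gates C"
  then obtain j where "(v, out C) \<in> A ^^ j" using gate_reaches_out rtrancl_imp_relpow by metis
  then show ?thesis using evT_correct[of v j "Suc t"] v verts_split by auto
qed

lemma path_le: assumes "v \<in> verts C" "(v, w) \<in> A ^^ l" "w \<in> gates C" shows "l \<le> t"
proof -
  obtain j where "(w, out C) \<in> A ^^ j" using assms(3) gate_reaches_out rtrancl_imp_relpow by metis
  then have "(v, out C) \<in> A ^^ (l + j)" using assms(2) by (auto intro: relpow_trans)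
  then show ?thesis using path_to_out_le[OF assms(1)] by fastforce
qed

lemma reachT_iff: "reachT asC i (enc_binary v) (enc_binary p) \<longleftrightarrow> (\<exists>l\<le>i. (v, p) \<in> A ^^ l)"
proof (induction i arbitrary: v)
  case (Suc i)
  have "(\<exists>l\<le>Suc i. (v, p) \<in> A ^^ l) \<longleftrightarrow> v = p \<or> (\<exists>u. (v, u) \<in> A \<and> (\<exists>l\<le>i. (u, p) \<in> A ^^ l))"
  proof
    assume "\<exists>l\<le>Suc i. (v, p) \<in> A ^^ l"
    then obtain l where l: "l \<le> Suc i" "(v, p) \<in> A ^^ l" by auto
    show "v = p \<or> (\<exists>u. (v, u) \<in> A \<and> (\<exists>l\<le>i. (u, p) \<in> A ^^ l))"
    proof (cases l)
      case (Suc l')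
      then show ?thesis using l relpow_Suc_D2 by (metis Suc_le_mono)
    qed (use l in auto)
  next
    assume "v = p \<or> (\<exists>u. (v, u) \<in> A \<and> (\<exists>l\<le>i. (u, p) \<in> A ^^ l))"
    then show "\<exists>l\<le>Suc i. (v, p) \<in> A ^^ l"
    proof
      assume "v = p" then show ?thesis by (intro exI[of _ 0]) auto
    next
      assume "\<exists>u. (v, u) \<in> A \<and> (\<exists>l\<le>i. (u, p) \<in> A ^^ l)"
      then show ?thesis by (metis Suc_le_mono relpow_Suc_I2)
    qed
  qed
  then show ?case unfolding reachT.simps arcs_out[where P = "\<lambda>x. reachT asC i x (enc_binary p)"] using Suc.IH by simp
qed simp

text \<open>Paths ending in a gate have length at most \<open>t\<close>, so the bounded search is
  exhaustive. A path that starts in a gate visits only gates, since arcs never enter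
  literals.\<close>

lemma reachT_subtree:
  assumes "v \<in> gates C" "p \<in> gates C"
  shows "reachT asC (Suc t) (enc_binary v) (enc_binary p) \<longleftrightarrow> v \<in> subtree C p"
proof -
  have "(\<exists>l\<le>Suc t. (v, p) \<in> A ^^ l) \<longleftrightarrow> (v, p) \<in> A\<^sup>*"
  proof
    assume "(v, p) \<in> A\<^sup>*"
    then obtain l where l: "(v, p) \<in> A ^^ l" using rtrancl_imp_relpow by blast
    then have "l \<le> t" using path_le assms verts_split by auto
    then show "\<exists>l\<le>Suc t. (v, p) \<in> A ^^ l" using l le_SucI by blast
  qed (use relpow_imp_rtrancl in blast)
  also have "(v, p) \<in> A\<^sup>* \<longleftrightarrow> (v, p) \<in> GA\<^sup>*"
  proof
    assume "(v, p) \<in> A\<^sup>*"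
    then show "(v, p) \<in> GA\<^sup>*" using assms(1)
    proof (induction rule: converse_rtrancl_induct)
      case (step y z)
      then show ?case using arc_to_gate by (blast intro: converse_rtrancl_into_rtrancl)
    qed simp
  qed (use rtrancl_mono[of GA A] in blast)
  finally show ?thesis using assms unfolding reachT_iff by (auto simp: subtree_def)
qed

lemma touchT_iff:
  assumes "p \<in> gates C"
  shows "touchT asC (Suc t) (enc_binary u) (enc_binary p) \<longleftrightarrow> touches u p"
  unfolding touchT_def arcs_out[where P = "\<lambda>x. reachT asC (Suc t) x (enc_binary p)"] touches_def using reachT_subtree[OF _ assms] arc_to_gate subtree_gate by blast

lemma keptT_iff:
  assumes "v \<in> gates C" "set Y = L - X"
  shows "keptT (Suc t) nsC asC (encS S) (encS Y) i (enc_binary v)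
    \<longleftrightarrow> (\<forall>w. \<forall>l<i. (v, w) \<in> A ^^ l \<longrightarrow> undetermined (set S) X w)"
  using assms(1)
proof (induction i arbitrary: v)
  case (Suc i)
  have "(\<forall>w. \<forall>l<Suc i. (v, w) \<in> A ^^ l \<longrightarrow> undetermined (set S) X w) \<longleftrightarrow>
    undetermined (set S) X v \<and> (\<forall>u. (v, u) \<in> A \<longrightarrow> (\<forall>w. \<forall>l<i. (u, w) \<in> A ^^ l \<longrightarrow> undetermined (set S) X w))"
    (is "?L \<longleftrightarrow> ?R")
  proof
    assume L: ?L
    have "undetermined (set S) X v" using L[rule_format, of 0 v] by simp
    moreover have "undetermined (set S) X w" if "(v, u) \<in> A" "l < i" "(u, w) \<in> A ^^ l" for u w l
      using L[rule_format, of "Suc l" w] relpow_Suc_I2[OF that(1,3)] that(2) by simp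
    ultimately show ?R by blast
  next
    assume R: ?R
    show ?L
    proof (intro allI impI)
      fix w l assume "l < Suc i" "(v, w) \<in> A ^^ l"
      then show "undetermined (set S) X w"
        using R by (cases l) (simp, meson Suc_less_SucD relpow_Suc_D2)
    qed
  qed
  moreover have "undetermined (set S) X v \<longleftrightarrow> \<not> evT nsC asC (encS S) (Suc t) (enc_binary v) \<and> evT nsC asC (encS Y) (Suc t) (enc_binary v)"
    using evT_gate[OF Suc.prems] assms(2) by (simp add: undetermined_def del: evT.simps)
  moreover have "keptT (Suc t) nsC asC (encS S) (encS Y) i (enc_binary u) \<longleftrightarrow> (\<forall>w. \<forall>l<i. (u, w) \<in> A ^^ l \<longrightarrow> undetermined (set S) X w)"
    if "(v, u) \<in> A" for u using Suc.IH that arc_to_gate by blast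
  ultimately show ?case
    unfolding keptT.simps arcs_out[where P = "keptT (Suc t) nsC asC (encS S) (encS Y) i"] by blast
qed simp

lemma keptT_kept_gates:
  assumes "v \<in> gates C" "set Y = L - X"
  shows "keptT (Suc t) nsC asC (encS S) (encS Y) (Suc t) (enc_binary v) \<longleftrightarrow> v \<in> kept_gates (set S) X"
proof -
  have "w \<in> gates C" if "(v, w) \<in> A\<^sup>*" for w
    using that assms(1) by (induction rule: rtrancl_induct) (auto intro: arc_to_gate)
  then have "(\<forall>w. \<forall>l<Suc t. (v, w) \<in> A ^^ l \<longrightarrow> undetermined (set S) X w) \<longleftrightarrow> (\<forall>w. (v, w) \<in> A\<^sup>* \<longrightarrow> undetermined (set S) X w)"
    using path_le assms(1) verts_split relpow_imp_rtrancl rtrancl_imp_relpow less_Suc_eq_le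
    by (metis UnI1)
  then show ?thesis unfolding keptT_iff[OF assms] using assms(1) by (simp add: kept_gates_def)
qed

end

lemma filter_fst: "map fst (filter (\<lambda>(v, l). Q v) xs) = filter Q (map fst xs)"
  by (induct xs) auto

context wsat_circuit
begin

definition instT :: "nat \<Rightarrow> tree" where
  "instT k = Node (Node nsC (Node asC (enc_binary (out C)))) (enc_unary k)"

lemma enc_instance_eq: "enc_instance (C, k) = instT k"
  by (simp add: enc_instance_def enc_circuit_def instT_def)

lemma instT_simps [simp]:
  "left (left (instT k)) = nsC" "left (right (left (instT k))) = asC"
  "right (right (left (instT k))) = enc_binary (out C)" "right (instT k) = enc_unary k"
  by (simp_all add: instT_def)

abbreviation "argT k S \<equiv> Node (encS S) (instT k)"

lemma lit_label: "(v, l) \<in> set (nodes C) \<Longrightarrow> (\<exists>b x. l = Lit b x) \<longleftrightarrow> v \<in> L"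
  unfolding lit_verts_def using label_unique by blast

lemma or_label: "(v, l) \<in> set (nodes C) \<Longrightarrow> l = Or \<longleftrightarrow> v \<in> or_gates C"
  unfolding or_gates_def using label_unique by blast

lemma filter_nodes: 
  assumes "\<And>v l. (v, l) \<in> set (nodes C) \<Longrightarrow> P (Node (enc_binary v) (enc_label l)) \<longleftrightarrow> Q v"
  shows "filter P (map encN (nodes C)) = map encN (filter (\<lambda>(v, l). Q v) (nodes C))"
  unfolding filter_map by (rule arg_cong[where f = "map encN"], rule filter_cong) (use assms in auto)

lemma restT_eq: "restT (argT k S) = enc_unary (k - length S)"
  by (simp add: restT_def of_list_replicate)

text \<open>The program filters whole node entries, so the labels are carried along here and
  stripped only in \<open>branch\<close>.\<close>

definition unsat_nodes :: "nat list \<Rightarrow> (nat \<times> label) list" where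
  "unsat_nodes S = filter (\<lambda>(v, l). v \<in> critical_gates C \<and> \<not> ev (set S) v) (nodes C)"

lemma fst_unsat_nodes: "map fst (unsat_nodes S) = unsat S"
  unfolding unsat_nodes_def unsat_def filter_fst ..

lemma unsatT_eq: "unsatT (Suc t) (argT k S) = enc_list encN (unsat_nodes S)"
proof -
  have arc: "Node (enc_binary v) (enc_binary (out C)) \<in> elems asC \<longleftrightarrow> (v, out C) \<in> A" for v
    by (force simp: arc_rel_def)
  have "filter (\<lambda>a. right a = enc_label Or \<and> Node (left a) (enc_binary (out C)) \<in> elems asC \<and>
     \<not> evT nsC asC (encS S) (Suc t) (left a)) (map encN (nodes C)) = map encN (unsat_nodes S)"
    unfolding unsat_nodes_def
  proof (rule filter_nodes)
    fix v l assume vl: "(v, l) \<in> set (nodes C)"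
    show "right (Node (enc_binary v) (enc_label l)) = enc_label Or \<and>
         Node (left (Node (enc_binary v) (enc_label l))) (enc_binary (out C)) \<in> elems asC \<and>
         \<not> evT nsC asC (encS S) (Suc t) (left (Node (enc_binary v) (enc_label l))) \<longleftrightarrow>
       v \<in> critical_gates C \<and> \<not> ev (set S) v"
      unfolding left.simps right.simps arc enc_label_inj or_label[OF vl]
      using evT_gate[of v S] by (auto simp: critical_gates_def gates_def simp del: evT.simps)
  qed
  then show ?thesis
    unfolding unsatT_def instT_simps left.simps right.simps to_list_enc_list
    by (simp only: of_list_map_enc)
qed

lemma frontT_eq: "frontT (Suc t) (argT k S) = enc_list encN (take (Suc (2 * (k - length S))) (unsat_nodes S))"
proof -
  have "length (to_list (Node Leaf (of_list (to_list (restT (argT k S)) @ to_list (restT (argT k S)))))) = Suc (2 * (k - length S))"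
    by (simp add: restT_eq)
  then show ?thesis
    unfolding frontT_def by (simp only: unsatT_eq to_list_enc_list take_map of_list_map_enc)
qed

lemma front_nodes: "front k S = map fst (take (Suc (2 * (k - length S))) (unsat_nodes S))"
  unfolding front_def fst_unsat_nodes[symmetric] take_map ..

lemma left_encN: "left (encN a) = enc_binary (fst a)"
  by (cases a) simp

lemma branchT_eq: "branchT (Suc t) (argT k S) = encS (branch k S)"
proof -
  let ?F = "elems (frontT (Suc t) (argT k S))"
  let ?Q = "\<lambda>v. v \<in> L \<and> v \<notin> set S \<and>
     (\<exists>p\<in>set (front k S). \<exists>q\<in>set (front k S). \<exists>r\<in>set (front k S).
        p \<noteq> q \<and> p \<noteq> r \<and> q \<noteq> r \<and> touches v p \<and> touches v q \<and> touches v r)"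
  let ?P = "\<lambda>a. left (right a) \<noteq> Leaf \<and> left a \<notin> elems (encS S) \<and>
     (\<exists>p\<in>?F. \<exists>q\<in>?F. \<exists>r\<in>?F.
        left p \<noteq> left q \<and> left p \<noteq> left r \<and> left q \<noteq> left r \<and> touchT asC (Suc t) (left a) (left p) \<and>
        touchT asC (Suc t) (left a) (left q) \<and> touchT asC (Suc t) (left a) (left r))"
  have front: "p \<in> gates C" if "p \<in> set (front k S)" for p
    using that front_props(1) unsat_props(2) critical_gate(1) by blast
  have eq: "(\<exists>p\<in>?F. \<exists>q\<in>?F. \<exists>r\<in>?F.
        left p \<noteq> left q \<and> left p \<noteq> left r \<and> left q \<noteq> left r \<and> touchT asC (Suc t) (enc_binary v) (left p) \<and>
        touchT asC (Suc t) (enc_binary v) (left q) \<and> touchT asC (Suc t) (enc_binary v) (left r)) \<longleftrightarrow>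
     (\<exists>p\<in>set (front k S). \<exists>q\<in>set (front k S). \<exists>r\<in>set (front k S).
        p \<noteq> q \<and> p \<noteq> r \<and> q \<noteq> r \<and> touches v p \<and> touches v q \<and> touches v r)" (is "?L v \<longleftrightarrow> ?R v") for v
  proof -
    have "?L v \<longleftrightarrow> (\<exists>p\<in>set (front k S). \<exists>q\<in>set (front k S). \<exists>r\<in>set (front k S).
        enc_binary p \<noteq> enc_binary q \<and> enc_binary p \<noteq> enc_binary r \<and> enc_binary q \<noteq> enc_binary r \<and> touchT asC (Suc t) (enc_binary v) (enc_binary p) \<and>
        touchT asC (Suc t) (enc_binary v) (enc_binary q) \<and> touchT asC (Suc t) (enc_binary v) (enc_binary r))"
      unfolding frontT_eq front_nodes elems_enc_list set_map bex_simps left_encN ..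
    also have "\<dots> \<longleftrightarrow> ?R v" unfolding enc_binary_inj using touchT_iff[OF front] by blast
    finally show ?thesis .
  qed
  have "filter ?P (map encN (nodes C)) = map encN (filter (\<lambda>(v, l). ?Q v) (nodes C))"
  proof (rule filter_nodes)
    fix v l assume vl: "(v, l) \<in> set (nodes C)"
    have "enc_binary v \<in> elems (encS S) \<longleftrightarrow> v \<in> set S" by auto
    moreover have "left (right (Node (enc_binary v) (enc_label l))) \<noteq> Leaf \<longleftrightarrow> v \<in> L" using lit_label[OF vl] by simp
    ultimately show "?P (Node (enc_binary v) (enc_label l)) \<longleftrightarrow> ?Q v" unfolding left.simps right.simps eq by blast
  qed
  then have "branchT (Suc t) (argT k S) = of_list (map left (map encN (filter (\<lambda>(v, l). ?Q v) (nodes C))))"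
    unfolding branchT_def instT_simps left.simps right.simps to_list_enc_list to_list_of_list by simp
  also have "map left (map encN (filter (\<lambda>(v, l). ?Q v) (nodes C))) = map enc_binary (map fst (filter (\<lambda>(v, l). ?Q v) (nodes C)))"
    by simp
  also have "map fst (filter (\<lambda>(v, l). ?Q v) (nodes C)) = branch k S" unfolding branch_def filter_fst ..
  finally show ?thesis by (simp only: of_list_map_enc)
qed

definition remaining :: "nat \<Rightarrow> nat list \<Rightarrow> nat list" where
  "remaining k S = filter (\<lambda>v. v \<in> L \<and> v \<notin> set (branch k S)) (map fst (nodes C))"

lemma set_remaining: "set (remaining k S) = L - set (branch k S)"
  unfolding remaining_def set_filter set_node_names using verts_split by blast

lemma remainingT_eq: "remainingT (Suc t) (argT k S) = encS (remaining k S)"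
proof -
  let ?Q = "\<lambda>v. v \<in> L \<and> v \<notin> set (branch k S)"
  have "filter (\<lambda>a. left (right a) \<noteq> Leaf \<and> left a \<notin> elems (encS (branch k S))) (map encN (nodes C))
    = map encN (filter (\<lambda>(v, l). ?Q v) (nodes C))"
    by (rule filter_nodes) (use lit_label in auto)
  then have "remainingT (Suc t) (argT k S) = of_list (map left (map encN (filter (\<lambda>(v, l). ?Q v) (nodes C))))"
    unfolding remainingT_def instT_simps left.simps right.simps to_list_enc_list to_list_of_list branchT_eq by simp
  also have "map left (map encN (filter (\<lambda>(v, l). ?Q v) (nodes C))) = map enc_binary (map fst (filter (\<lambda>(v, l). ?Q v) (nodes C)))"
    by simp
  also have "map fst (filter (\<lambda>(v, l). ?Q v) (nodes C)) = remaining k S" unfolding remaining_def filter_fst ..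
  finally show ?thesis by (simp only: of_list_map_enc)
qed

lemma nodesT'_eq: "nodesT' (Suc t) (argT k S) = enc_list encN (nodes (restrict_circuit (set S) (set (branch k S))))"
proof -
  let ?X = "set (branch k S)"
  have "filter (\<lambda>a. (left (right a) \<noteq> Leaf \<and> left a \<notin> elems (encS S) \<and> left a \<notin> elems (encS (branch k S))) \<or>
      (left (right a) = Leaf \<and> keptT (Suc t) nsC asC (encS S) (encS (remaining k S)) (Suc t) (left a))) (map encN (nodes C))
    = map encN (filter (\<lambda>(v, l). v \<in> kept (set S) ?X) (nodes C))"
  proof (rule filter_nodes)
    fix v l assume vl: "(v, l) \<in> set (nodes C)"
    let ?a = "Node (enc_binary v) (enc_label l)"
    have lit: "left (right ?a) \<noteq> Leaf \<longleftrightarrow> v \<in> L" using lit_label[OF vl] by simp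
    have mem: "enc_binary v \<in> elems (encS xs) \<longleftrightarrow> v \<in> set xs" for xs by auto
    have "v \<in> verts C" using vl by (force simp: verts_def)
    show "((left (right ?a) \<noteq> Leaf \<and> left ?a \<notin> elems (encS S) \<and> left ?a \<notin> elems (encS (branch k S))) \<or>
      (left (right ?a) = Leaf \<and> keptT (Suc t) nsC asC (encS S) (encS (remaining k S)) (Suc t) (left ?a))) \<longleftrightarrow> v \<in> kept (set S) ?X"
    proof (cases "v \<in> L")
      case True
      then have "v \<notin> kept_gates (set S) ?X" using gates_lits_disjoint by (auto simp: kept_gates_def)
      then show ?thesis using True lit mem[of S] mem[of "branch k S"] by (auto simp: kept_def simp del: keptT.simps)
    next
      case False
      then have "v \<in> gates C" using \<open>v \<in> verts C\<close> verts_split by auto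
      from keptT_kept_gates[OF this set_remaining, of S k S]
      show ?thesis using False lit by (simp add: kept_def del: keptT.simps)
    qed
  qed
  then show ?thesis
    unfolding nodesT'_def instT_simps left.simps right.simps to_list_enc_list branchT_eq remainingT_eq
    by (simp add: restrict_circuit_def of_list_map_enc del: keptT.simps)
qed

lemma arcsT'_eq: "arcsT' (Suc t) (argT k S) = enc_list encA (arcs (restrict_circuit (set S) (set (branch k S))))"
proof -
  let ?W = "kept (set S) (set (branch k S))"
  let ?N = "elems (nodesT' (Suc t) (argT k S))"
  have mem: "(\<exists>a\<in>?N. left a = enc_binary v) \<longleftrightarrow> v \<in> ?W" if "v \<in> verts C" for v
  proof -
    have "\<exists>l. (v, l) \<in> set (nodes C)" using that by (auto simp: verts_def)
    then show ?thesis unfolding nodesT'_eq by (auto simp: restrict_circuit_def case_prod_beta)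
  qed
  have "filter (\<lambda>e. (\<exists>a\<in>?N. left a = left e) \<and> (\<exists>a\<in>?N. left a = right e)) (map encA (arcs C))
    = map encA (filter (\<lambda>(u, v). u \<in> ?W \<and> v \<in> ?W) (arcs C))"
    unfolding filter_map
  proof (rule arg_cong[where f = "map encA"], rule filter_cong)
    fix e assume e: "e \<in> set (arcs C)"
    obtain u v where uv: "e = (u, v)" by (cases e)
    then have "u \<in> verts C" "v \<in> verts C" using e arc_verts[of u v] by (auto simp: arc_rel_def)
    then show "((\<lambda>e. (\<exists>a\<in>?N. left a = left e) \<and> (\<exists>a\<in>?N. left a = right e)) \<circ> encA) e \<longleftrightarrow> (case e of (u, v) \<Rightarrow> u \<in> ?W \<and> v \<in> ?W)"
      using mem uv by simp
  qed simp
  then show ?thesis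
    unfolding arcsT'_def instT_simps left.simps right.simps to_list_enc_list
    by (simp add: restrict_circuit_def of_list_map_enc)
qed

lemma leafT_eq: "leafT (Suc t) (argT k S) = enc_list enc_instance (leaf k S)"
proof -
  have 1: "evT nsC asC (encS S) (Suc t) (enc_binary (out C)) \<longleftrightarrow> ev (set S) (out C)" for S
    using evT_gate[OF out_gate] .
  have "length (to_list (of_list (to_list (restT (argT k S)) @ to_list (restT (argT k S))))) = 2 * (k - length S)"
    by (simp add: restT_eq)
  then have "of_list (drop (length (to_list (of_list (to_list (restT (argT k S)) @ to_list (restT (argT k S))))))
      (to_list (unsatT (Suc t) (argT k S)))) = enc_list encN (drop (2 * (k - length S)) (unsat_nodes S))"
    by (simp only: unsatT_eq to_list_enc_list drop_map of_list_map_enc)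
  moreover have "enc_list e xs = Leaf \<longleftrightarrow> xs = []" for e :: "nat \<times> label \<Rightarrow> tree" and xs by (cases xs) auto
  moreover have "length (unsat_nodes S) = length (unsat S)" using fst_unsat_nodes by (metis length_map)
  ultimately have 2: "of_list (drop (length (to_list (of_list (to_list (restT (argT k S)) @ to_list (restT (argT k S))))))
      (to_list (unsatT (Suc t) (argT k S)))) \<noteq> Leaf \<longleftrightarrow> 2 * (k - length S) < length (unsat S)"
    by auto
  show ?thesis
    unfolding leafT_def 2 unfolding instT_simps left.simps right.simps remainingT_eq 1 set_remaining leaf_def
      nodesT'_eq arcsT'_eq restT_eq
    by (auto simp: enc_instance_def enc_circuit_def restrict_circuit_def)
qed

lemma stepT_eq: "stepT (Suc t) (Node c (Node (enc_list encS T) (instT k))) =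
  Node (right c) (Node (enc_list encS ([] # concat (map (\<lambda>S. map (\<lambda>x. x # S) (branch k S)) T))) (instT k))"
proof -
  have "concat (map (\<lambda>S. map (\<lambda>x. Node x S) (to_list (branchT (Suc t) (Node S (instT k))))) (map encS T))
    = map encS (concat (map (\<lambda>S. map (\<lambda>x. x # S) (branch k S)) T))"
    by (induct T) (auto simp: branchT_eq)
  then show ?thesis by (simp add: stepT_def of_list_map_enc)
qed

lemma finalT_eq: "finalT (Suc t) (Node c (Node (enc_list encS T) (instT k))) =
  enc_result (Reduced (if k \<le> card L then concat (map (leaf k) T) else []))"
proof -
  have "filter (\<lambda>a. left (right a) \<noteq> Leaf) (map encN (nodes C)) = map encN (filter (\<lambda>(v, l). v \<in> L) (nodes C))"
    by (rule filter_nodes) (use lit_label in auto)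
  moreover have "length (filter (\<lambda>(v, l). v \<in> L) (nodes C)) = card L"
  proof -
    have "length (filter (\<lambda>(v, l). v \<in> L) (nodes C)) = length (filter (\<lambda>v. v \<in> L) (map fst (nodes C)))"
      using filter_fst[of "\<lambda>v. v \<in> L" "nodes C"] by (metis length_map)
    also have "\<dots> = card (set (filter (\<lambda>v. v \<in> L) (map fst (nodes C))))"
      using distinct_nodes by (intro distinct_card[symmetric] distinct_filter)
    also have "set (filter (\<lambda>v. v \<in> L) (map fst (nodes C))) = L"
      unfolding set_filter set_node_names using verts_split by blast
    finally show ?thesis .
  qed
  ultimately have 1: "length (filter (\<lambda>a. left (right a) \<noteq> Leaf) (map encN (nodes C))) = card L" by simp
  have unary: "enc_unary n = Leaf \<longleftrightarrow> n = 0" for n by (cases n) auto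
  have "concat (map (\<lambda>S. to_list (leafT (Suc t) (Node S (instT k)))) (map encS T)) = map enc_instance (concat (map (leaf k) T))"
    by (induct T) (auto simp: leafT_eq)
  moreover have "of_list (drop (length (to_list (of_list (filter (\<lambda>a. left (right a) \<noteq> Leaf) (to_list nsC))))) (to_list (enc_unary k))) = Leaf
    \<longleftrightarrow> k \<le> card L"
    unfolding to_list_of_list to_list_enc_list 1 by (simp add: of_list_replicate unary)
  ultimately show ?thesis
    unfolding finalT_def left.simps right.simps instT_simps to_list_enc_list[of encS] by (simp add: of_list_map_enc)
qed

end

subsection \<open>Running time\<close>

lemma tsize_enc_unary: "tsize (enc_unary n) = 2 * n + 1"
  by (induct n) auto

context wsat_circuit
begin

lemma tsize_instT: "tsize nsC \<le> tsize (instT k)" "2 * k + 2 \<le> tsize (instT k)"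
  by (auto simp: instT_def tsize_enc_unary)

lemma card_L_le_tsize: "card L \<le> tsize (instT k)"
proof -
  have "card L \<le> card (set (map fst (nodes C)))"
    unfolding set_node_names using verts_split by (intro card_mono) auto
  also have "\<dots> \<le> length (to_list nsC)" using card_length[of "map fst (nodes C)"] by simp
  also have "\<dots> \<le> tsize nsC" by (rule length_to_list)
  finally show ?thesis using tsize_instT(1) by (rule order_trans)
qed

lemma tsize_vertex: "v \<in> verts C \<Longrightarrow> tsize (enc_binary v) \<le> tsize (instT k)"
proof -
  assume "v \<in> verts C"
  then obtain l where "(v, l) \<in> set (nodes C)" by (auto simp: verts_def)
  then have "encN (v, l) \<in> set (to_list nsC)" by force
  from tsize_elem[OF this] show ?thesis using tsize_instT(1)[of k] by simp
qed

lemma tsize_search: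
  assumes "i \<le> k"
  defines "N \<equiv> tsize (instT k)"
  shows "tsize (enc_list encS (search k i)) \<le> Suc (length (search k i) * Suc (Suc (N * Suc N)))"
  unfolding enc_list_conv[of encS] length_map[of encS, symmetric]
proof (rule tsize_of_list_le)
  fix x assume "x \<in> set (map encS (search k i))"
  then obtain S where S: "S \<in> set (search k i)" "x = encS S" by auto
  note m = search_mem[OF S(1)]
  have "tsize (of_list (map enc_binary S)) \<le> Suc (length (map enc_binary S) * Suc N)"
    using m verts_split tsize_vertex unfolding N_def by (intro tsize_of_list_le) auto
  also have "\<dots> \<le> Suc (N * Suc N)"
  proof -
    have "length S \<le> N" using m assms(1) tsize_instT(2)[of k] unfolding N_def by linarith
    then show ?thesis unfolding length_map Suc_le_mono by (rule mult_le_mono1)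
  qed
  finally show "tsize x \<le> Suc (N * Suc N)" unfolding S(2) of_list_map_enc .
qed

text \<open>The loop invariant after \<open>i\<close> rounds, with \<open>k - i\<close> rounds left
  on the counter.\<close>

definition stateT :: "nat \<Rightarrow> nat \<Rightarrow> tree" where
  "stateT k i = Node (enc_unary (k - i)) (Node (enc_list encS (search k i)) (instT k))"

lemma stepT_funpow: "(stepT (Suc t) ^^ i) (stateT k 0) = stateT k i"
proof (induct i)
  case (Suc i)
  have "right (enc_unary n) = enc_unary (n - 1)" for n by (cases n) auto
  then show ?case using Suc by (simp add: stateT_def stepT_eq)
qed simp

text \<open>There are at most \<open>?H\<close> assignments, each with at most \<open>k\<close>
  entries, and \<open>k\<close> as well as the size of each entry is bounded by the size of the
  instance. The square is a convenient coarse form of this product.\<close>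

lemma tsize_stateT:
  assumes "i \<le> k"
  shows "tsize (stateT k i) \<le> 9 * ((8 * k + 5 + 4 * circuit_genus C) ^ k * tsize (instT k)) ^ 2"
proof -
  let ?N = "tsize (instT k)" and ?H = "(8 * k + 5 + 4 * circuit_genus C) ^ k"
  have "length (search k i) \<le> (8 * k + 5 + 4 * circuit_genus C) ^ i" by (rule length_search)
  also have "\<dots> \<le> ?H" using assms by (intro power_increasing) auto
  finally have len: "length (search k i) \<le> ?H" .
  have H: "1 \<le> ?H" by simp
  have "tsize (stateT k i) \<le> ?N + (Suc (length (search k i) * Suc (Suc (?N * Suc ?N)))) + ?N + 2"
    using tsize_search[OF assms] tsize_instT(2)[of k] by (simp add: stateT_def tsize_enc_unary)
  also have "\<dots> \<le> ?N + Suc (?H * Suc (Suc (?N * Suc ?N))) + ?N + 2"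
    using len by (intro add_mono order_refl) (simp only: Suc_le_mono, intro mult_right_mono, auto)
  also have "\<dots> = 2 * ?N + 3 + ?H * (?N * ?N + ?N + 2)" by (simp add: algebra_simps)
  also have "\<dots> \<le> ?H * (2 * ?N + 3) + ?H * (?N * ?N + ?N + 2)" using H by (intro add_right_mono) simp
  also have "\<dots> = ?H * (?N * ?N + 3 * ?N + 5)" by (simp add: algebra_simps)
  also have "\<dots> \<le> ?H * (9 * (?N * ?N))"
  proof (rule mult_left_mono)
    have "1 \<le> ?N" by simp
    then have "?N * 1 \<le> ?N * ?N" by (rule mult_le_mono2)
    then have "?N \<le> ?N * ?N" by simp
    then show "?N * ?N + 3 * ?N + 5 \<le> 9 * (?N * ?N)" using \<open>1 \<le> ?N\<close> by linarith
  qed simp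
  also have "\<dots> \<le> (?H * ?H) * (9 * (?N * ?N))" using H by (intro mult_right_mono) auto
  also have "\<dots> = 9 * (?H * ?N) ^ 2" by (simp add: power2_eq_square algebra_simps)
  finally show ?thesis .
qed

end

text \<open>One program serves all circuits for the given \<open>t\<close>. The search loop runs
  \<open>k\<close> times on states that are polynomial in the number of search nodes times the input
  size; the genus occurs only in this bound.\<close>

lemma reduction_program:
  obtains p c where "\<And>C k. wsat_mono_instance t C \<Longrightarrow>
    \<exists>\<tau>. runs p (enc_instance (C, k)) (enc_result (Reduced (wsat_circuit.reduction C k))) \<tau> \<and>
      \<tau> \<le> c * ((8 * k + 5 + 4 * circuit_genus C) ^ k * tsize (enc_instance (C, k))) ^ c"
proof -
  let ?step = "stepT (Suc t)" and ?final = "finalT (Suc t)"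
  let ?init = "\<lambda>x. Node (right x) (Node (Node Leaf Leaf) x)"
  have "ptime ?init" by (intro ptime_intros)
  then obtain p1 c1 where p1: "\<And>x. \<exists>\<tau>. runs p1 x (?init x) \<tau> \<and> \<tau> \<le> c1 * tsize x ^ c1"
    by (rule ptimeE) blast
  obtain p2 c2 where p2: "\<And>m x M. (\<And>i. i < m \<Longrightarrow> left ((?step ^^ i) x) \<noteq> Leaf) \<Longrightarrow> left ((?step ^^ m) x) = Leaf \<Longrightarrow>
      (\<And>i. i \<le> m \<Longrightarrow> tsize ((?step ^^ i) x) \<le> M) \<Longrightarrow>
      \<exists>\<tau>. runs p2 x ((?step ^^ m) x) \<tau> \<and> \<tau> \<le> (m + 1) * (c2 * M ^ c2)"
    by (rule while_runs[OF ptime_stepT]) blast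
  obtain p3 c3 where p3: "\<And>x. \<exists>\<tau>. runs p3 x (?final x) \<tau> \<and> \<tau> \<le> c3 * tsize x ^ c3"
    by (rule ptimeE[OF ptime_finalT]) blast
  let ?p = "PSeq p1 (PSeq p2 p3)"
  \<comment> \<open>The summands \<open>c1\<close>, \<open>c2\<close>, \<open>c3\<close> come from
    the three stages and 2 from the cost of the two sequencings; \<open>c\<close> then absorbs the
    factor \<open>9 ^ e\<close> and the exponent \<open>2 * e\<close> that come from
    \<open>M ^ e\<close>.\<close>
  define e where "e = c1 + c2 + c3 + 2"
  define c where "c = e * 9 ^ e + 2 * e"
  show thesis
  proof (rule that[of ?p c])
    fix C k assume "wsat_mono_instance t C"
    then interpret wsat_circuit t C by unfold_locales
    let ?N = "tsize (instT k)" and ?H = "(8 * k + 5 + 4 * circuit_genus C) ^ k"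
    define M where "M = 9 * (?H * ?N) ^ 2"
    have size: "tsize (stateT k i) \<le> M" if "i \<le> k" for i using tsize_stateT[OF that] by (simp add: M_def)
    have HN: "1 \<le> ?H * ?N" by simp
    have "?N \<le> tsize (stateT k 0)" by (simp add: stateT_def)
    then have NM: "?N \<le> M" using size[of 0] by simp
    have M1: "1 \<le> M" using NM tsize_ge_1[of "instT k"] by linarith
    have init: "?init (instT k) = stateT k 0" by (simp add: stateT_def)
    obtain a1 where a1: "runs p1 (instT k) (stateT k 0) a1" "a1 \<le> c1 * ?N ^ c1"
      using p1[of "instT k"] unfolding init by blast
    have "\<exists>\<tau>. runs p2 (stateT k 0) ((?step ^^ k) (stateT k 0)) \<tau> \<and> \<tau> \<le> (k + 1) * (c2 * M ^ c2)"
    proof (rule p2)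
      show "left ((?step ^^ i) (stateT k 0)) \<noteq> Leaf" if "i < k" for i
        unfolding stepT_funpow using that by (cases "k - i") (auto simp: stateT_def)
      show "left ((?step ^^ k) (stateT k 0)) = Leaf" unfolding stepT_funpow by (simp add: stateT_def)
      show "tsize ((?step ^^ i) (stateT k 0)) \<le> M" if "i \<le> k" for i unfolding stepT_funpow using size that .
    qed
    then obtain a2 where a2: "runs p2 (stateT k 0) (stateT k k) a2" "a2 \<le> (k + 1) * (c2 * M ^ c2)"
      unfolding stepT_funpow by blast
    obtain a3 where a3: "runs p3 (stateT k k) (?final (stateT k k)) a3" "a3 \<le> c3 * tsize (stateT k k) ^ c3"
      using p3 by blast
    have fin: "?final (stateT k k) = enc_result (Reduced (reduction k))"
      unfolding stateT_def finalT_eq reduction_def ..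
    let ?\<tau> = "a1 + (a2 + a3 + tsize (stateT k 0)) + ?N"
    have run: "runs ?p (instT k) (enc_result (Reduced (reduction k))) ?\<tau>"
      using runs_Seq[OF a1(1) runs_Seq[OF a2(1) a3(1)]] unfolding fin .
    have "a1 \<le> c1 * M ^ e"
    proof -
      have "a1 \<le> c1 * ?N ^ c1" by fact
      also have "\<dots> \<le> c1 * M ^ c1" using NM by (intro mult_left_mono power_mono) auto
      also have "\<dots> \<le> c1 * M ^ e" using M1 by (intro mult_left_mono power_increasing) (auto simp: e_def)
      finally show ?thesis .
    qed
    moreover have "a2 \<le> c2 * M ^ e"
    proof -
      have "k + 1 \<le> M" using tsize_instT(2)[of k] NM by linarith
      then have "a2 \<le> M * (c2 * M ^ c2)" using a2(2) by (meson mult_right_mono le0 order_trans)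
      also have "\<dots> = c2 * M ^ (c2 + 1)" by simp
      also have "\<dots> \<le> c2 * M ^ e" using M1 by (intro mult_left_mono power_increasing) (auto simp: e_def)
      finally show ?thesis .
    qed
    moreover have "a3 \<le> c3 * M ^ e"
    proof -
      have "a3 \<le> c3 * tsize (stateT k k) ^ c3" by fact
      also have "\<dots> \<le> c3 * M ^ c3" using size[of k] by (intro mult_left_mono power_mono) auto
      also have "\<dots> \<le> c3 * M ^ e" using M1 by (intro mult_left_mono power_increasing) (auto simp: e_def)
      finally show ?thesis .
    qed
    moreover have "M \<le> M ^ e" using M1 by (intro self_le_power) (auto simp: e_def)
    ultimately have "?\<tau> \<le> c1 * M ^ e + c2 * M ^ e + c3 * M ^ e + 2 * M ^ e"
      using size[of 0] NM by linarith
    also have "\<dots> = e * M ^ e" by (simp add: e_def algebra_simps)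
    also have "\<dots> = e * 9 ^ e * (?H * ?N) ^ (2 * e)"
      unfolding M_def by (simp add: power_mult_distrib flip: power_mult)
    also have "\<dots> \<le> c * (?H * ?N) ^ c"
    proof (rule mult_mono)
      show "(?H * ?N) ^ (2 * e) \<le> (?H * ?N) ^ c" using HN by (intro power_increasing) (auto simp: c_def)
    qed (auto simp: c_def)
    finally show "\<exists>\<tau>. runs ?p (enc_instance (C, k)) (enc_result (Reduced (reduction k))) \<tau> \<and>
      \<tau> \<le> c * (?H * tsize (enc_instance (C, k))) ^ c"
      using run unfolding enc_instance_eq by blast
  qed
qed

section \<open>Computable bounds\<close>

lemma ptime_runs: "ptime F \<Longrightarrow> \<exists>p. \<forall>x. \<exists>\<tau>. runs p x (F x) \<tau>"
  unfolding ptime_def by blast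

lemma computable_const: "computable (\<lambda>_. c)"
  unfolding computable_def using ptime_runs[OF ptime_const[of "enc_unary c"]] by blast

lemma computable_id: "computable (\<lambda>n. n)"
  unfolding computable_def using ptime_runs[OF ptime_id] by blast

lemma computable_binary:
  assumes f: "computable f" "computable g" and p: "\<And>a b. \<exists>\<tau>. runs p (Node (enc_unary a) (enc_unary b)) (enc_unary (h a b)) \<tau>"
  shows "computable (\<lambda>n. h (f n) (g n))"
proof -
  obtain pf pg where pf: "\<And>n. \<exists>\<tau>. runs pf (enc_unary n) (enc_unary (f n)) \<tau>"
    and pg: "\<And>n. \<exists>\<tau>. runs pg (enc_unary n) (enc_unary (g n)) \<tau>"
    using f by (auto simp: computable_def)
  have "\<exists>\<tau>. runs (PSeq (PPair pf pg) p) (enc_unary n) (enc_unary (h (f n) (g n))) \<tau>" for n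
    using pf[of n] pg[of n] p[of "f n" "g n"] by (meson runs_Pair runs_Seq)
  then show ?thesis unfolding computable_def by blast
qed

lemma computable_add: "computable f \<Longrightarrow> computable g \<Longrightarrow> computable (\<lambda>n. f n + g n)"
proof -
  have "ptime (\<lambda>x. of_list (to_list (left x) @ to_list (right x)))" by (intro ptime_intros)
  from ptime_runs[OF this] obtain p where p: "\<And>x. \<exists>\<tau>. runs p x (of_list (to_list (left x) @ to_list (right x))) \<tau>" by blast
  have "\<exists>\<tau>. runs p (Node (enc_unary a) (enc_unary b)) (enc_unary (a + b)) \<tau>" for a b
    using p[of "Node (enc_unary a) (enc_unary b)"] by (simp add: of_list_replicate flip: replicate_add)
  then show "computable f \<Longrightarrow> computable g \<Longrightarrow> computable (\<lambda>n. f n + g n)" by (rule computable_binary[rotated 2])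
qed

definition multT :: "tree \<Rightarrow> tree \<Rightarrow> tree" where
  "multT x y = of_list (concat (map (\<lambda>_. to_list y) (to_list x)))"

lemma multT_eq: "multT (enc_unary a) (enc_unary b) = enc_unary (a * b)"
proof -
  have "concat (replicate a (replicate b Leaf)) = replicate (a * b) Leaf"
    by (induct a) (auto simp: replicate_add)
  then show ?thesis by (simp add: multT_def of_list_replicate)
qed

lemma ptime_multT: "ptime f \<Longrightarrow> ptime g \<Longrightarrow> ptime (\<lambda>x. multT (f x) (g x))"
  unfolding multT_def by (intro ptime_concat_map ptime_weaken)

lemma computable_mult: "computable f \<Longrightarrow> computable g \<Longrightarrow> computable (\<lambda>n. f n * g n)"
proof -
  have "ptime (\<lambda>x. multT (left x) (right x))" by (intro ptime_multT ptime_intros)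
  from ptime_runs[OF this] obtain p where p: "\<And>x. \<exists>\<tau>. runs p x (multT (left x) (right x)) \<tau>" by blast
  have "\<exists>\<tau>. runs p (Node (enc_unary a) (enc_unary b)) (enc_unary (a * b)) \<tau>" for a b
    using p[of "Node (enc_unary a) (enc_unary b)"] by (simp add: multT_eq)
  then show "computable f \<Longrightarrow> computable g \<Longrightarrow> computable (\<lambda>n. f n * g n)" by (rule computable_binary[rotated 2])
qed

text \<open>Repeated unary multiplication, which is far from polynomial. Only termination matters,
  so the largest state that occurs serves as the size bound.\<close>

lemma computable_power: "computable f \<Longrightarrow> computable g \<Longrightarrow> computable (\<lambda>n. f n ^ g n)"
proof -
  let ?step = "\<lambda>s. Node (right (left s)) (Node (left (right s)) (multT (left (right s)) (right (right s))))"
  let ?st = "\<lambda>a b i. Node (enc_unary (b - i)) (Node (enc_unary a) (enc_unary (a ^ i)))"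
  have "ptime ?step" by (intro ptime_intros ptime_multT)
  then obtain p c where p: "\<And>m x M. (\<And>i. i < m \<Longrightarrow> left ((?step ^^ i) x) \<noteq> Leaf) \<Longrightarrow> left ((?step ^^ m) x) = Leaf \<Longrightarrow>
      (\<And>i. i \<le> m \<Longrightarrow> tsize ((?step ^^ i) x) \<le> M) \<Longrightarrow>
      \<exists>\<tau>. runs p x ((?step ^^ m) x) \<tau> \<and> \<tau> \<le> (m + 1) * (c * M ^ c)"
    by (rule while_runs) blast
  have st: "(?step ^^ i) (?st a b 0) = ?st a b i" for a b i
  proof (induct i)
    case (Suc i)
    have "right (enc_unary n) = enc_unary (n - 1)" for n by (cases n) auto
    then show ?case using Suc by (simp add: multT_eq)
  qed simp
  have loop: "\<exists>\<tau>. runs p (?st a b 0) (?st a b b) \<tau>" for a b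
  proof -
    have "\<exists>\<tau>. runs p (?st a b 0) ((?step ^^ b) (?st a b 0)) \<tau> \<and>
      \<tau> \<le> (b + 1) * (c * (Max ((\<lambda>i. tsize (?st a b i)) ` {..b})) ^ c)"
    proof (rule p)
      show "left ((?step ^^ i) (?st a b 0)) \<noteq> Leaf" if "i < b" for i
        unfolding st using that by (cases "b - i") auto
      show "left ((?step ^^ b) (?st a b 0)) = Leaf" unfolding st by simp
      show "tsize ((?step ^^ i) (?st a b 0)) \<le> Max ((\<lambda>i. tsize (?st a b i)) ` {..b})" if "i \<le> b" for i
        unfolding st using that by (intro Max_ge) auto
    qed
    then show ?thesis unfolding st by blast
  qed
  have "ptime (\<lambda>x. Node (right x) (Node (left x) (Node Leaf Leaf)))" by (intro ptime_intros)
  from ptime_runs[OF this] obtain q where q: "\<And>x. \<exists>\<tau>. runs q x (Node (right x) (Node (left x) (Node Leaf Leaf))) \<tau>" by blast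
  have "ptime (\<lambda>x. right (right x))" by (intro ptime_intros)
  from ptime_runs[OF this] obtain r where r: "\<And>x. \<exists>\<tau>. runs r x (right (right x)) \<tau>" by blast
  have "\<exists>\<tau>. runs (PSeq q (PSeq p r)) (Node (enc_unary a) (enc_unary b)) (enc_unary (a ^ b)) \<tau>" for a b
  proof -
    have "\<exists>\<tau>. runs q (Node (enc_unary a) (enc_unary b)) (?st a b 0) \<tau>"
      using q[of "Node (enc_unary a) (enc_unary b)"] by simp
    moreover have "\<exists>\<tau>. runs r (?st a b b) (enc_unary (a ^ b)) \<tau>" using r[of "?st a b b"] by simp
    ultimately show ?thesis using loop[where a = a and b = b] by (meson runs_Seq)
  qed
  then show "computable f \<Longrightarrow> computable g \<Longrightarrow> computable (\<lambda>n. f n ^ g n)" by (rule computable_binary[rotated 2])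
qed

text \<open>Unbounded search by a while loop, whose condition \<open>k - s n\<close> is nonzero as
  long as \<open>s n\<close> is too small. Here the effectiveness of the little-o is used.\<close>

lemma computable_search:
  assumes "computable s" "\<And>k. \<exists>n. k \<le> s n"
  shows "computable (\<lambda>k. LEAST n. k \<le> s n)"
proof -
  obtain ps where ps: "\<And>n. \<exists>\<tau>. runs ps (enc_unary n) (enc_unary (s n)) \<tau>"
    using assms(1) by (auto simp: computable_def)
  have "ptime (\<lambda>x. of_list (drop (length (to_list (left x))) (to_list (right x))))" by (intro ptime_intros)
  from ptime_runs[OF this] obtain pd where
    pd: "\<And>x. \<exists>\<tau>. runs pd x (of_list (drop (length (to_list (left x))) (to_list (right x)))) \<tau>" by blast
  have "ptime (\<lambda>x. Node (left x) (Node Leaf (right x)))" by (intro ptime_intros)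
  from ptime_runs[OF this] obtain pb where pb: "\<And>x. \<exists>\<tau>. runs pb x (Node (left x) (Node Leaf (right x))) \<tau>" by blast
  let ?st = "\<lambda>k n. Node (enc_unary k) (enc_unary n)"
  let ?c = "PSeq (PPair (PSeq PRight ps) PLeft) pd" and ?w = "PWhile (PSeq (PPair (PSeq PRight ps) PLeft) pd) pb"
  have c: "\<exists>\<tau>. runs ?c (?st k n) (enc_unary (k - s n)) \<tau>" for k n
  proof -
    have 1: "runs PRight (?st k n) (enc_unary n) (tsize (?st k n))" using runs_Right[of "?st k n"] by simp
    have 2: "runs PLeft (?st k n) (enc_unary k) (tsize (?st k n))" using runs_Left[of "?st k n"] by simp
    have 3: "\<exists>\<tau>. runs pd (Node (enc_unary (s n)) (enc_unary k)) (enc_unary (k - s n)) \<tau>"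
      using pd[of "Node (enc_unary (s n)) (enc_unary k)"] by (simp add: of_list_replicate)
    show ?thesis using 1 2 3 ps[of n] by (meson runs_Seq runs_Pair)
  qed
  have w: "\<exists>\<tau>. runs ?w (?st k n) (?st k (LEAST n. k \<le> s n)) \<tau>" if "n \<le> (LEAST n. k \<le> s n)" for k n
    using that
  proof (induction n rule: inc_induct)
    case base
    have "k \<le> s (LEAST n. k \<le> s n)" using assms(2) by (rule LeastI_ex)
    then have "\<exists>\<tau>. runs ?c (?st k (LEAST n. k \<le> s n)) Leaf \<tau>" using c[of k "LEAST n. k \<le> s n"] by simp
    then show ?case by (meson runs_While_stop)
  next
    case (step n)
    have "\<not> k \<le> s n" using step(2) by (rule not_less_Least)
    then have "enc_unary (k - s n) \<noteq> Leaf" by (cases "k - s n") auto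
    moreover have "\<exists>\<tau>. runs pb (?st k n) (?st k (Suc n)) \<tau>" using pb[of "?st k n"] by simp
    ultimately show ?case using c[of k n] step.IH by (meson runs_While_step)
  qed
  have "\<exists>\<tau>. runs (PSeq (PPair PId PNil) (PSeq ?w PRight)) (enc_unary k) (enc_unary (LEAST n. k \<le> s n)) \<tau>" for k
  proof -
    have 1: "\<exists>\<tau>. runs (PPair PId PNil) (enc_unary k) (?st k 0) \<tau>"
      using runs_Pair[OF runs_Id runs_Nil] by fastforce
    have 2: "\<exists>\<tau>. runs PRight (?st k (LEAST n. k \<le> s n)) (enc_unary (LEAST n. k \<le> s n)) \<tau>"
      using runs_Right[of "?st k (LEAST n. k \<le> s n)"] by (metis right.simps(2))
    show ?thesis using 1 2 w[of 0 k] by (meson runs_Seq le0)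
  qed
  then show ?thesis unfolding computable_def by blast
qed

text \<open>
  If \<open>s n \<ge> k\<close>, then \<open>g n\<close> to the power \<open>k\<close> is at most \<open>n\<close>; otherwise \<open>n\<close>, and hence \<open>g n\<close>, is bounded
  in terms of \<open>k\<close>, computably because \<open>s\<close> is.
\<close>

lemma subpolynomial_power_bound:
  assumes "subpolynomial g"
  obtains h where "computable h" "\<And>k n. 1 \<le> n \<Longrightarrow> (8 * k + 5 + 4 * g n) ^ k \<le> h k * n"
proof -
  obtain e s where s: "computable s" "mono s" "filterlim s at_top at_top"
    and es: "\<forall>\<^sub>F n in sequentially. e n \<le> 1 / real (s n)"
    and ge: "\<forall>\<^sub>F n in sequentially. real (g n) \<le> real n powr e n"
    using assms by (auto simp: subpolynomial_def effective_smallo_def)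
  have "\<forall>\<^sub>F n in sequentially. 1 \<le> s n" using s(3) by (auto simp: filterlim_at_top)
  with es ge have "\<forall>\<^sub>F n in sequentially. e n \<le> 1 / real (s n) \<and> real (g n) \<le> real n powr e n \<and> 1 \<le> s n"
    by eventually_elim auto
  then obtain n0 where n0: "\<And>n. n0 \<le> n \<Longrightarrow> e n \<le> 1 / real (s n) \<and> real (g n) \<le> real n powr e n \<and> 1 \<le> s n"
    by (auto simp: eventually_sequentially)
  have ex: "\<exists>n. k \<le> s n" for k
  proof -
    have "\<forall>\<^sub>F n in sequentially. k \<le> s n" using s(3) by (auto simp: filterlim_at_top)
    then show ?thesis by (auto simp: eventually_sequentially)
  qed
  define N where "N k = (LEAST n. k \<le> s n)" for k
  have Nk: "k \<le> s (N k)" for k unfolding N_def using ex by (rule LeastI_ex)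
  \<comment> \<open>Covers the finitely many \<open>n\<close> for which the asymptotic estimates may
    fail.\<close>
  define G where "G = (\<Sum>n<n0. g n)"
  \<comment> \<open>Dominates the base if \<open>g n\<close> is at most \<open>G + N k\<close> or
    zero; the 9 in place of 5 leaves room for the factor \<open>8 * k + 9\<close> of the other
    case.\<close>
  define h where "h k = (8 * k + 9 + 4 * (G + N k)) ^ k" for k
  have pw: "real (g n) \<le> real n powr (1 / real (s n))" if "n0 \<le> n" "1 \<le> n" for n
  proof -
    have "real (g n) \<le> real n powr e n" using n0 that by blast
    also have "\<dots> \<le> real n powr (1 / real (s n))" using n0[OF that(1)] that(2) by (intro powr_mono) auto
    finally show ?thesis .
  qed
  have bound: "(8 * k + 5 + 4 * g n) ^ k \<le> h k * n" if n: "1 \<le> n" for k n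
  proof (cases "g n \<le> G + N k \<or> g n = 0")
    case True
    then have "(8 * k + 5 + 4 * g n) ^ k \<le> h k" unfolding h_def by (intro power_mono) auto
    also have "\<dots> \<le> h k * n" using n by simp
    finally show ?thesis .
  next
    case False
    have big: "n0 \<le> n"
    proof (rule ccontr)
      assume "\<not> n0 \<le> n"
      then have "g n \<le> G" unfolding G_def by (intro member_le_sum) auto
      then show False using False by auto
    qed
    \<comment> \<open>Otherwise \<open>n\<close> is smaller than \<open>N k\<close> by monotonicity
      of \<open>s\<close>. The exponent \<open>1 / s n\<close> is at most 1, so \<open>g n\<close>
      is at most \<open>n\<close>, against the case assumption.\<close>
    have sk: "k \<le> s n"
    proof (rule ccontr)
      assume "\<not> k \<le> s n"
      then have "\<not> N k \<le> n" using Nk[of k] monoD[OF s(2), of "N k" n] by auto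
      have "real (g n) \<le> real n powr (1 / real (s n))" by (rule pw[OF big n])
      also have "\<dots> \<le> real n powr 1" using n n0[OF big] by (intro powr_mono) auto
      finally have "g n \<le> n" using n by simp
      then show False using False \<open>\<not> N k \<le> n\<close> by auto
    qed
    have "real (g n ^ k) \<le> (real n powr (1 / real (s n))) ^ k"
      unfolding of_nat_power using pw[OF big n] by (intro power_mono) auto
    also have "\<dots> = real n powr (real k / real (s n))"
      using n by (simp add: powr_powr flip: powr_realpow)
    also have "\<dots> \<le> real n powr 1" using n sk n0[OF big] by (intro powr_mono) auto
    finally have gk: "g n ^ k \<le> n" using n by simp
    \<comment> \<open>As \<open>g n\<close> is at least 1 here, the additive terms become a factor,
      whose power depends on \<open>k\<close> only.\<close>
    have "8 * k + 5 + 4 * g n \<le> (8 * k + 9) * g n" using False by (cases "g n") (auto simp: algebra_simps)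
    then have "(8 * k + 5 + 4 * g n) ^ k \<le> ((8 * k + 9) * g n) ^ k" by (intro power_mono) auto
    also have "\<dots> = (8 * k + 9) ^ k * g n ^ k" by (rule power_mult_distrib)
    also have "\<dots> \<le> h k * n" unfolding h_def using gk by (intro mult_mono power_mono) auto
    finally show ?thesis .
  qed
  have "computable h" unfolding h_def N_def
    by (intro computable_power computable_add computable_mult computable_const computable_id computable_search s(1) ex)
  then show thesis using that[OF _ bound] by blast
qed

theorem theorem5:
  fixes t :: nat and g :: "nat \<Rightarrow> nat"
  assumes "t \<ge> 2" and "subpolynomial g"
  shows "\<exists>(p :: prog) (f :: nat \<Rightarrow> nat) (c :: nat) (h :: nat \<Rightarrow> nat) (d :: nat).
    computable f \<and> computable h \<and>
    (\<forall>C k n. wsat_mono_instance t C \<and> n = card (variables C) \<and> circuit_genus C \<le> g n \<longrightarrow>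
      (\<exists>r \<tau>. runs p (enc_instance (C, k)) (enc_result r) \<tau> \<and>
        \<tau> \<le> f k * tsize (enc_instance (C, k)) ^ c \<and>
        (case r of
          Decided b \<Rightarrow> b \<longleftrightarrow> yes_instance C k
        | Reduced Is \<Rightarrow>
            length Is \<le> h k * n ^ d \<and>
            (yes_instance C k \<longleftrightarrow> (\<exists>(C', k') \<in> set Is. yes_instance C' k')) \<and>
            (\<forall>(C', k') \<in> set Is.
              wsat_mono_instance t C' \<and> k' \<le> k \<and>
              card (critical_gates C') \<le> 2 * k' \<and>
              (\<forall>x \<in> variables C'. card (critical_gates_of_var C' x) \<le> 2) \<and>
              circuit_genus C' \<le> g n))))"
proof -
  obtain h where h: "computable h" "\<And>k n. 1 \<le> n \<Longrightarrow> (8 * k + 5 + 4 * g n) ^ k \<le> h k * n"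
    using subpolynomial_power_bound[OF assms(2)] by blast
  obtain p c where p: "\<And>C k. wsat_mono_instance t C \<Longrightarrow>
    \<exists>\<tau>. runs p (enc_instance (C, k)) (enc_result (Reduced (wsat_circuit.reduction C k))) \<tau> \<and>
      \<tau> \<le> c * ((8 * k + 5 + 4 * circuit_genus C) ^ k * tsize (enc_instance (C, k))) ^ c"
    by (rule reduction_program[of t]) blast
  show ?thesis
  proof (rule exI[of _ p], rule exI[of _ "\<lambda>k. c * h k ^ c"], rule exI[of _ "2 * c"], rule exI[of _ h],
      rule exI[of _ 1], intro conjI allI impI)
    show "computable (\<lambda>k. c * h k ^ c)" by (intro computable_mult computable_power computable_const h(1))
    show "computable h" by (rule h(1))
    fix C k n
    assume as: "wsat_mono_instance t C \<and> n = card (variables C) \<and> circuit_genus C \<le> g n"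
    then interpret wsat_circuit t C by unfold_locales auto
    let ?N = "tsize (enc_instance (C, k))" and ?H = "(8 * k + 5 + 4 * circuit_genus C) ^ k"
    have n: "n = card L" "1 \<le> n" using as card_variables card_variables_pos by auto
    have "?H \<le> (8 * k + 5 + 4 * g n) ^ k" using as by (intro power_mono) auto
    also have "\<dots> \<le> h k * n" by (rule h(2)[OF n(2)])
    finally have H: "?H \<le> h k * n" .
    obtain \<tau> where \<tau>: "runs p (enc_instance (C, k)) (enc_result (Reduced (reduction k))) \<tau>" "\<tau> \<le> c * (?H * ?N) ^ c"
      using p as by blast
    have "n \<le> ?N" using card_L_le_tsize[of k] n enc_instance_eq by simp
    \<comment> \<open>The factor \<open>n\<close> in the bound on the search nodes is absorbed into
      the input size, which doubles the exponent.\<close>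
    then have "?H * ?N \<le> h k * ?N * ?N" using H by (meson mult_le_mono le_refl order_trans mult_le_mono2)
    then have "c * (?H * ?N) ^ c \<le> c * (h k * ?N * ?N) ^ c" by (intro mult_left_mono power_mono) auto
    also have "\<dots> = c * h k ^ c * ?N ^ (2 * c)" by (simp add: power_mult_distrib mult_2 power_add)
    finally have time: "\<tau> \<le> c * h k ^ c * ?N ^ (2 * c)" using \<tau>(2) by (rule order_trans[rotated])
    have "length (reduction k) \<le> h k * n ^ 1" using length_reduction[of k] H by simp
    moreover have "t \<ge> 1" using assms(1) by simp
    note red = reduction_correct[OF this, of k]
    have "\<forall>(C', k') \<in> set (reduction k). wsat_mono_instance t C' \<and> k' \<le> k \<and>
              card (critical_gates C') \<le> 2 * k' \<and>
              (\<forall>x \<in> variables C'. card (critical_gates_of_var C' x) \<le> 2) \<and> circuit_genus C' \<le> g n"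
      using red(2) as by fastforce
    ultimately show "\<exists>r \<tau>. runs p (enc_instance (C, k)) (enc_result r) \<tau> \<and>
        \<tau> \<le> c * h k ^ c * ?N ^ (2 * c) \<and>
        (case r of
          Decided b \<Rightarrow> b \<longleftrightarrow> yes_instance C k
        | Reduced Is \<Rightarrow>
            length Is \<le> h k * n ^ 1 \<and>
            (yes_instance C k \<longleftrightarrow> (\<exists>(C', k') \<in> set Is. yes_instance C' k')) \<and>
            (\<forall>(C', k') \<in> set Is.
              wsat_mono_instance t C' \<and> k' \<le> k \<and>
              card (critical_gates C') \<le> 2 * k' \<and>
              (\<forall>x \<in> variables C'. card (critical_gates_of_var C' x) \<le> 2) \<and>
              circuit_genus C' \<le> g n))"
      using \<tau>(1) time red(1) by (intro exI[of _ "Reduced (reduction k)"] exI[of _ \<tau>]) simp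
  qed
qed

end
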